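(* Let $n\ge 1$ and $T>0$. Let $a^{ij},b:\mathbb{R}^n\times[0,T]\to\mathbb{R}$ ($1\le i,j\le n$) be continuous functions such that for every $(p,t)$ the matrix $A(p,t)=(a^{ij}(p,t))$ is symmetric and positive semi-definite. Suppose there is a continuous function $\alpha:[0,\infty)\times[0,T]\to\mathbb{R}$ with $\alpha>0$ everywhere and $$\alpha(R,t)\le R^2\inf\Big\{\frac{v^{T}A(p,t)v}{(v\cdot p)^2}\;:\; p,v\in\mathbb{R}^n,\ |p|=R,\ v\cdot p\neq 0\Big\}\quad\text{for all } R>0,\ t\in[0,T].$$ Let $u:\mathbb{R}^n\times[0,T]\to\mathbb{R}$ be a continuous viscosity solution of $$u_t=a^{ij}(Du,t)D_iD_ju+b(Du,t)$$ (summation over $i,j$) on $\mathbb{R}^n\times(0,T)$, which is spatially periodic: there is a lattice $\Lambda\subset\mathbb{R}^n$ of rank $n$ with $u(x+\gamma,t)=u(x,t)$ for all $\gamma\in\Lambda$, $x\in\mathbb{R}^n$, $t\in[0,T]$. Define $$\omega(s,t)=\sup\Big\{\tfrac{u(y,t)-u(x,t)}{2}\;:\;x,y\in\mathbb{R}^n,\ \tfrac{|y-x|}{2}=s\Big\}.$$ Then $\omega$ is a viscosity subsolution of the one-dimensional equation $\phi_t=\alpha(|\phi'|,t)\phi''$ on $(0,\infty)\times(0,T)$; that is, whenever $\phi$ is a smooth function near $(s_0,t_0)$ with $s_0>0$, $0<t_0<T$, such that $\omega-\phi$ has a local maximum at $(s_0,t_0)$, then at $(s_0,t_0)$ $$\phi_t\le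 \alpha(|\phi'|,t_0)\,\phi'' ,$$ where $'$ denotes differentiation in $s$.
   Context: Viscosity solutions of $u_t+F(x,t,u,Du,D^2u)=0$ (here $F(x,t,r,p,X)=-\operatorname{tr}(A(p,t)X)-b(p,t)$, continuous and degenerate elliptic): a continuous $u$ is a viscosity subsolution if for every smooth $\varphi$ such that $u-\varphi$ has a local maximum at $z_0=(x_0,t_0)$ in the open domain, $\varphi_t(z_0)+F(z_0,u(z_0),D\varphi(z_0),D^2\varphi(z_0))\le 0$; a viscosity supersolution if for every smooth $\varphi$ such that $u-\varphi$ has a local minimum at $z_0$, $\varphi_t(z_0)+F(z_0,u(z_0),D\varphi(z_0),D^2\varphi(z_0))\ge 0$; a viscosity solution is a continuous function that is both. The function $\omega$ is called the (optimal) modulus of continuity of $u(\cdot,t)$. *)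

theory Defs
  imports "HOL-Analysis.Analysis"
begin

definition pdir :: "('a::real_normed_vector \<Rightarrow> real) \<Rightarrow> 'a \<Rightarrow> 'a \<Rightarrow> real" where
  "pdir f v z = deriv (\<lambda>s. f (z + s *\<^sub>R v)) 0"

fun iter_pdir :: "'a::real_normed_vector list \<Rightarrow> ('a \<Rightarrow> real) \<Rightarrow> 'a \<Rightarrow> real" where
  "iter_pdir [] f = f"
| "iter_pdir (v # vs) f = pdir (iter_pdir vs f) v"

definition smooth_on :: "'a::real_normed_vector set \<Rightarrow> ('a \<Rightarrow> real) \<Rightarrow> bool" where
  "smooth_on S f \<longleftrightarrow>
     (\<forall>vs. continuous_on S (iter_pdir vs f) \<and>
        (\<forall>v. \<forall>z\<in>S. (\<lambda>s. iter_pdir vs f (z + s *\<^sub>R v)) differentiable (at 0)))"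

definition grad_x :: "((real^'n) \<times> real \<Rightarrow> real) \<Rightarrow> (real^'n) \<times> real \<Rightarrow> real^'n" where
  "grad_x \<phi> z = (\<chi> i. pdir \<phi> (axis i 1, 0) z)"

definition hess_x :: "((real^'n) \<times> real \<Rightarrow> real) \<Rightarrow> (real^'n) \<times> real \<Rightarrow> real^'n^'n" where
  "hess_x \<phi> z = (\<chi> i j. pdir (pdir \<phi> (axis j 1, 0)) (axis i 1, 0) z)"

definition dt :: "('a::real_normed_vector \<times> real \<Rightarrow> real) \<Rightarrow> 'a \<times> real \<Rightarrow> real" where
  "dt \<phi> z = pdir \<phi> (0, 1) z"

definition visc_sub ::
  "(real^'n \<Rightarrow> real \<Rightarrow> real^'n^'n) \<Rightarrow> (real^'n \<Rightarrow> real \<Rightarrow> real) \<Rightarrow> real \<Rightarrow> (real^'n \<Rightarrow> real \<Rightarrow> real) \<Rightarrow> bool" where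
  "visc_sub A b T u \<longleftrightarrow>
    (\<forall>\<phi> x0 t0. smooth_on (UNIV \<times> {0<..<T}) \<phi> \<and> 0 < t0 \<and> t0 < T \<and>
       (\<exists>e>0. \<forall>x t. (x, t) \<in> ball (x0, t0) e \<and> 0 < t \<and> t < T \<longrightarrow>
                  u x t - \<phi> (x, t) \<le> u x0 t0 - \<phi> (x0, t0))
     \<longrightarrow> dt \<phi> (x0, t0)
          - (\<Sum>i\<in>UNIV. \<Sum>j\<in>UNIV. A (grad_x \<phi> (x0, t0)) t0 $ i $ j * hess_x \<phi> (x0, t0) $ i $ j)
          - b (grad_x \<phi> (x0, t0)) t0 \<le> 0)"

definition visc_super ::
  "(real^'n \<Rightarrow> real \<Rightarrow> real^'n^'n) \<Rightarrow> (real^'n \<Rightarrow> real \<Rightarrow> real) \<Rightarrow> real \<Rightarrow> (real^'n \<Rightarrow> real \<Rightarrow> real) \<Rightarrow> bool" where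
  "visc_super A b T u \<longleftrightarrow>
    (\<forall>\<phi> x0 t0. smooth_on (UNIV \<times> {0<..<T}) \<phi> \<and> 0 < t0 \<and> t0 < T \<and>
       (\<exists>e>0. \<forall>x t. (x, t) \<in> ball (x0, t0) e \<and> 0 < t \<and> t < T \<longrightarrow>
                  u x t - \<phi> (x, t) \<ge> u x0 t0 - \<phi> (x0, t0))
     \<longrightarrow> dt \<phi> (x0, t0)
          - (\<Sum>i\<in>UNIV. \<Sum>j\<in>UNIV. A (grad_x \<phi> (x0, t0)) t0 $ i $ j * hess_x \<phi> (x0, t0) $ i $ j)
          - b (grad_x \<phi> (x0, t0)) t0 \<ge> 0)"

definition visc_solution ::
  "(real^'n \<Rightarrow> real \<Rightarrow> real^'n^'n) \<Rightarrow> (real^'n \<Rightarrow> real \<Rightarrow> real) \<Rightarrow> real \<Rightarrow> (real^'n \<Rightarrow> real \<Rightarrow> real) \<Rightarrow> bool" where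
  "visc_solution A b T u \<longleftrightarrow>
     continuous_on (UNIV \<times> {0..T}) (\<lambda>(x, t). u x t) \<and> visc_sub A b T u \<and> visc_super A b T u"

definition full_lattice :: "(real^'n) set \<Rightarrow> bool" where
  "full_lattice L \<longleftrightarrow>
     (\<exists>B :: real^'n^'n. invertible B \<and> L = {B *v (\<chi> i. of_int (k i)) | k :: 'n \<Rightarrow> int. True})"

definition modulus :: "(real^'n \<Rightarrow> real \<Rightarrow> real) \<Rightarrow> real \<Rightarrow> real \<Rightarrow> real" where
  "modulus u s t = Sup {(u y t - u x t) / 2 | x y. dist y x / 2 = s}"

end

(* At a local maximum of omega - phi the supremum omega(s0,t0) is attained at some x0, y0 with |y0 - x0| = 2 s0, and
   u(y,t) - u(x,t) is touched from above at (y0,x0,t0) by 2 phi(|y - x|/2, t). The usual way on from here is the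
   parabolic theorem on sums, hence Alexandrov's theorem; it is replaced by a comparison with explicit solutions of
   a heat equation.

   Since the equation does not involve x, the spatial sup-convolutions of u and of -u are still subsolutions. They are
   semiconvex, which bounds the Hessian of a touching test function from below; near the contact point, whose
   gradient is known, the coefficients can therefore be frozen at p0, t0 at the price of adding kappa I to
   A(p0,t0). Comparing with the heat flow of a trigonometric approximation of the data at time t0 - tau, localised by
   a quartic barrier, bounds the sup-convolution at the contact point by that heat flow over time tau, plus b tau + O(tau^2).
   The sum of the two heat flows, in y and in x, solves a heat equation in (y,x) with covariance matrix
   [A, A - 2 alpha e e^T; A - 2 alpha e e^T, A], where e is the unit vector along y0 - x0: parallel coupling for the part
   A - alpha e e^T, which is positive semi-definite by the hypothesis on alpha, and reflection coupling in the direction e. The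
   classical maximum principle compares this sum with a quadratic majorant of 2 phi(|y - x|/2, t); parallel directions contribute
   nothing and the reflected one contributes 2 alpha phi''. Dividing by tau and letting tau, kappa and the remaining
   errors tend to 0 gives phi_t <= alpha phi''. *)
theory Submission
  imports Defs
begin

section \<open>Test functions\<close>

text \<open>The contact supplies a smooth function touching a difference of two values of u, whereas
  the viscosity inequalities speak of functions touching u or -u alone, and second derivatives need
  not exist at the contact point. The heat flow trades the pointwise inequality for one integrated
  over a time \<tau>. The two integrated inequalities are evaluated at fixed points, so they can
  simply be added. The price is that every error must be o(\<tau>), a small multiple of \<tau>, or
  removable while \<tau> is fixed. Hence the barrier is quartic: a quadratic one would cost a fixed
  multiple of \<tau>, which survives the division by \<tau>. Hence also the trigonometric data: they
  make the flow explicit and smooth, and their approximation error is sent to 0 at fixed \<tau>,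
  which is possible because the constants in the final estimates do not involve the coefficients of
  the sums.\<close>

text \<open>A class of functions closed under directional derivatives, so that its members are smooth in the sense
  of \<open>smooth_on\<close>.\<close>

inductive elementary :: "('a::euclidean_space \<Rightarrow> real) \<Rightarrow> bool" where
  const: "elementary (\<lambda>x. c)"
| linear: "bounded_linear f \<Longrightarrow> elementary f"
| add: "elementary f \<Longrightarrow> elementary g \<Longrightarrow> elementary (\<lambda>x. f x + g x)"
| mult: "elementary f \<Longrightarrow> elementary g \<Longrightarrow> elementary (\<lambda>x. f x * g x)"
| exp: "elementary f \<Longrightarrow> elementary (\<lambda>x. exp (f x))"
| sin: "elementary f \<Longrightarrow> elementary (\<lambda>x. sin (f x))"
| cos: "elementary f \<Longrightarrow> elementary (\<lambda>x. cos (f x))"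

lemma elementary_minus: "elementary f \<Longrightarrow> elementary (\<lambda>x. - f x)"
  using elementary.mult[OF elementary.const[of "-1"], of f] by simp

lemma elementary_diff: "elementary f \<Longrightarrow> elementary g \<Longrightarrow> elementary (\<lambda>x. f x - g x)"
  using elementary.add[OF _ elementary_minus, of f g] by simp

lemma elementary_power: "elementary f \<Longrightarrow> elementary (\<lambda>x. f x ^ n)"
  by (induction n) (auto intro: elementary.const elementary.mult)

lemma elementary_inner:
  assumes "bounded_linear f" "bounded_linear (g :: 'a::euclidean_space \<Rightarrow> 'b::euclidean_space)"
  shows "elementary (\<lambda>x. (f x - c) \<bullet> (g x - d))"
proof -
  have sum: "elementary (\<lambda>x. \<Sum>i\<in>I. h i x)" if "finite I" "\<And>i. i \<in> I \<Longrightarrow> elementary (h i)"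
    for I and h :: "'b \<Rightarrow> 'a \<Rightarrow> real"
    using that by (induction I rule: finite_induct) (auto intro: elementary.const elementary.add)
  have "elementary (\<lambda>x. \<Sum>i\<in>Basis. ((f x \<bullet> i) - c \<bullet> i) * ((g x \<bullet> i) - d \<bullet> i))"
    by (intro sum finite_Basis elementary.mult elementary_diff elementary.linear elementary.const
        bounded_linear_inner_left_comp assms)
  moreover have "(f x - c) \<bullet> (g x - d) = (\<Sum>i\<in>Basis. ((f x \<bullet> i) - c \<bullet> i) * ((g x \<bullet> i) - d \<bullet> i))" for x
    by (subst euclidean_inner) (simp add: inner_diff_left)
  ultimately show ?thesis
    by simp
qed

text \<open>Differentiability and closure under differentiation are proved in a single induction;
  iterating \<open>pdir\<close> then never leaves the class, which is what \<open>smooth_on\<close>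
  asks for at every order.\<close>

lemma elementary_has_derivative:
  "elementary f \<Longrightarrow> \<exists>f'. (\<forall>z. (f has_derivative f' z) (at z)) \<and> (\<forall>v. elementary (\<lambda>z. f' z v))"
proof (induction rule: elementary.induct)
  case (const c)
  show ?case by (rule exI[of _ "\<lambda>z v. 0"]) (auto intro: elementary.const)
next
  case (linear f)
  then show ?case
    by (intro exI[of _ "\<lambda>z. f"]) (auto intro: elementary.const bounded_linear_imp_has_derivative)
next
  case (add f g)
  then obtain f' g' where "\<forall>z. (f has_derivative f' z) (at z)" "\<forall>v. elementary (\<lambda>z. f' z v)"
    "\<forall>z. (g has_derivative g' z) (at z)" "\<forall>v. elementary (\<lambda>z. g' z v)" by blast
  then show ?case
    by (intro exI[of _ "\<lambda>z v. f' z v + g' z v"])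
      (auto intro!: elementary.add derivative_intros)
next
  case (mult f g)
  then obtain f' g' where "\<forall>z. (f has_derivative f' z) (at z)" "\<forall>v. elementary (\<lambda>z. f' z v)"
    "\<forall>z. (g has_derivative g' z) (at z)" "\<forall>v. elementary (\<lambda>z. g' z v)" by blast
  then show ?case
    by (intro exI[of _ "\<lambda>z v. f z * g' z v + f' z v * g z"])
      (auto intro!: elementary.add elementary.mult mult.hyps derivative_intros)
next
  case (exp f)
  then obtain f' where "\<forall>z. (f has_derivative f' z) (at z)" "\<forall>v. elementary (\<lambda>z. f' z v)" by blast
  then show ?case
    by (intro exI[of _ "\<lambda>z v. f' z v * exp (f z)"])
      (auto intro!: elementary.mult elementary.exp exp.hyps derivative_eq_intros)
next
  case (sin f)
  then obtain f' where "\<forall>z. (f has_derivative f' z) (at z)" "\<forall>v. elementary (\<lambda>z. f' z v)" by blast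
  then show ?case
    by (intro exI[of _ "\<lambda>z v. f' z v * cos (f z)"])
      (auto intro!: elementary.mult elementary.cos sin.hyps derivative_eq_intros)
next
  case (cos f)
  then obtain f' where "\<forall>z. (f has_derivative f' z) (at z)" "\<forall>v. elementary (\<lambda>z. f' z v)" by blast
  then show ?case
    by (intro exI[of _ "\<lambda>z v. f' z v * (- sin (f z))"])
      (auto intro!: elementary.mult elementary_minus elementary.sin cos.hyps derivative_eq_intros)
qed

lemma pdir_line:
  assumes "(f has_derivative D) (at z)"
  shows "((\<lambda>s. f (z + s *\<^sub>R v)) has_real_derivative D v) (at 0)"
proof -
  have "((\<lambda>s. f (z + s *\<^sub>R v)) has_derivative (\<lambda>s. D (s *\<^sub>R v))) (at 0)"
    by (rule has_derivative_compose[where f = "\<lambda>s. z + s *\<^sub>R v" and g = f])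
      (use assms in \<open>auto intro!: derivative_eq_intros\<close>)
  moreover have "(\<lambda>s. D (s *\<^sub>R v)) = (\<lambda>s. D v * s)"
    using linear_scale[OF has_derivative_linear[OF assms]] by (auto simp: mult.commute)
  ultimately show ?thesis
    by (simp add: has_field_derivative_def)
qed

lemma pdir_eq: "(f has_derivative D) (at z) \<Longrightarrow> pdir f v z = D v"
  unfolding pdir_def by (rule DERIV_imp_deriv[OF pdir_line])

lemma elementary_pdir: "elementary f \<Longrightarrow> elementary (pdir f v)"
proof -
  assume "elementary f"
  then obtain f' where f': "\<forall>z. (f has_derivative f' z) (at z)" "\<forall>v. elementary (\<lambda>z. f' z v)"
    using elementary_has_derivative by blast
  then have "pdir f v = (\<lambda>z. f' z v)" by (auto intro: pdir_eq)
  then show ?thesis using f' by simp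
qed

lemma elementary_has_derivative_pdir:
  assumes "elementary f" shows "(f has_derivative (\<lambda>v. pdir f v z)) (at z)"
proof -
  from assms obtain f' where f': "\<forall>z. (f has_derivative f' z) (at z)"
    using elementary_has_derivative by blast
  then have "(\<lambda>v. pdir f v z) = f' z" by (auto intro: pdir_eq)
  then show ?thesis using f' by simp
qed

lemma elementary_continuous: "elementary f \<Longrightarrow> continuous_on S f"
  by (meson continuous_at_imp_continuous_on elementary_has_derivative_pdir has_derivative_continuous)

lemma elementary_smooth_on: "elementary f \<Longrightarrow> smooth_on S f"
proof -
  assume "elementary f"
  then have e: "elementary (iter_pdir vs f)" for vs
    by (induction vs) (auto intro: elementary_pdir)
  show ?thesis
    unfolding smooth_on_def
    using e elementary_continuous pdir_line[OF elementary_has_derivative_pdir[OF e]]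
      real_differentiable_def by blast
qed

lemma pdir_line_at:
  assumes "elementary f"
  shows "((\<lambda>s. f (z + s *\<^sub>R v)) has_real_derivative pdir f v (z + r *\<^sub>R v)) (at r)"
proof -
  have "((\<lambda>s. f ((z + r *\<^sub>R v) + s *\<^sub>R v)) has_real_derivative pdir f v (z + r *\<^sub>R v)) (at 0)"
    by (rule pdir_line[OF elementary_has_derivative_pdir[OF assms]])
  then have "((\<lambda>s. f (z + (r + s) *\<^sub>R v)) has_real_derivative pdir f v (z + r *\<^sub>R v)) (at 0)"
    by (simp add: algebra_simps)
  then show ?thesis
    using DERIV_at_within_shift[of "\<lambda>s. f (z + s *\<^sub>R v)" "pdir f v (z + r *\<^sub>R v)" r 0 UNIV]
    by (simp add: add.commute)
qed

lemma pdir_add: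
  "elementary f \<Longrightarrow> elementary g \<Longrightarrow> pdir (\<lambda>z. f z + g z) v = (\<lambda>z. pdir f v z + pdir g v z)"
  by (intro ext pdir_eq[where D = "\<lambda>v. pdir f v _ + pdir g v _"] has_derivative_add
      elementary_has_derivative_pdir)

lemma pdir_cmult: "elementary f \<Longrightarrow> pdir (\<lambda>z. c * f z) v = (\<lambda>z. c * pdir f v z)"
  by (intro ext pdir_eq[where D = "\<lambda>v. c * pdir f v _"] has_derivative_mult_right
      elementary_has_derivative_pdir)

lemma pdir_sum_direction:
  assumes "elementary f" "finite I"
  shows "pdir f (\<Sum>i\<in>I. c i *\<^sub>R d i) = (\<lambda>z. \<Sum>i\<in>I. c i * pdir f (d i) z)"
proof
  fix z
  have "linear (\<lambda>v. pdir f v z)"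
    by (rule has_derivative_linear[OF elementary_has_derivative_pdir[OF assms(1)]])
  then show "pdir f (\<Sum>i\<in>I. c i *\<^sub>R d i) z = (\<Sum>i\<in>I. c i * pdir f (d i) z)"
    using linear_sum[of "\<lambda>v. pdir f v z" "\<lambda>i. c i *\<^sub>R d i" I] linear_scale[of "\<lambda>v. pdir f v z"] by simp
qed

lemma pdir_sum:
  assumes "finite I" "\<And>i. i \<in> I \<Longrightarrow> elementary (f i)"
  shows "pdir (\<lambda>z. \<Sum>i\<in>I. f i z) v = (\<lambda>z. \<Sum>i\<in>I. pdir (f i) v z)"
  by (intro ext pdir_eq[where D = "\<lambda>v. \<Sum>i\<in>I. pdir (f i) v _"] has_derivative_sum
      elementary_has_derivative_pdir assms)

section \<open>Second-order operators given by lists of directions\<close>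

definition pdir2 :: "('a::real_normed_vector \<times> real \<Rightarrow> real) \<Rightarrow> 'a \<Rightarrow> 'a \<times> real \<Rightarrow> real" where
  "pdir2 f v = pdir (pdir f (v, 0)) (v, 0)"

lemma pdir2_hess_x:
  assumes "elementary f"
  shows "pdir2 f v z = (\<Sum>i\<in>UNIV. \<Sum>j\<in>UNIV. v $ i * v $ j * hess_x f z $ i $ j)"
proof -
  have v: "(v, 0::real) = (\<Sum>i\<in>UNIV. v $ i *\<^sub>R (axis i 1, 0))" for v :: "real^'n"
    by (simp add: prod_eq_iff fst_sum snd_sum basis_expansion flip: scalar_mult_eq_scaleR)
  have "pdir2 f v z = pdir (\<lambda>z. \<Sum>j\<in>UNIV. v $ j * pdir f (axis j 1, 0) z) (v, 0) z"
    unfolding pdir2_def by (subst v, subst pdir_sum_direction[OF assms]) auto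
  also have "\<dots> = (\<Sum>j\<in>UNIV. v $ j * pdir (pdir f (axis j 1, 0)) (v, 0) z)"
    using assms by (simp add: pdir_sum pdir_cmult elementary.mult elementary.const elementary_pdir)
  also have "\<dots> = (\<Sum>j\<in>UNIV. v $ j * (\<Sum>i\<in>UNIV. v $ i * hess_x f z $ i $ j))"
    by (subst v, subst pdir_sum_direction) (auto intro!: elementary_pdir assms simp: hess_x_def)
  also have "\<dots> = (\<Sum>i\<in>UNIV. \<Sum>j\<in>UNIV. v $ i * v $ j * hess_x f z $ i $ j)"
    by (subst sum.swap) (simp add: sum_distrib_left algebra_simps)
  finally show ?thesis .
qed

text \<open>This is tr(A D^2 f) with A the sum of \<sigma> \<sigma>^T over the list. Using a list
  instead of a matrix reduces second-order terms to one-dimensional second derivatives, and a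
  coupling of two flows becomes a choice of directions in the product space.\<close>

definition generator ::
  "'a::real_normed_vector list \<Rightarrow> ('a \<times> real \<Rightarrow> real) \<Rightarrow> 'a \<times> real \<Rightarrow> real" where
  "generator \<Sigma> f z = (\<Sum>\<sigma>\<leftarrow>\<Sigma>. pdir2 f \<sigma> z)"

lemma pdir2_add: "elementary f \<Longrightarrow> elementary g \<Longrightarrow> pdir2 (\<lambda>z. f z + g z) v z = pdir2 f v z + pdir2 g v z"
  by (simp add: pdir2_def pdir_add elementary_pdir)

lemma pdir2_cmult: "elementary f \<Longrightarrow> pdir2 (\<lambda>z. c * f z) v z = c * pdir2 f v z"
  by (simp add: pdir2_def pdir_cmult elementary_pdir)

lemma generator_add:
  "elementary f \<Longrightarrow> elementary g \<Longrightarrow> generator \<Sigma> (\<lambda>z. f z + g z) z = generator \<Sigma> f z + generator \<Sigma> g z"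
  by (simp add: generator_def pdir2_add sum_list_addf)

lemma generator_cmult: "elementary f \<Longrightarrow> generator \<Sigma> (\<lambda>z. c * f z) z = c * generator \<Sigma> f z"
  by (simp add: generator_def pdir2_cmult sum_list_const_mult)

lemma generator_hess_x:
  assumes "elementary f" "\<And>i j. A $ i $ j = (\<Sum>\<sigma>\<leftarrow>\<Sigma>. \<sigma> $ i * \<sigma> $ j)"
  shows "(\<Sum>i\<in>UNIV. \<Sum>j\<in>UNIV. A $ i $ j * hess_x f z $ i $ j) = generator \<Sigma> f z"
proof -
  have "(\<Sum>i\<in>UNIV. \<Sum>j\<in>UNIV. (\<Sum>\<sigma>\<leftarrow>\<Sigma>. \<sigma> $ i * \<sigma> $ j) * H i j) =
        (\<Sum>\<sigma>\<leftarrow>\<Sigma>. \<Sum>i\<in>UNIV. \<Sum>j\<in>UNIV. \<sigma> $ i * \<sigma> $ j * H i j)"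
    for H :: "'n::finite \<Rightarrow> 'n \<Rightarrow> real" and \<Sigma> :: "(real^'n) list"
    by (induction \<Sigma>) (auto simp: algebra_simps sum.distrib)
  then show ?thesis
    by (simp add: assms generator_def pdir2_hess_x)
qed

text \<open>If the second derivative at 0 were negative, \<open>g1\<close> would be negative just to
  the right of 0, and the mean value theorem would put g below its minimum.\<close>

lemma second_derivative_test:
  fixes g :: "real \<Rightarrow> real"
  assumes g1: "\<And>r. (g has_real_derivative g1 r) (at r)" and g2: "(g1 has_real_derivative g2) (at 0)"
    and e: "e > 0" "\<And>r. \<bar>r\<bar> < e \<Longrightarrow> g 0 \<le> g r"
  shows "g1 0 = 0 \<and> g2 \<ge> 0"
proof
  show z: "g1 0 = 0"
    by (rule DERIV_local_min[OF g1[of 0] e(1)]) (use e in auto)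
  show "g2 \<ge> 0"
  proof (rule ccontr)
    assume "\<not> g2 \<ge> 0"
    then obtain d where d: "d > 0" "\<And>h. 0 < h \<Longrightarrow> h < d \<Longrightarrow> g1 (0 + h) < g1 0"
      using DERIV_neg_dec_right[OF g2] by auto
    define h where "h = min d e / 2"
    have h: "0 < h" "h < d" "h < e" using d(1) e(1) by (auto simp: h_def)
    obtain \<xi> where \<xi>: "0 < \<xi>" "\<xi> < h" "g h - g 0 = (h - 0) * g1 \<xi>"
      using MVT2[OF h(1), of g g1] g1 by blast
    have "g1 \<xi> < 0" using d(2)[of \<xi>] \<xi> h z by auto
    then have "g h < g 0" using \<xi>(3) h(1) mult_pos_neg[of h "g1 \<xi>"] by simp
    then show False using e(2)[of h] h by auto
  qed
qed

lemma elementary_shift: "elementary f \<Longrightarrow> elementary (\<lambda>x. f (x - c))"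
proof (induction rule: elementary.induct)
  case (linear f)
  then have "(\<lambda>x. f (x - c)) = (\<lambda>x. f x - f c)"
    by (simp add: linear_diff bounded_linear.linear)
  then show ?case
    using linear by (auto intro: elementary_diff elementary.linear elementary.const)
qed (auto intro: elementary.intros)

lemma pdir_shift: "pdir (\<lambda>x. f (x - c)) v = (\<lambda>x. pdir f v (x - c))"
  by (simp add: pdir_def fun_eq_iff algebra_simps)

lemma pdir2_shift: "pdir2 (\<lambda>x. f (x - c)) v = (\<lambda>x. pdir2 f v (x - c))"
  by (simp add: pdir2_def pdir_shift fun_eq_iff)

lemma generator_shift: "generator \<Sigma> (\<lambda>x. f (x - c)) z = generator \<Sigma> f (z - c)"
  by (simp add: generator_def pdir2_shift)

lemma generator_minus: "elementary f \<Longrightarrow> generator \<Sigma> (\<lambda>z. - f z) z = - generator \<Sigma> f z"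
  using generator_cmult[of f \<Sigma> "-1"] by simp

lemma pdir_minus: "elementary f \<Longrightarrow> pdir (\<lambda>z. - f z) v = (\<lambda>z. - pdir f v z)"
  using pdir_cmult[of f "-1"] by simp

lemma pdir_const: "pdir (\<lambda>z. c) v = (\<lambda>z. 0)"
  by (intro ext pdir_eq[where D = "\<lambda>v. 0"]) auto

lemma generator_const: "generator \<Sigma> (\<lambda>z. c) z = 0"
  by (simp add: generator_def pdir2_def pdir_const sum_list_0)

section \<open>Trigonometric solutions of the heat equation and the maximum principle\<close>

definition trig :: "(real \<times> 'a::euclidean_space \<times> real) list \<Rightarrow> 'a \<Rightarrow> real" where
  "trig l y = (\<Sum>(c, k, \<theta>)\<leftarrow>l. c * cos (k \<bullet> y + \<theta>))"

definition sqsum :: "'a::euclidean_space list \<Rightarrow> 'a \<Rightarrow> real" where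
  "sqsum \<Sigma> k = (\<Sum>\<sigma>\<leftarrow>\<Sigma>. (\<sigma> \<bullet> k)\<^sup>2)"

text \<open>Each mode cos(k y + \<theta>) is an eigenfunction of \<open>generator \<Sigma>\<close>
  with eigenvalue \<open>- sqsum \<Sigma> k\<close>, so damping the modes separately gives the
  solution with initial value \<open>trig l\<close> in closed form.\<close>

definition heat ::
  "'a::euclidean_space list \<Rightarrow> (real \<times> 'a \<times> real) list \<Rightarrow> 'a \<times> real \<Rightarrow> real" where
  "heat \<Sigma> l z = (\<Sum>(c, k, \<theta>)\<leftarrow>l. c * exp (- (snd z * sqsum \<Sigma> k)) * cos (k \<bullet> fst z + \<theta>))"

lemma sqsum_nonneg: "0 \<le> sqsum \<Sigma> k"
  unfolding sqsum_def by (intro sum_list_nonneg) auto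

lemma heat_0 [simp]: "heat \<Sigma> l (y, 0) = trig l y"
  by (simp add: heat_def trig_def case_prod_beta)

lemma elementary_const_fst: "elementary (\<lambda>z. k \<bullet> fst z + \<theta>)"
  by (intro elementary.add elementary.const elementary.linear bounded_linear_inner_right_comp
      bounded_linear_fst)

lemma elementary_snd: "elementary snd"
  by (intro elementary.linear bounded_linear_snd)

lemma elementary_heat: "elementary (heat \<Sigma> l)"
proof (induction l)
  case Nil
  then show ?case using elementary.const[of 0] by (simp add: heat_def[abs_def])
next
  case (Cons m l)
  obtain c k \<theta> where m: "m = (c, k, \<theta>)" by (cases m)
  have "elementary (\<lambda>z. (c * exp (- (snd z * sqsum \<Sigma> k))) * cos (k \<bullet> fst z + \<theta>) + heat \<Sigma> l z)"
    by (intro elementary.add elementary.mult elementary.const elementary.exp elementary.cos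
        elementary_minus elementary_snd elementary_const_fst Cons)
  then show ?case by (simp add: heat_def[abs_def] m)
qed

lemma heat_equation: "pdir (heat \<Sigma> l) (0, 1) z = generator \<Sigma> (heat \<Sigma> l) z"
proof (induction l)
  case Nil
  show ?case
    by (simp add: heat_def[abs_def] generator_const pdir_const)
next
  case (Cons m l)
  obtain c k \<theta> where m: "m = (c, k, \<theta>)" by (cases m)
  define q where "q = sqsum \<Sigma> k"
  define M where "M = (\<lambda>z :: 'a \<times> real. (c * exp (- (snd z * q))) * cos (k \<bullet> fst z + \<theta>))"
  define N where "N = (\<lambda>z :: 'a \<times> real. (c * exp (- (snd z * q))) * sin (k \<bullet> fst z + \<theta>))"
  have dM: "(M has_derivative (\<lambda>v. - q * snd v * M z - (k \<bullet> fst v) * N z)) (at z)" for z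
    unfolding M_def N_def by (auto intro!: derivative_eq_intros simp: algebra_simps)
  have dN: "(N has_derivative (\<lambda>v. - q * snd v * N z + (k \<bullet> fst v) * M z)) (at z)" for z
    unfolding M_def N_def by (auto intro!: derivative_eq_intros simp: algebra_simps)
  have M: "elementary M"
    unfolding M_def
    by (intro elementary.mult elementary.const elementary.exp elementary.cos
        elementary_minus elementary_snd elementary_const_fst)
  have M1: "pdir M (\<sigma>, 0) = (\<lambda>z. - (k \<bullet> \<sigma>) * N z)" for \<sigma>
    by (intro ext, subst pdir_eq[OF dM]) simp
  have "((\<lambda>z. - (k \<bullet> \<sigma>) * N z) has_derivative
      (\<lambda>v. - (k \<bullet> \<sigma>) * (- q * snd v * N z + (k \<bullet> fst v) * M z))) (at z)" for \<sigma> z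
    by (intro has_derivative_mult_right dN)
  from pdir_eq[OF this] have "pdir2 M \<sigma> z = - (\<sigma> \<bullet> k)\<^sup>2 * M z" for \<sigma> z
    by (simp add: pdir2_def M1 power2_eq_square inner_commute)
  then have "generator \<Sigma> M z = - q * M z"
    by (simp add: generator_def q_def sqsum_def sum_list_mult_const uminus_sum_list_map comp_def flip: sum_list_mult_const)
  moreover have "pdir M (0, 1) z = - q * M z"
    by (subst pdir_eq[OF dM]) simp
  moreover have "heat \<Sigma> (m # l) = (\<lambda>z. M z + heat \<Sigma> l z)"
    by (simp add: heat_def[abs_def] m M_def q_def)
  ultimately show ?case
    using Cons by (simp add: pdir_add generator_add M elementary_heat)
qed

section \<open>The quartic barrier and comparison on cylinders\<close>

definition trace_sq :: "'a::euclidean_space list \<Rightarrow> real" where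
  "trace_sq \<Sigma> = (\<Sum>\<sigma>\<leftarrow>\<Sigma>. \<sigma> \<bullet> \<sigma>)"

lemma trace_sq_nonneg: "0 \<le> trace_sq \<Sigma>"
  unfolding trace_sq_def by (intro sum_list_nonneg) auto

text \<open>|y - c|^4 completed to a supersolution of the heat equation, with a =
  \<open>trace_sq \<Sigma>\<close>: the time derivative of the middle term absorbs the operator
  applied to the quartic term, that of the last term absorbs the operator applied to the middle one.
  At the centre only 12 a^2 s^2 remains.\<close>

definition barrier :: "'a::euclidean_space list \<Rightarrow> 'a \<Rightarrow> 'a \<times> real \<Rightarrow> real" where
  "barrier \<Sigma> c z = ((fst z - c) \<bullet> (fst z - c))\<^sup>2 + 12 * trace_sq \<Sigma> * snd z * ((fst z - c) \<bullet> (fst z - c))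
     + 12 * (trace_sq \<Sigma> * snd z)\<^sup>2"

lemma elementary_barrier: "elementary (barrier \<Sigma> c)"
  unfolding barrier_def[abs_def]
  by (intro elementary.add elementary.mult elementary.const elementary_power elementary_snd
      elementary_inner bounded_linear_fst)

text \<open>By Cauchy-Schwarz, 8 (h \<sigma>)^2 + 4 |h|^2 |\<sigma>|^2 is at most 12 |h|^2
  |\<sigma>|^2. Summed over the list this is 12 a |h|^2, the time derivative of the middle term; the
  remaining 24 a^2 s is matched exactly by the last term.\<close>

lemma barrier_supersolution:
  assumes "0 \<le> snd z"
  shows "generator \<Sigma> (barrier \<Sigma> c) z \<le> pdir (barrier \<Sigma> c) (0, 1) z"
proof -
  define a where "a = trace_sq \<Sigma>"
  have a: "0 \<le> a" by (simp add: a_def trace_sq_nonneg)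
  define h where "h = (\<lambda>z :: 'a \<times> real. fst z - c)"
  have B: "barrier \<Sigma> c = (\<lambda>z. (h z \<bullet> h z)\<^sup>2 + 12 * a * snd z * (h z \<bullet> h z) + 12 * (a * snd z)\<^sup>2)"
    by (simp add: barrier_def[abs_def] a_def h_def)
  have dB: "(barrier \<Sigma> c has_derivative (\<lambda>v. 4 * (h z \<bullet> h z) * (h z \<bullet> fst v)
      + 12 * a * snd v * (h z \<bullet> h z) + 24 * a * snd z * (h z \<bullet> fst v) + 24 * a\<^sup>2 * snd z * snd v)) (at z)" for z
    unfolding B h_def
    by (auto intro!: derivative_eq_intros simp: inner_commute algebra_simps power2_eq_square)
  have B1: "pdir (barrier \<Sigma> c) (\<sigma>, 0) = (\<lambda>z. 4 * (h z \<bullet> h z) * (h z \<bullet> \<sigma>) + 24 * a * snd z * (h z \<bullet> \<sigma>))" for \<sigma>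
    by (intro ext, subst pdir_eq[OF dB]) simp
  have "((\<lambda>z. 4 * (h z \<bullet> h z) * (h z \<bullet> \<sigma>) + 24 * a * snd z * (h z \<bullet> \<sigma>)) has_derivative
     (\<lambda>v. 8 * (h z \<bullet> fst v) * (h z \<bullet> \<sigma>) + 4 * (h z \<bullet> h z) * (fst v \<bullet> \<sigma>)
        + 24 * a * snd v * (h z \<bullet> \<sigma>) + 24 * a * snd z * (fst v \<bullet> \<sigma>))) (at z)" for \<sigma> z
    unfolding h_def
    by (auto intro!: derivative_eq_intros simp: inner_commute algebra_simps)
  from pdir_eq[OF this]
  have p2: "pdir2 (barrier \<Sigma> c) \<sigma> z = 8 * (h z \<bullet> \<sigma>)\<^sup>2 + 4 * (h z \<bullet> h z) * (\<sigma> \<bullet> \<sigma>) + 24 * a * snd z * (\<sigma> \<bullet> \<sigma>)" for \<sigma>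
    by (simp add: pdir2_def B1 power2_eq_square)
  have "generator \<Sigma> (barrier \<Sigma> c) z \<le> (\<Sum>\<sigma>\<leftarrow>\<Sigma>. (12 * (h z \<bullet> h z) + 24 * a * snd z) * (\<sigma> \<bullet> \<sigma>))"
    unfolding generator_def
  proof (rule sum_list_mono)
    fix \<sigma>
    show "pdir2 (barrier \<Sigma> c) \<sigma> z \<le> (12 * (h z \<bullet> h z) + 24 * a * snd z) * (\<sigma> \<bullet> \<sigma>)"
      unfolding p2 using Cauchy_Schwarz_ineq[of "h z" \<sigma>] by (simp add: algebra_simps)
  qed
  also have "\<dots> = 12 * a * (h z \<bullet> h z) + 24 * a\<^sup>2 * snd z"
    by (subst sum_list_const_mult) (simp add: a_def trace_sq_def algebra_simps power2_eq_square)
  also have "\<dots> = pdir (barrier \<Sigma> c) (0, 1) z"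
    by (subst pdir_eq[OF dB]) simp
  finally show ?thesis .
qed

lemma barrier_bounds:
  assumes "0 \<le> s"
  shows "0 \<le> barrier \<Sigma> c (y, s)" "dist y c ^ 4 \<le> barrier \<Sigma> c (y, s)"
    "barrier \<Sigma> c (c, s) = 12 * (trace_sq \<Sigma>)\<^sup>2 * s\<^sup>2"
proof -
  have "dist y c ^ 4 = ((y - c) \<bullet> (y - c))\<^sup>2"
    by (simp add: dist_norm dot_square_norm flip: power_mult)
  then show "dist y c ^ 4 \<le> barrier \<Sigma> c (y, s)" "0 \<le> barrier \<Sigma> c (y, s)"
    using assms trace_sq_nonneg[of \<Sigma>] by (auto simp: barrier_def)
qed (auto simp: barrier_def power_mult_distrib)

lemma pdir2_local_max:
  assumes "elementary f" "e > 0" "\<And>r. \<bar>r\<bar> < e \<Longrightarrow> f (y + r *\<^sub>R \<sigma>, s) \<le> f (y, s)"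
  shows "pdir2 f \<sigma> (y, s) \<le> 0"
proof -
  have z: "(y + r *\<^sub>R \<sigma>, s) = (y, s) + r *\<^sub>R (\<sigma>, 0)" for r by simp
  note e = elementary_minus[OF assms(1)]
  have "0 \<le> pdir (pdir (\<lambda>z. - f z) (\<sigma>, 0)) (\<sigma>, 0) ((y, s) + 0 *\<^sub>R (\<sigma>, 0))"
    using second_derivative_test[of "\<lambda>r. - f ((y, s) + r *\<^sub>R (\<sigma>, 0))",
        OF pdir_line_at[OF e] pdir_line_at[OF elementary_pdir[OF e]] assms(2)] assms(3)
    by auto
  then show ?thesis
    using assms(1) by (simp add: pdir2_def pdir_minus elementary_pdir)
qed

text \<open>A positive maximum over the cylinder can lie neither on the bottom nor on the side. At
  any other point the time derivative is \<ge> 0 and all second derivatives are \<le> 0, against the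
  strict inequality.\<close>

lemma classical_maximum_principle:
  assumes W: "elementary W"
    and init: "\<And>y. y \<in> cball c r \<Longrightarrow> W (y, 0) \<le> 0"
    and lateral: "\<And>y s. dist y c = r \<Longrightarrow> 0 \<le> s \<Longrightarrow> s \<le> \<tau> \<Longrightarrow> W (y, s) \<le> 0"
    and strict: "\<And>y s. dist y c < r \<Longrightarrow> 0 < s \<Longrightarrow> s \<le> \<tau> \<Longrightarrow> pdir W (0, 1) (y, s) < generator \<Sigma> W (y, s)"
    and y: "y \<in> cball c r" and s: "0 \<le> s" "s \<le> \<tau>"
  shows "W (y, s) \<le> 0"
proof (rule ccontr)
  assume pos: "\<not> W (y, s) \<le> 0"
  have "compact (cball c r \<times> {0..\<tau>})" by (intro compact_Times) auto
  then obtain z where z: "z \<in> cball c r \<times> {0..\<tau>}" "\<And>z'. z' \<in> cball c r \<times> {0..\<tau>} \<Longrightarrow> W z' \<le> W z"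
    using continuous_attains_sup[of "cball c r \<times> {0..\<tau>}" W] elementary_continuous[OF W] y s
    by (metis SigmaI atLeastAtMost_iff empty_iff)
  obtain y' s' where z': "z = (y', s')" by (cases z)
  have Wpos: "W (y', s') > 0" using pos z(2)[of "(y, s)"] y s by (auto simp: z')
  have s': "0 < s'" "s' \<le> \<tau>" using init[of y'] Wpos z(1) z' by (auto intro: le_neq_trans)
  have y': "dist y' c < r"
    using lateral[of y' s'] Wpos s' z(1) z' by (auto simp: dist_commute intro: le_neq_trans)
  \<comment> \<open>The maximum may lie at the final time, so it is compared with earlier times
    only; this gives an inequality instead of a vanishing derivative.\<close>
  have t: "0 \<le> pdir W (0, 1) (y', s')"
  proof (rule ccontr)
    assume neg: "\<not> 0 \<le> pdir W (0, 1) (y', s')"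
    have "((\<lambda>h. W ((y', s') + h *\<^sub>R (0, 1))) has_real_derivative pdir W (0, 1) (y', s')) (at 0)"
      by (rule pdir_line[OF elementary_has_derivative_pdir[OF W]])
    then obtain d where d: "d > 0" "\<And>h. 0 < h \<Longrightarrow> h < d \<Longrightarrow> W (y', s') < W ((y', s') + (- h) *\<^sub>R (0, 1))"
      using DERIV_neg_dec_left[of "\<lambda>h. W ((y', s') + h *\<^sub>R (0, 1))" _ 0] neg by force
    define h where "h = min d s' / 2"
    have "0 < h" "h < d" "h < s'" using d(1) s' by (auto simp: h_def)
    then show False using d(2)[of h] z(2)[of "(y', s' - h)"] z(1) s' by (auto simp: z')
  qed
  have "pdir2 W \<sigma> (y', s') \<le> 0" for \<sigma>
  proof (rule pdir2_local_max[OF W])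
    show "(r - dist y' c) / (norm \<sigma> + 1) > 0" using y' by (intro divide_pos_pos add_nonneg_pos) auto
    fix \<rho> assume "\<bar>\<rho>\<bar> < (r - dist y' c) / (norm \<sigma> + 1)"
    then have "\<bar>\<rho>\<bar> * (norm \<sigma> + 1) < r - dist y' c"
      by (simp add: pos_less_divide_eq add_nonneg_pos)
    then have "norm (\<rho> *\<^sub>R \<sigma>) < r - dist y' c" by (simp add: algebra_simps)
    then have "dist (y' + \<rho> *\<^sub>R \<sigma>) c < r"
      using norm_triangle_ineq[of "y' - c" "\<rho> *\<^sub>R \<sigma>"] by (simp add: dist_norm algebra_simps)
    then show "W (y' + \<rho> *\<^sub>R \<sigma>, s') \<le> W (y', s')"
      using z(2)[of "(y' + \<rho> *\<^sub>R \<sigma>, s')"] z(1) by (auto simp: z' dist_commute)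
  qed
  then have "generator \<Sigma> W (y', s') \<le> 0"
    unfolding generator_def by (intro sum_list_nonpos) auto
  then show False using strict[OF y' s'] t by auto
qed

text \<open>Comparison with the barrier localises: only the values of the data near the centre matter, up to
  an error that is quadratic in time.\<close>

lemma heat_le_supersolution:
  assumes Q: "elementary Q" "\<And>z. generator \<Sigma> Q z \<le> \<Xi>" "\<And>z. pdir Q (0, 1) z = 0"
    and r: "0 < r" and C: "0 \<le> C" and \<tau>: "0 \<le> \<tau>"
    and init: "\<And>y. y \<in> cball c r \<Longrightarrow> trig l y \<le> Q (y, 0) + m"
    and lateral: "\<And>y s. dist y c = r \<Longrightarrow> 0 \<le> s \<Longrightarrow> s \<le> \<tau> \<Longrightarrow> heat \<Sigma> l (y, s) \<le> Q (y, s) + m + \<Xi> * s + C * r ^ 4"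
  shows "heat \<Sigma> l (c, \<tau>) \<le> Q (c, \<tau>) + m + \<Xi> * \<tau> + 12 * C * (trace_sq \<Sigma>)\<^sup>2 * \<tau>\<^sup>2"
proof (rule field_le_epsilon)
  fix e :: real assume e: "0 < e"
  \<comment> \<open>A drift \<gamma> in time supplies the strictness that the maximum principle
    requires; over the time \<tau> it costs at most e.\<close>
  define \<gamma> where "\<gamma> = e / (\<tau> + 1)"
  have \<gamma>: "0 < \<gamma>" "\<gamma> * \<tau> \<le> e" using e \<tau> by (auto simp: \<gamma>_def field_simps)
  define P where "P = (\<lambda>z :: 'a \<times> real. (- \<Xi> - \<gamma>) * snd z + (- m))"
  have dP: "(P has_derivative (\<lambda>v. (- \<Xi> - \<gamma>) * snd v)) (at z)" for z
    unfolding P_def by (auto intro!: derivative_eq_intros)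
  have P: "elementary P"
    unfolding P_def by (intro elementary.add elementary.mult elementary.const elementary_snd)
  have "pdir P (\<sigma>, 0) = (\<lambda>z. 0)" for \<sigma>
    by (intro ext, subst pdir_eq[OF dP]) simp
  then have gP: "generator \<Sigma> P z = 0" for z
    by (simp add: generator_def pdir2_def pdir_const sum_list_0)
  have tP: "pdir P (0, 1) z = - \<Xi> - \<gamma>" for z
    by (subst pdir_eq[OF dP]) simp
  define W where "W = (\<lambda>z. ((heat \<Sigma> l z + (-1) * Q z) + (- C) * barrier \<Sigma> c z) + P z)"
  note el = elementary_heat elementary_barrier P Q(1) elementary.const elementary.mult elementary.add
  have W: "elementary W" unfolding W_def by (intro el)
  have "W (c, \<tau>) \<le> 0"
  proof (rule classical_maximum_principle[OF W, where c = c and r = r and \<Sigma> = \<Sigma>])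
    fix y assume "y \<in> cball c r"
    then show "W (y, 0) \<le> 0"
      using init[of y] mult_nonneg_nonneg[OF C barrier_bounds(1)[of 0 \<Sigma> c y]]
      by (simp add: W_def P_def)
  next
    fix y s assume s: "dist y c = r" "0 \<le> s" "s \<le> \<tau>"
    then have "C * r ^ 4 \<le> C * barrier \<Sigma> c (y, s)"
      using C barrier_bounds(2)[of s y c \<Sigma>] by (intro mult_left_mono) auto
    moreover have "0 \<le> \<gamma> * s" using \<gamma>(1) s by simp
    ultimately show "W (y, s) \<le> 0"
      using lateral[OF s] by (simp add: W_def P_def algebra_simps)
  next
    fix y s assume s: "dist y c < r" "0 < s" "s \<le> \<tau>"
    have "generator \<Sigma> W (y, s) = generator \<Sigma> (heat \<Sigma> l) (y, s) - generator \<Sigma> Q (y, s)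
        - C * generator \<Sigma> (barrier \<Sigma> c) (y, s)"
      unfolding W_def by (subst generator_add | intro el)+ (simp add: generator_cmult generator_minus el gP)
    moreover have "pdir W (0, 1) (y, s) = pdir (heat \<Sigma> l) (0, 1) (y, s)
        - C * pdir (barrier \<Sigma> c) (0, 1) (y, s) - \<Xi> - \<gamma>"
      unfolding W_def by (subst pdir_add | intro el)+ (simp add: pdir_cmult pdir_minus el tP Q(3))
    moreover have "C * generator \<Sigma> (barrier \<Sigma> c) (y, s) \<le> C * pdir (barrier \<Sigma> c) (0, 1) (y, s)"
      using C s by (intro mult_left_mono barrier_supersolution) auto
    ultimately show "pdir W (0, 1) (y, s) < generator \<Sigma> W (y, s)"
      using Q(2)[of "(y, s)"] \<gamma>(1) by (simp add: heat_equation)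
  qed (use r \<tau> in auto)
  then show "heat \<Sigma> l (c, \<tau>) \<le> Q (c, \<tau>) + m + \<Xi> * \<tau> + 12 * C * (trace_sq \<Sigma>)\<^sup>2 * \<tau>\<^sup>2 + e"
    using barrier_bounds(3)[OF \<tau>, of \<Sigma> c] \<gamma>(2) by (simp add: W_def P_def algebra_simps)
qed

lemma heat_bounded: "\<bar>heat \<Sigma> l (y, s)\<bar> \<le> (\<Sum>(c, k, \<theta>)\<leftarrow>l. \<bar>c\<bar>)" if "0 \<le> s"
proof (induction l)
  case (Cons m l)
  obtain c k \<theta> where m: "m = (c, k, \<theta>)" by (cases m)
  have "\<bar>exp (- (s * sqsum \<Sigma> k))\<bar> * \<bar>cos (k \<bullet> y + \<theta>)\<bar> \<le> 1 * 1"
    using that sqsum_nonneg[of \<Sigma> k] by (intro mult_mono) auto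
  then have "\<bar>c * exp (- (s * sqsum \<Sigma> k)) * cos (k \<bullet> y + \<theta>)\<bar> \<le> \<bar>c\<bar>"
    using mult_left_mono[of _ 1 "\<bar>c\<bar>"] by (simp add: abs_mult mult.assoc)
  then show ?case using Cons by (simp add: heat_def m)
qed (simp add: heat_def)

text \<open>The sum of the absolute coefficients bounds the flow only crudely, but it is needed only
  on a distant sphere: a small multiple C of the barrier costs at most e at the centre, while
  \<open>C * r ^ 4\<close> covers the crude bound once r is large.\<close>

lemma heat_upper_bound:
  assumes "\<And>y. trig l y \<le> m" "0 \<le> \<tau>"
  shows "heat \<Sigma> l (y, \<tau>) \<le> m"
proof (rule field_le_epsilon)
  fix e :: real assume e: "0 < e"
  define K where "K = (\<Sum>(c, k, \<theta>)\<leftarrow>l. \<bar>c\<bar>)"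
  define D where "D = 12 * (trace_sq \<Sigma>)\<^sup>2 * \<tau>\<^sup>2"
  define C where "C = e / (D + 1)"
  have D: "0 \<le> D" by (simp add: D_def)
  have C: "0 < C" "C * D \<le> e" using e D by (auto simp: C_def field_simps)
  define r where "r = max 1 ((K - m) / C)"
  have r: "1 \<le> r" "K - m \<le> C * r" using C by (auto simp: r_def field_simps max_def)
  have "r \<le> r ^ 4" using r(1) by (intro self_le_power) auto
  then have r4: "K - m \<le> C * r ^ 4" using r C(1) by (meson mult_left_mono order_trans less_imp_le)
  have "heat \<Sigma> l (y, \<tau>) \<le> 0 + m + 0 * \<tau> + 12 * C * (trace_sq \<Sigma>)\<^sup>2 * \<tau>\<^sup>2"
  proof (rule heat_le_supersolution[where Q = "\<lambda>z. 0" and r = r])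
    fix y' s assume "(0::real) \<le> s"
    then show "heat \<Sigma> l (y', s) \<le> 0 + m + 0 * s + C * r ^ 4"
      using heat_bounded[of s \<Sigma> l y'] r4 by (simp add: K_def)
  qed (use r C assms in \<open>auto simp: generator_const pdir_const intro: elementary.const\<close>)
  then show "heat \<Sigma> l (y, \<tau>) \<le> m + e" using C(2) by (simp add: D_def algebra_simps)
qed

lemma heat_lower_bound:
  assumes "\<And>y. m \<le> trig l y" "0 \<le> \<tau>"
  shows "m \<le> heat \<Sigma> l (y, \<tau>)"
proof -
  define l' where "l' = map (\<lambda>(c, k, \<theta>). (- c, k, \<theta>)) l"
  have h: "heat \<Sigma> l' z = - heat \<Sigma> l z" for z
    unfolding heat_def l'_def by (induction l) (auto simp: case_prod_beta)
  have "trig l' y = - trig l y" for y using h[of "(y, 0)"] by simp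
  then show ?thesis using heat_upper_bound[of l' "- m" \<tau> \<Sigma> y] assms h by simp
qed

section \<open>Trigonometric approximation\<close>

lemma trig_add: "trig (u @ v) y = trig u y + trig v y"
  by (simp add: trig_def)

text \<open>Product-to-sum formula: frequencies and phases are subtracted and added, so
  trigonometric sums form an algebra and polynomials in sines stay inside it.\<close>

lemma trig_mult: "\<exists>l. \<forall>y. trig l y = trig l1 y * trig l2 y"
proof -
  define m where "m = (\<lambda>(c1, k1, \<theta>1) (c2, k2, \<theta>2).
      [(c1 * c2 / 2, k1 - k2, \<theta>1 - \<theta>2), (c1 * c2 / 2 :: real, k1 + k2 :: 'a, \<theta>1 + \<theta>2 :: real)])"
  have "trig (m (c1, k1, \<theta>1) (c2, k2, \<theta>2)) y = (c1 * cos (k1 \<bullet> y + \<theta>1)) * (c2 * cos (k2 \<bullet> y + \<theta>2))"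
    for c1 k1 \<theta>1 c2 k2 \<theta>2 y
    using cos_times_cos[of "k1 \<bullet> y + \<theta>1" "k2 \<bullet> y + \<theta>2"]
    by (simp add: m_def trig_def inner_diff_left inner_add_left algebra_simps add_divide_distrib)
  then have one: "trig (m p q) y = trig [p] y * trig [q] y" for p q y
    by (cases p; cases q) (simp add: trig_def)
  have trig_Cons: "trig (p # v) y = trig [p] y + trig v y" for p v and y :: 'a
    by (simp add: trig_def)
  have row: "\<exists>l. \<forall>y. trig l y = trig [p] y * trig l2 y" for p
  proof (induction l2)
    case Nil
    show ?case by (rule exI[of _ "[]"]) (simp add: trig_def)
  next
    case (Cons q l2)
    then obtain l where "\<forall>y. trig l y = trig [p] y * trig l2 y" by blast
    then have "trig (m p q @ l) y = trig [p] y * trig (q # l2) y" for y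
      by (simp add: trig_add one trig_Cons[of q l2] distrib_left)
    then show ?case by blast
  qed
  show ?thesis
  proof (induction l1)
    case Nil
    show ?case by (rule exI[of _ "[]"]) (simp add: trig_def)
  next
    case (Cons p l1)
    then obtain l where "\<forall>y. trig l y = trig l1 y * trig l2 y" by blast
    moreover obtain l' where "\<forall>y. trig l' y = trig [p] y * trig l2 y" using row by blast
    ultimately have "trig (l' @ l) y = trig (p # l1) y * trig l2 y" for y
      by (simp add: trig_add trig_Cons[of p l1] distrib_right)
    then show ?case by blast
  qed
qed

text \<open>Polynomials in the sines of the coordinates are trigonometric sums, and the substitution by
  \<open>arcsin\<close> turns uniform approximation on a cube into approximation with a global bound.\<close>

lemma trig_approximation:
  fixes F :: "'a::euclidean_space \<Rightarrow> real"
  assumes F: "continuous_on UNIV F" "\<And>y. \<bar>F y\<bar> \<le> N" and e: "0 < e"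
  obtains l where "\<And>y. y \<in> cball c 1 \<Longrightarrow> \<bar>trig l y - F y\<bar> \<le> e" "\<And>y. \<bar>trig l y\<bar> \<le> N + e"
proof -
  define G where "G = (\<lambda>S. F (c + (\<Sum>i\<in>Basis. arcsin (S \<bullet> i) *\<^sub>R i)))"
  define sn where "sn = (\<lambda>y. \<Sum>i\<in>Basis. sin ((y - c) \<bullet> i) *\<^sub>R i)"
  have sn_i: "sn y \<bullet> i = sin ((y - c) \<bullet> i)" if "i \<in> Basis" for y i
    using that by (simp add: sn_def inner_sum_left inner_Basis if_distrib sum.delta cong: if_cong)
  have "continuous_on (cbox (- One) One) G"
    unfolding G_def
    by (intro continuous_on_compose2[OF F(1)] continuous_intros) (auto simp: mem_box)
  then obtain P where P: "real_polynomial_function P" "\<And>S. S \<in> cbox (- One) One \<Longrightarrow> \<bar>G S - P S\<bar> < e"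
    using Stone_Weierstrass_real_polynomial_function[of "cbox (- One) One" G e] e by auto
  have "\<exists>l. \<forall>y. trig l y = p (sn y)" if "real_polynomial_function p" for p
    using that
  proof (induction rule: real_polynomial_function.induct)
    case (linear f)
    have one: "trig [(f i, i, - (c \<bullet> i) - pi / 2)] y = sin ((y - c) \<bullet> i) * f i" for y i
    proof -
      have "i \<bullet> y + (- (c \<bullet> i) - pi / 2) = (y - c) \<bullet> i - pi / 2"
        by (simp add: inner_diff_left inner_commute[of i y])
      then have "cos (i \<bullet> y + (- (c \<bullet> i) - pi / 2)) = sin ((y - c) \<bullet> i)"
        by (simp only: cos_diff) simp
      then show ?thesis by (simp add: trig_def)
    qed
    have "\<exists>l. \<forall>y. trig l y = (\<Sum>i\<in>I. sin ((y - c) \<bullet> i) * f i)" if "finite I" for I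
      using that
    proof (induction I rule: finite_induct)
      case empty
      show ?case by (rule exI[of _ "[]"]) (simp add: trig_def)
    next
      case (insert i I)
      then obtain l where "\<forall>y. trig l y = (\<Sum>i\<in>I. sin ((y - c) \<bullet> i) * f i)" by blast
      then have "\<forall>y. trig ([(f i, i, - (c \<bullet> i) - pi / 2)] @ l) y = (\<Sum>i\<in>insert i I. sin ((y - c) \<bullet> i) * f i)"
        using insert.hyps unfolding trig_add one by simp
      then show ?case by blast
    qed
    from this[of Basis] show ?case
      using linear bounded_linear.linear[OF linear] by (simp add: sn_def linear_sum linear_scale)
  next
    case (const a)
    show ?case by (rule exI[of _ "[(a, 0, 0)]"]) (simp add: trig_def)
  next
    case (add p q)
    then show ?case by (metis trig_add)
  next
    case (mult p q)
    then show ?case by (metis trig_mult)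
  qed
  then obtain l where l: "\<And>y. trig l y = P (sn y)" using P(1) by blast
  have "sn y \<in> cbox (- One) One" for y
    by (auto simp: mem_box sn_i)
  then have close: "\<bar>G (sn y) - trig l y\<bar> < e" for y
    using P(2) l by simp
  have "G (sn y) = F y" if y: "y \<in> cball c 1" for y
  proof -
    have "(\<Sum>i\<in>Basis. arcsin (sn y \<bullet> i) *\<^sub>R i) = (\<Sum>i\<in>Basis. ((y - c) \<bullet> i) *\<^sub>R i)"
    proof (intro sum.cong refl arg_cong2[where f = scaleR])
      fix i :: 'a assume i: "i \<in> Basis"
      have "\<bar>(y - c) \<bullet> i\<bar> \<le> 1"
        using Basis_le_norm[OF i, of "y - c"] y by (simp add: dist_norm norm_minus_commute)
      \<comment> \<open>The unit ball is small enough: coordinates up to 1 stay in the range where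
        \<open>arcsin\<close> inverts \<open>sin\<close>.\<close>
      then have "\<bar>(y - c) \<bullet> i\<bar> \<le> pi / 2" using pi_ge_two by linarith
      then show "arcsin (sn y \<bullet> i) = (y - c) \<bullet> i"
        using i by (auto simp: sn_i intro!: arcsin_sin)
    qed
    then show ?thesis by (simp add: G_def euclidean_representation)
  qed
  then have "\<bar>trig l y - F y\<bar> \<le> e" if "y \<in> cball c 1" for y
    using close[of y] that by auto
  moreover have "\<bar>trig l y\<bar> \<le> N + e" for y
    using close[of y] F(2)[of "c + (\<Sum>i\<in>Basis. arcsin (sn y \<bullet> i) *\<^sub>R i)"] by (simp add: G_def)
  ultimately show ?thesis by (rule that)
qed

section \<open>Positive semi-definite matrices\<close>

lemma quadratic_form_sum:
  fixes A :: "real^'n^'n"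
  shows "v \<bullet> (A *v v) = (\<Sum>i\<in>UNIV. \<Sum>j\<in>UNIV. A $ i $ j * (v $ i * v $ j))"
  by (simp add: inner_vec_def matrix_vector_mult_def sum_distrib_left algebra_simps)

text \<open>Cholesky elimination, one index at a time. A positive diagonal entry a = A k k is
  removed by subtracting w w^T with w the k-th row over sqrt a, and the Schur complement stays
  positive semi-definite; a zero diagonal entry forces its whole row to vanish.\<close>

lemma psd_decomposition:
  fixes A :: "real^'n^'n"
  assumes sym: "transpose A = A" and psd: "\<And>v. 0 \<le> v \<bullet> (A *v v)"
  obtains \<Sigma> where "\<And>i j. A $ i $ j = (\<Sum>\<sigma>\<leftarrow>\<Sigma>. \<sigma> $ i * \<sigma> $ j)"
proof -
  have "\<exists>\<Sigma>. \<forall>i j. A $ i $ j = (\<Sum>\<sigma>\<leftarrow>\<Sigma>. \<sigma> $ i * \<sigma> $ j)"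
    if "finite F" "transpose A = A" "\<And>v. 0 \<le> v \<bullet> (A *v v)" "\<And>i j. i \<notin> F \<Longrightarrow> A $ i $ j = 0"
    for F and A :: "real^'n^'n"
    using that
  proof (induction F arbitrary: A rule: finite_induct)
    case empty
    then show ?case by (intro exI[of _ "[]"]) auto
  next
    case (insert k F)
    note psd = insert.prems(2)
    have sym: "A $ i $ j = A $ j $ i" for i j
      using insert.prems(1) by (metis transpose_def vec_lambda_beta)
    define a where "a = A $ k $ k"
    have Ak: "A *v axis k 1 = (\<chi> i. A $ k $ i)"
      by (simp add: vec_eq_iff matrix_vector_mult_basis column_def sym[of _ k])
    have sa: "x \<bullet> (A *v y) = y \<bullet> (A *v x)" for x y
      using insert.prems(1) by (metis dot_lmul_matrix inner_commute vector_transpose_matrix)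
    have expand: "(v + t *\<^sub>R axis k 1) \<bullet> (A *v (v + t *\<^sub>R axis k 1))
        = v \<bullet> (A *v v) + 2 * t * ((A $ k) \<bullet> v) + t\<^sup>2 * a" for v t
    proof -
      have "(A *v axis k 1) \<bullet> v = (A $ k) \<bullet> v"
        by (simp add: Ak inner_vec_def)
      moreover have "axis k 1 \<bullet> (A *v axis k 1) = a"
        by (simp add: Ak a_def inner_axis')
      moreover have "A *v (t *\<^sub>R axis k 1) = t *\<^sub>R (A *v axis k 1)"
        by (simp add: linear_scale)
      ultimately show ?thesis
        using sa[of "axis k 1" v]
        by (simp add: matrix_vector_right_distrib inner_add_left inner_add_right power2_eq_square inner_commute algebra_simps)
    qed
    have "a \<ge> 0" using psd[of "axis k 1"] by (simp add: Ak a_def inner_axis')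
    then consider "a = 0" | "a > 0" by linarith
    then show ?case
    proof cases
      case 1
      have "A $ k $ i = 0" for i
      proof (rule ccontr)
        assume nz: "A $ k $ i \<noteq> 0"
        \<comment> \<open>With a = 0 the form is affine in t, and this t gives it the value
          -1.\<close>
        define t where "t = - (axis i 1 \<bullet> (A *v axis i 1) + 1) / (2 * (A $ k $ i))"
        have "(A $ k) \<bullet> axis i 1 = A $ k $ i" by (simp add: inner_axis)
        then show False
          using psd[of "axis i 1 + t *\<^sub>R axis k 1"] nz unfolding expand 1
          by (simp add: t_def field_simps)
      qed
      then have "A $ i $ j = 0" if "i \<notin> F" for i j
        using insert.prems(3)[of i j] that by (cases "i = k") auto
      then show ?thesis using insert.IH[of A] insert.prems by blast
    next
      case 2
      define w where "w = (1 / sqrt a) *\<^sub>R (A $ k)"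
      define A' where "A' = (\<chi> i j. A $ i $ j - w $ i * w $ j)"
      have ww: "w $ i * w $ j = A $ k $ i * A $ k $ j / a" for i j
        using 2 by (simp add: w_def field_simps flip: power2_eq_square)
      have "transpose A' = A'"
        by (simp add: vec_eq_iff transpose_def A'_def sym mult.commute)
      moreover have "0 \<le> v \<bullet> (A' *v v)" for v
      proof -
        define s where "s = (A $ k) \<bullet> v"
        have "v \<bullet> (A' *v v) = v \<bullet> (A *v v) - (w \<bullet> v)\<^sup>2"
        proof -
          have "(w \<bullet> v)\<^sup>2 = (\<Sum>i\<in>UNIV. \<Sum>j\<in>UNIV. w $ i * w $ j * (v $ i * v $ j))"
            by (simp add: inner_vec_def power2_eq_square sum_product algebra_simps)
          then show ?thesis
            by (simp add: quadratic_form_sum A'_def left_diff_distrib sum_subtractf)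
        qed
        also have "(w \<bullet> v)\<^sup>2 = s\<^sup>2 / a"
          using 2 by (simp add: w_def s_def power_divide)
        \<comment> \<open>Completing the square: \<open>- s / a\<close> minimises the form along the
          k-th axis, and the minimum is the value of the reduced form.\<close>
        also have "v \<bullet> (A *v v) - s\<^sup>2 / a = (v + (- s / a) *\<^sub>R axis k 1) \<bullet> (A *v (v + (- s / a) *\<^sub>R axis k 1))"
          unfolding expand s_def[symmetric] using 2 by (simp add: field_simps power2_eq_square)
        finally show ?thesis using psd by simp
      qed
      moreover have "A' $ i $ j = 0" if "i \<notin> F" for i j
      proof (cases "i = k")
        case True
        then show ?thesis using 2 by (simp add: A'_def ww a_def)
      next
        case False
        then have "A $ i $ j = 0" "A $ k $ i = 0" using insert.prems(3) that sym[of k i] by auto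
        then show ?thesis by (simp add: A'_def ww)
      qed
      ultimately obtain \<Sigma> where "\<forall>i j. A' $ i $ j = (\<Sum>\<sigma>\<leftarrow>\<Sigma>. \<sigma> $ i * \<sigma> $ j)"
        using insert.IH[of A'] by blast
      moreover have "A $ i $ j = w $ i * w $ j + A' $ i $ j" for i j
        by (simp add: A'_def)
      ultimately have "A $ i $ j = (\<Sum>\<sigma>\<leftarrow>w # \<Sigma>. \<sigma> $ i * \<sigma> $ j)" for i j
        by simp
      then show ?thesis by blast
    qed
  qed
  from this[of UNIV A] show ?thesis using sym psd that by auto
qed

lemma perturbed_trace_bound:
  fixes E H :: "real^'n^'n" and \<kappa> K :: real
  assumes E: "\<And>i j. \<bar>E $ i $ j\<bar> \<le> \<kappa> / CARD('n)" "transpose E = E"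
    and H: "\<And>\<xi>. - (K * (\<xi> \<bullet> \<xi>)) \<le> \<xi> \<bullet> (H *v \<xi>)" and K: "0 \<le> K"
  shows "(\<Sum>i\<in>UNIV. \<Sum>j\<in>UNIV. E $ i $ j * H $ i $ j) \<le> \<kappa> * (\<Sum>i\<in>UNIV. H $ i $ i) + \<kappa> * K * (CARD('n) + 1)"
proof -
  have \<kappa>: "0 \<le> \<kappa>" using order_trans[OF abs_ge_zero E(1)] by (simp add: zero_le_divide_iff)
  define S where "S = H + mat K"
  have SH: "S $ i $ j = H $ i $ j + (if i = j then K else 0)" for i j
    by (simp add: S_def mat_def)
  have "\<xi> \<bullet> (mat K *v \<xi>) = K * (\<xi> \<bullet> \<xi>)" for \<xi> :: "real^'n"
  proof -
    have "mat K *v \<xi> = K *\<^sub>R \<xi>"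
      by (simp add: vec_eq_iff matrix_vector_mult_def mat_def if_distrib[of "\<lambda>x. x * _"] sum.delta cong: if_cong)
    then show ?thesis by simp
  qed
  then have S: "0 \<le> \<xi> \<bullet> (S *v \<xi>)" for \<xi>
    using H[of \<xi>] by (simp add: S_def matrix_vector_mult_add_rdistrib inner_add_right)
  have Sij: "axis i 1 \<bullet> (S *v axis j 1) = S $ i $ j" for i j
    by (simp add: matrix_vector_mult_basis column_def inner_axis')
  \<comment> \<open>Testing S with the sum and the difference of two basis vectors.\<close>
  have pair: "\<bar>S $ i $ j + S $ j $ i\<bar> \<le> S $ i $ i + S $ j $ j" for i j
    using S[of "axis i 1 + axis j 1"] S[of "axis i 1 - axis j 1"]
    by (simp add: matrix_vector_right_distrib matrix_vector_mult_diff_distrib inner_add_left inner_add_right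
        inner_diff_left inner_diff_right Sij)
  have Es: "E $ i $ j = E $ j $ i" for i j
    using E(2) by (metis transpose_def vec_lambda_beta)
  have "(\<Sum>i\<in>UNIV. \<Sum>j\<in>UNIV. E $ i $ j * S $ i $ j) = (\<Sum>i\<in>UNIV. \<Sum>j\<in>UNIV. E $ i $ j * S $ j $ i)"
    by (subst sum.swap) (simp add: Es)
  then have "2 * (\<Sum>i\<in>UNIV. \<Sum>j\<in>UNIV. E $ i $ j * S $ i $ j) =
      (\<Sum>i\<in>UNIV. \<Sum>j\<in>UNIV. E $ i $ j * (S $ i $ j + S $ j $ i))"
    by (simp add: distrib_left sum.distrib)
  also have "\<dots> \<le> (\<Sum>i\<in>UNIV. \<Sum>j\<in>UNIV. \<kappa> / CARD('n) * (S $ i $ i + S $ j $ j))"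
  proof (intro sum_mono)
    fix i j
    have "E $ i $ j * (S $ i $ j + S $ j $ i) \<le> \<bar>E $ i $ j\<bar> * \<bar>S $ i $ j + S $ j $ i\<bar>"
      by (metis abs_ge_self abs_mult)
    also have "\<dots> \<le> \<kappa> / CARD('n) * (S $ i $ i + S $ j $ j)"
      using E(1) pair \<kappa> by (intro mult_mono) auto
    finally show "E $ i $ j * (S $ i $ j + S $ j $ i) \<le> \<kappa> / CARD('n) * (S $ i $ i + S $ j $ j)" .
  qed
  also have "\<dots> = 2 * (\<kappa> * (\<Sum>i\<in>UNIV. S $ i $ i))"
    unfolding sum_distrib_left[symmetric] by (simp add: sum.distrib sum_distrib_left[symmetric])
  finally have 1: "(\<Sum>i\<in>UNIV. \<Sum>j\<in>UNIV. E $ i $ j * S $ i $ j) \<le> \<kappa> * (\<Sum>i\<in>UNIV. S $ i $ i)" by simp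
  have "\<bar>\<Sum>i\<in>UNIV. E $ i $ i\<bar> \<le> (\<Sum>i\<in>(UNIV::'n set). \<kappa> / CARD('n))"
    by (rule order_trans[OF sum_abs]) (intro sum_mono E(1))
  then have "- (K * (\<Sum>i\<in>UNIV. E $ i $ i)) \<le> K * \<kappa>"
    using mult_left_mono[OF _ K, of "- (\<Sum>i\<in>UNIV. E $ i $ i)" \<kappa>] by simp
  moreover have "(\<Sum>i\<in>UNIV. \<Sum>j\<in>UNIV. E $ i $ j * S $ i $ j) =
      (\<Sum>i\<in>UNIV. \<Sum>j\<in>UNIV. E $ i $ j * H $ i $ j) + K * (\<Sum>i\<in>UNIV. E $ i $ i)"
  proof -
    have "E $ i $ j * S $ i $ j = E $ i $ j * H $ i $ j + (if i = j then K * E $ i $ i else 0)" for i j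
      by (simp add: SH algebra_simps)
    then show ?thesis by (simp add: sum.distrib sum.delta sum_distrib_left)
  qed
  moreover have "(\<Sum>i\<in>UNIV. S $ i $ i) = (\<Sum>i\<in>UNIV. H $ i $ i) + CARD('n) * K"
    by (simp add: SH sum.distrib)
  ultimately show ?thesis using 1 by (simp add: algebra_simps)
qed

section \<open>Sup-convolution of subsolutions\<close>

definition supconv :: "real \<Rightarrow> ('a::real_normed_vector \<Rightarrow> real \<Rightarrow> real) \<Rightarrow> 'a \<Rightarrow> real \<Rightarrow> real" where
  "supconv \<epsilon> u y t = Sup (range (\<lambda>w. u (y + w) t - (norm w)\<^sup>2 / (2 * \<epsilon>)))"

definition local_max_at ::
  "real \<Rightarrow> ('a::metric_space \<Rightarrow> real \<Rightarrow> real) \<Rightarrow> ('a \<times> real \<Rightarrow> real) \<Rightarrow> 'a \<Rightarrow> real \<Rightarrow> bool" where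
  "local_max_at T f v z t \<longleftrightarrow> (\<exists>e>0. \<forall>y s. (y, s) \<in> ball (z, t) e \<and> 0 < s \<and> s < T \<longrightarrow>
     f y s - v (y, s) \<le> f z t - v (z, t))"

text \<open>One-sided, so that a supersolution u can be handled as the subsolution -u, and
  restricted to the test functions that the comparison uses.\<close>

definition elementary_subsolution ::
  "(real^'n \<Rightarrow> real \<Rightarrow> real^'n^'n) \<Rightarrow> (real^'n \<Rightarrow> real \<Rightarrow> real) \<Rightarrow> real \<Rightarrow> (real^'n \<Rightarrow> real \<Rightarrow> real) \<Rightarrow> bool" where
  "elementary_subsolution A b T u \<longleftrightarrow>
    (\<forall>\<phi> x0 t0. elementary \<phi> \<and> 0 < t0 \<and> t0 < T \<and> local_max_at T u \<phi> x0 t0 \<longrightarrow>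
      dt \<phi> (x0, t0) \<le> (\<Sum>i\<in>UNIV. \<Sum>j\<in>UNIV. A (grad_x \<phi> (x0, t0)) t0 $ i $ j * hess_x \<phi> (x0, t0) $ i $ j)
        + b (grad_x \<phi> (x0, t0)) t0)"

lemma visc_sub_elementary: "visc_sub A b T u \<Longrightarrow> elementary_subsolution A b T u"
  unfolding visc_sub_def elementary_subsolution_def local_max_at_def
  using elementary_smooth_on[where S = "UNIV \<times> {0<..<T}"] by (fastforce simp: algebra_simps)

text \<open>Testing -u from above by \<phi> is testing u from below by -\<phi>; as the gradient
  changes sign, the coefficients become A(-p) and -b(-p).\<close>

lemma visc_super_elementary:
  assumes "visc_super A b T u"
  shows "elementary_subsolution (\<lambda>p. A (- p)) (\<lambda>p t. - b (- p) t) T (\<lambda>x t. - u x t)"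
  unfolding elementary_subsolution_def
proof (intro allI impI, elim conjE)
  fix \<phi> x0 t0
  assume \<phi>: "elementary \<phi>" and t0: "0 < t0" "t0 < T" and max: "local_max_at T (\<lambda>x t. - u x t) \<phi> x0 t0"
  have "\<exists>e>0. \<forall>x t. (x, t) \<in> ball (x0, t0) e \<and> 0 < t \<and> t < T \<longrightarrow>
      u x t - (- \<phi> (x, t)) \<ge> u x0 t0 - (- \<phi> (x0, t0))"
    using max unfolding local_max_at_def by (simp add: algebra_simps)
  then have "dt (\<lambda>z. - \<phi> z) (x0, t0)
      - (\<Sum>i\<in>UNIV. \<Sum>j\<in>UNIV. A (grad_x (\<lambda>z. - \<phi> z) (x0, t0)) t0 $ i $ j * hess_x (\<lambda>z. - \<phi> z) (x0, t0) $ i $ j)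
      - b (grad_x (\<lambda>z. - \<phi> z) (x0, t0)) t0 \<ge> 0"
    using assms elementary_smooth_on[OF elementary_minus[OF \<phi>]] t0 unfolding visc_super_def by blast
  moreover have "dt (\<lambda>z. - \<phi> z) z = - dt \<phi> z" "grad_x (\<lambda>z. - \<phi> z) z = - grad_x \<phi> z"
    "hess_x (\<lambda>z. - \<phi> z) z = - hess_x \<phi> z" for z
    using \<phi> by (simp_all add: dt_def grad_x_def hess_x_def pdir_minus elementary_pdir vec_eq_iff)
  ultimately show "dt \<phi> (x0, t0) \<le> (\<Sum>i\<in>UNIV. \<Sum>j\<in>UNIV. A (- grad_x \<phi> (x0, t0)) t0 $ i $ j * hess_x \<phi> (x0, t0) $ i $ j)
        + - b (- grad_x \<phi> (x0, t0)) t0"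
    by (simp add: sum_negf)
qed

text \<open>Interpreted twice, for u and for -u with the reflected coefficients, so that each
  one-sided estimate is proved once for both points of the pair.\<close>

locale bounded_subsolution =
  fixes A :: "real^'n \<Rightarrow> real \<Rightarrow> real^'n^'n" and b :: "real^'n \<Rightarrow> real \<Rightarrow> real"
    and T :: real and u :: "real^'n \<Rightarrow> real \<Rightarrow> real" and N \<epsilon> :: real
  assumes unif: "uniformly_continuous_on (UNIV \<times> {0..T}) (\<lambda>(x, t). u x t)"
    and bdd: "t \<in> {0..T} \<Longrightarrow> \<bar>u x t\<bar> \<le> N"
    and sub: "elementary_subsolution A b T u"
    and eps: "0 < \<epsilon>"
begin

lemma supconv_attained_ge:
  assumes t: "t \<in> {0..T}"
  shows "(\<exists>w. supconv \<epsilon> u y t = u (y + w) t - (norm w)\<^sup>2 / (2 * \<epsilon>)) \<and>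
    u (y + w') t - (norm w')\<^sup>2 / (2 * \<epsilon>) \<le> supconv \<epsilon> u y t"
proof -
  define g where "g = (\<lambda>w. u (y + w) t - (norm w)\<^sup>2 / (2 * \<epsilon>))"
  \<comment> \<open>Beyond this radius the penalty is at least 2 N, the largest possible gain in u,
    so shifts outside the ball do no better than the zero shift.\<close>
  define R where "R = sqrt (4 * \<epsilon> * N)"
  have N: "0 \<le> N" using bdd[OF t, of 0] by simp
  have R: "0 \<le> R" "R\<^sup>2 = 4 * \<epsilon> * N" using N eps by (auto simp: R_def)
  have "continuous_on UNIV (\<lambda>w. (case (y + w, t) of (x, t) \<Rightarrow> u x t))"
    by (rule continuous_on_compose2[OF uniformly_continuous_imp_continuous[OF unif]])
      (use t in \<open>auto intro!: continuous_intros\<close>)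
  then have "continuous_on (cball 0 R) g"
    unfolding g_def using eps by (auto intro!: continuous_intros elim: continuous_on_subset)
  then obtain w where w: "w \<in> cball 0 R" "\<And>w'. w' \<in> cball 0 R \<Longrightarrow> g w' \<le> g w"
    using continuous_attains_sup[of "cball 0 R" g] R by auto
  have max: "g w' \<le> g w" for w'
  proof (cases "w' \<in> cball 0 R")
    case False
    then have "R\<^sup>2 \<le> (norm w')\<^sup>2" using R(1) by (intro power_mono) auto
    then have "2 * N \<le> (norm w')\<^sup>2 / (2 * \<epsilon>)" using R(2) eps by (simp add: field_simps)
    then have "g w' \<le> g 0"
      using bdd[OF t, of "y + w'"] bdd[OF t, of y] by (simp add: g_def)
    also have "\<dots> \<le> g w" using w(2)[of 0] R by simp
    finally show ?thesis .
  qed (use w in auto)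
  then have "supconv \<epsilon> u y t = g w"
    unfolding supconv_def g_def[symmetric] by (intro cSup_eq_maximum) auto
  then show ?thesis using max by (auto simp: g_def)
qed

lemmas supconv_attained = conjunct1[OF supconv_attained_ge]
lemmas supconv_ge = conjunct2[OF supconv_attained_ge]

lemma supconv_bounded:
  assumes t: "t \<in> {0..T}" shows "\<bar>supconv \<epsilon> u y t\<bar> \<le> N"
proof -
  obtain w where "supconv \<epsilon> u y t = u (y + w) t - (norm w)\<^sup>2 / (2 * \<epsilon>)"
    using supconv_attained[OF t] by blast
  moreover have "0 \<le> (norm w)\<^sup>2 / (2 * \<epsilon>)" using eps by simp
  ultimately show ?thesis
    using bdd[OF t, of "y + w"] bdd[OF t, of y] supconv_ge[OF t, of y 0] by auto
qed

text \<open>The d that serves u serves the sup-convolution too, because the maximiser at one point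
  is an admissible shift at the other. A common d is what the comparison of near-maximisers at
  different points will need.\<close>

lemma supconv_uniformly_continuous:
  assumes "0 < \<sigma>"
  obtains d where "0 < d" "\<And>x x'. x \<in> UNIV \<times> {0..T} \<Longrightarrow> x' \<in> UNIV \<times> {0..T} \<Longrightarrow> dist x' x < d \<Longrightarrow>
      \<bar>(\<lambda>(x, t). u x t) x' - (\<lambda>(x, t). u x t) x\<bar> < \<sigma>"
    "\<And>x x'. x \<in> UNIV \<times> {0..T} \<Longrightarrow> x' \<in> UNIV \<times> {0..T} \<Longrightarrow> dist x' x < d \<Longrightarrow>
      \<bar>(\<lambda>(x, t). supconv \<epsilon> u x t) x' - (\<lambda>(x, t). supconv \<epsilon> u x t) x\<bar> < \<sigma>"
proof -
  from unif assms obtain d where d: "0 < d" "\<And>x x'. x \<in> UNIV \<times> {0..T} \<Longrightarrow> x' \<in> UNIV \<times> {0..T} \<Longrightarrow>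
      dist x' x < d \<Longrightarrow> \<bar>(\<lambda>(x, t). u x t) x' - (\<lambda>(x, t). u x t) x\<bar> < \<sigma>"
    unfolding uniformly_continuous_on_def dist_real_def by metis
  have less: "supconv \<epsilon> u y t < supconv \<epsilon> u y' t' + \<sigma>"
    if t: "t \<in> {0..T}" "t' \<in> {0..T}" and near: "dist (y', t') (y, t) < d" for y t y' t'
  proof -
    obtain w where w: "supconv \<epsilon> u y t = u (y + w) t - (norm w)\<^sup>2 / (2 * \<epsilon>)"
      using supconv_attained[OF t(1)] by blast
    have "dist (y' + w, t') (y + w, t) < d" using near by (simp add: dist_Pair_Pair)
    then show ?thesis
      using d(2)[of "(y + w, t)" "(y' + w, t')"] supconv_ge[OF t(2), of y' w] t w by auto
  qed
  show thesis
  proof (rule that[OF d(1) d(2)])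
    fix x x' :: "(real^'n) \<times> real" assume x: "x \<in> UNIV \<times> {0..T}" "x' \<in> UNIV \<times> {0..T}" "dist x' x < d"
    obtain y t y' t' where "x = (y, t)" "x' = (y', t')" by (cases x; cases x')
    then show "\<bar>(\<lambda>(x, t). supconv \<epsilon> u x t) x' - (\<lambda>(x, t). supconv \<epsilon> u x t) x\<bar> < \<sigma>"
      using less[of t t' y' y] less[of t' t y y'] x by (auto simp: dist_commute)
  qed
qed

lemma supconv_continuous: "continuous_on (UNIV \<times> {0..T}) (\<lambda>(x, t). supconv \<epsilon> u x t)"
proof (rule uniformly_continuous_imp_continuous)
  show "uniformly_continuous_on (UNIV \<times> {0..T}) (\<lambda>(x, t). supconv \<epsilon> u x t)"
    unfolding uniformly_continuous_on_def dist_real_def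
    by (metis supconv_uniformly_continuous)
qed

text \<open>As the equation does not depend on \<open>x\<close>, spatial sup-convolution preserves subsolutions exactly; the gradient
  of a test function at a touching point is determined by the maximiser \<open>w\<close>.\<close>

lemma supconv_touching:
  assumes v: "elementary v" and t: "0 < t" "t < T" and touch: "local_max_at T (supconv \<epsilon> u) v z t"
    and w: "supconv \<epsilon> u z t = u (z + w) t - (norm w)\<^sup>2 / (2 * \<epsilon>)"
  shows "dt v (z, t) \<le> (\<Sum>i\<in>UNIV. \<Sum>j\<in>UNIV. A ((1 / \<epsilon>) *\<^sub>R w) t $ i $ j * hess_x v (z, t) $ i $ j)
      + b ((1 / \<epsilon>) *\<^sub>R w) t"
    and "- ((\<xi> \<bullet> \<xi>) / \<epsilon>) \<le> pdir2 v \<xi> (z, t)"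
proof -
  obtain e where e: "e > 0" "\<And>y s. (y, s) \<in> ball (z, t) e \<Longrightarrow> 0 < s \<Longrightarrow> s < T \<Longrightarrow>
      supconv \<epsilon> u y s - v (y, s) \<le> supconv \<epsilon> u z t - v (z, t)"
    using touch unfolding local_max_at_def by blast
  have tT: "t \<in> {0..T}" using t by simp
  \<comment> \<open>Since v touches the sup-convolution at z and the value there comes from u at z +
    w, the translate of v by w touches u at z + w.\<close>
  define \<phi> where "\<phi> = (\<lambda>p. v (p - (w, 0)))"
  have "u x s - \<phi> (x, s) \<le> u (z + w) t - \<phi> (z + w, t)"
    if "(x, s) \<in> ball (z + w, t) e" "0 < s" "s < T" for x s
  proof -
    have "dist (z + w) x = dist z (x - w)" by (simp add: dist_norm algebra_simps)
    then have "(x - w, s) \<in> ball (z, t) e" using that(1) by (simp add: dist_Pair_Pair)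
    then show ?thesis
      using e(2)[of "x - w" s] supconv_ge[of s "x - w" w] that w by (simp add: \<phi>_def)
  qed
  then have "local_max_at T u \<phi> (z + w) t"
    unfolding local_max_at_def using e(1) by blast
  then have "dt \<phi> (z + w, t)
      \<le> (\<Sum>i\<in>UNIV. \<Sum>j\<in>UNIV. A (grad_x \<phi> (z + w, t)) t $ i $ j * hess_x \<phi> (z + w, t) $ i $ j)
        + b (grad_x \<phi> (z + w, t)) t"
    using sub t elementary_shift[OF v, of "(w, 0)", folded \<phi>_def] unfolding elementary_subsolution_def by blast
  moreover have "dt \<phi> (z + w, t) = dt v (z, t)" "grad_x \<phi> (z + w, t) = grad_x v (z, t)"
    "hess_x \<phi> (z + w, t) = hess_x v (z, t)"
    by (simp_all add: dt_def grad_x_def hess_x_def \<phi>_def pdir_shift)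
  ultimately have visc: "dt v (z, t) \<le>
      (\<Sum>i\<in>UNIV. \<Sum>j\<in>UNIV. A (grad_x v (z, t)) t $ i $ j * hess_x v (z, t) $ i $ j) + b (grad_x v (z, t)) t"
    by simp
  have test: "pdir v (\<xi>, 0) (z, t) = (w \<bullet> \<xi>) / \<epsilon> \<and> - ((\<xi> \<bullet> \<xi>) / \<epsilon>) \<le> pdir2 v \<xi> (z, t)" for \<xi>
  proof -
    \<comment> \<open>Moving z by r \<xi> while keeping z + w fixed changes the shift to w - r
      \<xi>; this bounds the sup-convolution from below by a paraboloid in r. Hence v minus that
      paraboloid has a minimum at r = 0: its first derivative gives the gradient w / \<epsilon>, its
      second the bound on the Hessian.\<close>
    define g where "g = (\<lambda>r. v ((z, t) + r *\<^sub>R (\<xi>, 0)) + (r\<^sup>2 * (\<xi> \<bullet> \<xi>) / (2 * \<epsilon>) - r * (w \<bullet> \<xi>) / \<epsilon>))"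
    define g1 where "g1 = (\<lambda>r. pdir v (\<xi>, 0) ((z, t) + r *\<^sub>R (\<xi>, 0)) + (r * (\<xi> \<bullet> \<xi>) / \<epsilon> - (w \<bullet> \<xi>) / \<epsilon>))"
    have "g1 0 = 0 \<and> pdir2 v \<xi> ((z, t) + 0 *\<^sub>R (\<xi>, 0)) + (\<xi> \<bullet> \<xi>) / \<epsilon> \<ge> 0"
    proof (rule second_derivative_test)
      show "(g has_real_derivative g1 r) (at r)" for r
        unfolding g_def g1_def
        by (rule DERIV_add[OF pdir_line_at[OF v]])
          (use eps in \<open>auto intro!: derivative_eq_intros simp: field_simps\<close>)
      show "(g1 has_real_derivative pdir2 v \<xi> ((z, t) + 0 *\<^sub>R (\<xi>, 0)) + (\<xi> \<bullet> \<xi>) / \<epsilon>) (at 0)"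
        unfolding g1_def pdir2_def
        by (rule DERIV_add[OF pdir_line_at[OF elementary_pdir[OF v]]])
          (use eps in \<open>auto intro!: derivative_eq_intros simp: field_simps\<close>)
      show "e / (norm \<xi> + 1) > 0" using e(1) by (intro divide_pos_pos add_nonneg_pos) auto
      fix r :: real assume "\<bar>r\<bar> < e / (norm \<xi> + 1)"
      then have "\<bar>r\<bar> * (norm \<xi> + 1) < e" by (simp add: pos_less_divide_eq add_nonneg_pos)
      then have "norm (r *\<^sub>R \<xi>) < e" by (simp add: algebra_simps)
      then have "(z + r *\<^sub>R \<xi>, t) \<in> ball (z, t) e" by (simp add: dist_Pair_Pair dist_norm)
      then have "supconv \<epsilon> u (z + r *\<^sub>R \<xi>) t - v (z + r *\<^sub>R \<xi>, t) \<le> supconv \<epsilon> u z t - v (z, t)"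
        using e(2) t by blast
      moreover have "u (z + w) t - (norm (w - r *\<^sub>R \<xi>))\<^sup>2 / (2 * \<epsilon>) \<le> supconv \<epsilon> u (z + r *\<^sub>R \<xi>) t"
        using supconv_ge[OF tT, of "z + r *\<^sub>R \<xi>" "w - r *\<^sub>R \<xi>"] by simp
      moreover have "(norm (w - r *\<^sub>R \<xi>))\<^sup>2 / (2 * \<epsilon>)
          = (norm w)\<^sup>2 / (2 * \<epsilon>) - r * (w \<bullet> \<xi>) / \<epsilon> + r\<^sup>2 * (\<xi> \<bullet> \<xi>) / (2 * \<epsilon>)"
      proof -
        have "(norm (w - r *\<^sub>R \<xi>))\<^sup>2 = (norm w)\<^sup>2 - 2 * (r * (w \<bullet> \<xi>)) + r\<^sup>2 * (\<xi> \<bullet> \<xi>)"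
          unfolding power2_norm_eq_inner
          by (simp add: inner_diff_left inner_diff_right inner_commute power2_eq_square)
        then show ?thesis using eps by (simp add: field_simps)
      qed
      ultimately show "g 0 \<le> g r" using w by (simp add: g_def)
    qed
    then show ?thesis by (simp add: g1_def)
  qed
  have "grad_x v (z, t) = (1 / \<epsilon>) *\<^sub>R w"
    using test by (simp add: grad_x_def vec_eq_iff inner_axis)
  then show "dt v (z, t) \<le> (\<Sum>i\<in>UNIV. \<Sum>j\<in>UNIV. A ((1 / \<epsilon>) *\<^sub>R w) t $ i $ j * hess_x v (z, t) $ i $ j)
      + b ((1 / \<epsilon>) *\<^sub>R w) t" using visc by simp
  show "- ((\<xi> \<bullet> \<xi>) / \<epsilon>) \<le> pdir2 v \<xi> (z, t)" using test by blast
qed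

end

text \<open>Near a point where the maximiser is unique the sup-convolution satisfies a \<^emph>\<open>linear\<close> inequality with constant
  coefficients: semiconvexity bounds the Hessian of a touching function from below, so the oscillation of \<open>A\<close>
  is absorbed by adding a multiple of the identity.\<close>

lemma (in bounded_subsolution) supconv_frozen:
  assumes A_cont: "\<forall>i j. continuous_on (UNIV \<times> {0..T}) (\<lambda>(p, t). A p t $ i $ j)"
    and b_cont: "continuous_on (UNIV \<times> {0..T}) (\<lambda>(p, t). b p t)"
    and A_sym: "\<forall>p. \<forall>t\<in>{0..T}. transpose (A p t) = A p t"
    and t0: "0 < t0" "t0 < T" and \<kappa>: "0 < \<kappa>"
    and ident: "\<And>\<theta>. 0 < \<theta> \<Longrightarrow> \<exists>\<sigma>>0. \<forall>w. supconv \<epsilon> u y0 t0 - \<sigma> \<le> u (y0 + w) t0 - (norm w)\<^sup>2 / (2 * \<epsilon>) \<longrightarrow>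
        norm (w - \<epsilon> *\<^sub>R p0) \<le> \<theta>"
  obtains r where "0 < r" "r < t0" "t0 + r < T"
    "\<And>v z t. elementary v \<Longrightarrow> dist z y0 < r \<Longrightarrow> \<bar>t - t0\<bar> < r \<Longrightarrow> local_max_at T (supconv \<epsilon> u) v z t \<Longrightarrow>
      dt v (z, t) \<le> (\<Sum>i\<in>UNIV. \<Sum>j\<in>UNIV. (A p0 t0 + mat \<kappa>) $ i $ j * hess_x v (z, t) $ i $ j) + b p0 t0
        + \<kappa> * ((CARD('n) + 1) / \<epsilon> + 1)"
proof -
  define S where "S = (UNIV :: (real^'n) set) \<times> {0..T}"
  have S: "(p0, t0) \<in> S" using t0 by (simp add: S_def)
  define c where "c = \<kappa> / CARD('n)"
  have c: "0 < c" using \<kappa> by (simp add: c_def)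
  have "\<forall>\<^sub>F x in at (p0, t0) within S. \<forall>i j. dist (A (fst x) (snd x) $ i $ j) (A p0 t0 $ i $ j) < c"
    using A_cont S c unfolding S_def continuous_on_def
    by (intro eventually_all_finite) (force simp: case_prod_beta dest!: tendstoD)
  moreover have "\<forall>\<^sub>F x in at (p0, t0) within S. dist (b (fst x) (snd x)) (b p0 t0) < \<kappa>"
    using b_cont S \<kappa> unfolding S_def continuous_on_def by (force simp: case_prod_beta dest!: tendstoD)
  ultimately have "\<forall>\<^sub>F x in at (p0, t0) within S. (\<forall>i j. dist (A (fst x) (snd x) $ i $ j) (A p0 t0 $ i $ j) < c)
      \<and> dist (b (fst x) (snd x)) (b p0 t0) < \<kappa>"
    by (rule eventually_conj)
  then obtain \<delta> where \<delta>: "0 < \<delta>" "\<And>p t. t \<in> {0..T} \<Longrightarrow> dist (p, t) (p0, t0) < \<delta> \<Longrightarrow> (p, t) \<noteq> (p0, t0) \<Longrightarrow>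
      (\<forall>i j. \<bar>A p t $ i $ j - A p0 t0 $ i $ j\<bar> < c) \<and> \<bar>b p t - b p0 t0\<bar> < \<kappa>"
    unfolding eventually_at dist_real_def S_def by fastforce
  have close: "\<bar>A p t $ i $ j - A p0 t0 $ i $ j\<bar> \<le> c \<and> \<bar>b p t - b p0 t0\<bar> \<le> \<kappa>"
    if "t \<in> {0..T}" "dist (p, t) (p0, t0) < \<delta>" for p t i j
    using \<delta>(2)[OF that] c \<kappa> by (cases "(p, t) = (p0, t0)") (auto intro: less_imp_le)
  \<comment> \<open>The gradient at a touching point is p = w / \<epsilon>, so |w - \<epsilon> p0|
    \<le> \<theta> means |p - p0| \<le> \<delta> / 2; the other half of \<delta> is left for the
    time variable.\<close>
  define \<theta> where "\<theta> = \<epsilon> * \<delta> / 2"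
  have "0 < \<theta>" using eps \<delta> by (simp add: \<theta>_def)
  then obtain \<sigma> where \<sigma>: "0 < \<sigma>" "\<And>w. supconv \<epsilon> u y0 t0 - \<sigma> \<le> u (y0 + w) t0 - (norm w)\<^sup>2 / (2 * \<epsilon>) \<Longrightarrow>
        norm (w - \<epsilon> *\<^sub>R p0) \<le> \<theta>"
    using ident by blast
  obtain d where d: "0 < d" "\<And>x x'. x \<in> UNIV \<times> {0..T} \<Longrightarrow> x' \<in> UNIV \<times> {0..T} \<Longrightarrow> dist x' x < d \<Longrightarrow>
      \<bar>(\<lambda>(x, t). u x t) x' - (\<lambda>(x, t). u x t) x\<bar> < \<sigma> / 2"
    "\<And>x x'. x \<in> UNIV \<times> {0..T} \<Longrightarrow> x' \<in> UNIV \<times> {0..T} \<Longrightarrow> dist x' x < d \<Longrightarrow>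
      \<bar>(\<lambda>(x, t). supconv \<epsilon> u x t) x' - (\<lambda>(x, t). supconv \<epsilon> u x t) x\<bar> < \<sigma> / 2"
    using supconv_uniformly_continuous[of "\<sigma> / 2"] \<sigma>(1) by (metis half_gt_zero)
  define r where "r = Min {d / 2, \<delta> / 2, t0 / 2, (T - t0) / 2}"
  have r: "0 < r" "r \<le> d / 2" "r \<le> \<delta> / 2" "r \<le> t0 / 2" "r \<le> (T - t0) / 2"
    using d(1) \<delta>(1) t0 by (simp_all only: r_def Min_gr_iff Min_le finite.intros insertI1 insertI2 insert_not_empty ball_simps half_gt_zero diff_gt_0_iff_gt simp_thms)
  show thesis
  proof (rule that[of r])
    fix v z t
    assume v: "elementary v" and z: "dist z y0 < r" and t: "\<bar>t - t0\<bar> < r"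
      and touch: "local_max_at T (supconv \<epsilon> u) v z t"
    have tT: "0 < t" "t < T" "t \<in> {0..T}" using t r t0 by auto
    obtain w where w: "supconv \<epsilon> u z t = u (z + w) t - (norm w)\<^sup>2 / (2 * \<epsilon>)"
      using supconv_attained[OF tT(3)] by blast
    define p where "p = (1 / \<epsilon>) *\<^sub>R w"
    define H where "H = hess_x v (z, t)"
    note T1 = supconv_touching[OF v tT(1,2) touch w, folded p_def H_def]
    have dist_sum: "dist (a, s) (a', s') \<le> dist a a' + \<bar>s - s'\<bar>" for a a' :: "real^'n" and s s' :: real
      unfolding dist_Pair_Pair by (rule order_trans[OF sqrt_sum_squares_le_sum]) (auto simp: dist_real_def)
    have "dist (z, t) (y0, t0) < d" using dist_sum[of z t y0 t0] z t r by auto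
    moreover have "dist (z + w, t) (y0 + w, t0) < d"
      using dist_sum[of "z + w" t "y0 + w" t0] z t r by auto
    ultimately have "\<bar>u (z + w) t - u (y0 + w) t0\<bar> < \<sigma> / 2"
        "\<bar>supconv \<epsilon> u z t - supconv \<epsilon> u y0 t0\<bar> < \<sigma> / 2"
      using d(2)[of "(y0 + w, t0)" "(z + w, t)"] d(3)[of "(y0, t0)" "(z, t)"] tT(3) t0 by auto
    \<comment> \<open>The maximiser w at (z, t) is a near-maximiser at (y0, t0): u and its
      sup-convolution each contribute an error \<sigma> / 2.\<close>
    then have "supconv \<epsilon> u y0 t0 - \<sigma> \<le> u (y0 + w) t0 - (norm w)\<^sup>2 / (2 * \<epsilon>)"
      using w unfolding abs_less_iff by linarith
    then have "norm (w - \<epsilon> *\<^sub>R p0) \<le> \<theta>" by (rule \<sigma>(2))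
    moreover have "w - \<epsilon> *\<^sub>R p0 = \<epsilon> *\<^sub>R (p - p0)" using eps by (simp add: p_def scaleR_right_diff_distrib)
    then have "norm (w - \<epsilon> *\<^sub>R p0) = \<epsilon> * dist p p0" using eps by (simp only: norm_scaleR dist_norm)
    ultimately have "dist p p0 \<le> \<delta> / 2" using eps by (simp add: \<theta>_def field_simps)
    then have near: "dist (p, t) (p0, t0) < \<delta>" using dist_sum[of p t p0 t0] t r by auto
    define E where "E = A p t - A p0 t0"
    have "(\<Sum>i\<in>UNIV. \<Sum>j\<in>UNIV. E $ i $ j * H $ i $ j)
        \<le> \<kappa> * (\<Sum>i\<in>UNIV. H $ i $ i) + \<kappa> * (1 / \<epsilon>) * (CARD('n) + 1)"
    proof (rule perturbed_trace_bound)
      show "\<bar>E $ i $ j\<bar> \<le> \<kappa> / CARD('n)" for i j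
        using close[OF tT(3) near] by (simp add: E_def c_def)
      show "transpose E = E"
        using A_sym tT(3) t0 by (simp add: E_def vec_eq_iff transpose_def)
      show "- (1 / \<epsilon> * (\<xi> \<bullet> \<xi>)) \<le> \<xi> \<bullet> (H *v \<xi>)" for \<xi>
        using T1(2)[of \<xi>] by (simp add: pdir2_hess_x[OF v] quadratic_form_sum H_def mult.commute)
    qed (use eps in auto)
    moreover have "(\<Sum>i\<in>UNIV. \<Sum>j\<in>UNIV. (A p0 t0 + mat \<kappa>) $ i $ j * H $ i $ j)
        = (\<Sum>i\<in>UNIV. \<Sum>j\<in>UNIV. A p0 t0 $ i $ j * H $ i $ j) + \<kappa> * (\<Sum>i\<in>UNIV. H $ i $ i)"
      by (simp add: mat_def distrib_right sum.distrib if_distrib[of "\<lambda>x. x * _"] sum.delta sum_distrib_left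
          cong: if_cong)
    moreover have "(\<Sum>i\<in>UNIV. \<Sum>j\<in>UNIV. A p t $ i $ j * H $ i $ j)
        = (\<Sum>i\<in>UNIV. \<Sum>j\<in>UNIV. A p0 t0 $ i $ j * H $ i $ j) + (\<Sum>i\<in>UNIV. \<Sum>j\<in>UNIV. E $ i $ j * H $ i $ j)"
      by (simp add: E_def left_diff_distrib sum_subtractf)
    ultimately have bounds: "(\<Sum>i\<in>UNIV. \<Sum>j\<in>UNIV. A p t $ i $ j * H $ i $ j)
        \<le> (\<Sum>i\<in>UNIV. \<Sum>j\<in>UNIV. (A p0 t0 + mat \<kappa>) $ i $ j * H $ i $ j) + \<kappa> * (1 / \<epsilon>) * (CARD('n) + 1)"
      by linarith
    show "dt v (z, t) \<le> (\<Sum>i\<in>UNIV. \<Sum>j\<in>UNIV. (A p0 t0 + mat \<kappa>) $ i $ j * hess_x v (z, t) $ i $ j)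
        + b p0 t0 + \<kappa> * ((CARD('n) + 1) / \<epsilon> + 1)"
    proof -
      have "b p t \<le> b p0 t0 + \<kappa>" using conjunct2[OF close[OF tT(3) near]] by (simp add: abs_le_iff)
      moreover have "\<kappa> * (1 / \<epsilon>) * (CARD('n) + 1) + \<kappa> = \<kappa> * ((CARD('n) + 1) / \<epsilon> + 1)"
        by (simp add: distrib_left add_divide_distrib)
      ultimately show ?thesis using bounds T1(1) unfolding H_def[symmetric] by linarith
    qed
  qed (use r t0 in auto)
qed

text \<open>The comparison runs up to t0 + \<tau> although the value at t0 is wanted: a local
  maximum in the sense of \<open>local_max_at\<close> is two-sided in time, so the touching point
  must not lie at the final time. The term \<gamma> exp(m (s - \<tau>)), with s the time since the
  start, excludes this: it outweighs the a priori gap at the end, is only \<gamma> at t0, and makes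
  the supersolution strict. C is fixed before \<tau>, l and e.\<close>

lemma (in bounded_subsolution) mean_value_inequality:
  assumes r: "0 < r" "r < t0" "t0 + r < T"
    and linear: "\<And>v z t. elementary v \<Longrightarrow> dist z y0 < r \<Longrightarrow> \<bar>t - t0\<bar> < r \<Longrightarrow>
      local_max_at T (supconv \<epsilon> u) v z t \<Longrightarrow> dt v (z, t) \<le> generator \<Sigma> v (z, t) + \<beta>"
  obtains C where "\<And>\<tau> l e. 0 < \<tau> \<Longrightarrow> \<tau> < r / 2 \<Longrightarrow> 0 \<le> e \<Longrightarrow>
    (\<And>y. y \<in> cball y0 (r / 2) \<Longrightarrow> supconv \<epsilon> u y (t0 - \<tau>) \<le> trig l y + e) \<Longrightarrow>
    (\<And>y. - N - 1 \<le> trig l y) \<Longrightarrow>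
    supconv \<epsilon> u y0 t0 \<le> heat \<Sigma> l (y0, \<tau>) + e + \<beta> * \<tau> + C * \<tau>\<^sup>2"
proof -
  define R where "R = r / 2"
  have R: "0 < R" "R < r" using r by (auto simp: R_def)
  define f where "f = supconv \<epsilon> u"
  have "t0 \<in> {0..T}" using r by auto
  from bdd[OF this] have N: "0 \<le> N" by (meson abs_ge_zero order_trans)
  \<comment> \<open>The largest possible gap: the sup-convolution is at most N, the heat flow with
    its drift at least - N - 1 - |\<beta>| r.\<close>
  define D where "D = 2 * N + 1 + \<bar>\<beta>\<bar> * r"
  have D: "0 < D" using N r by (simp add: D_def add_pos_nonneg)
  define C where "C = D / R ^ 4"
  have C: "0 \<le> C" "C * R ^ 4 = D" using D R by (auto simp: C_def)
  show thesis
  proof (rule that[of "12 * C * (trace_sq \<Sigma>)\<^sup>2"])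
    fix \<tau> e :: real and l
    assume \<tau>: "0 < \<tau>" "\<tau> < r / 2" and e: "0 \<le> e"
      and init: "\<And>y. y \<in> cball y0 (r / 2) \<Longrightarrow> supconv \<epsilon> u y (t0 - \<tau>) \<le> trig l y + e"
      and lower: "\<And>y. - N - 1 \<le> trig l y"
    have heat_lower: "- N - 1 \<le> heat \<Sigma> l (y, s)" if "0 \<le> s" for y s
      by (rule heat_lower_bound[OF lower that])
    show "supconv \<epsilon> u y0 t0 \<le> heat \<Sigma> l (y0, \<tau>) + e + \<beta> * \<tau> + 12 * C * (trace_sq \<Sigma>)\<^sup>2 * \<tau>\<^sup>2"
    proof (rule field_le_epsilon)
      fix \<gamma> :: real assume \<gamma>: "0 < \<gamma>"
      \<comment> \<open>At the final time this gives \<gamma> exp(m \<tau>) \<ge> \<gamma> m \<tau>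
        = D.\<close>
      define m where "m = D / (\<gamma> * \<tau>)"
      have m: "0 < m" using D \<gamma> \<tau> by (simp add: m_def)
      have "D = \<gamma> * (m * \<tau>)" using \<gamma> \<tau> by (simp add: m_def)
      also have "\<dots> \<le> \<gamma> * exp (m * \<tau>)"
        using exp_ge_add_one_self[of "m * \<tau>"] \<gamma> by (intro mult_left_mono) linarith+
      finally have big: "D \<le> \<gamma> * exp (m * \<tau>)" .
      define P where "P = (\<lambda>z :: (real^'n) \<times> real. \<beta> * snd z + e + \<gamma> * exp (m * snd z + - (m * \<tau>)))"
      have dP: "(P has_derivative (\<lambda>v. \<beta> * snd v + \<gamma> * (m * snd v * exp (m * snd z + - (m * \<tau>))))) (at z)" for z
        unfolding P_def by (auto intro!: derivative_eq_intros)
      have P: "elementary P"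
        unfolding P_def by (intro elementary.add elementary.mult elementary.exp elementary.const elementary_snd)
      have "pdir P (\<sigma>, 0) = (\<lambda>z. 0)" for \<sigma>
        by (intro ext, subst pdir_eq[OF dP]) simp
      then have gP: "generator \<Sigma> P z = 0" for z
        by (simp add: generator_def pdir2_def pdir_const sum_list_0)
      have tP: "pdir P (0, 1) z = \<beta> + \<gamma> * (m * exp (m * snd z + - (m * \<tau>)))" for z
        by (subst pdir_eq[OF dP]) simp
      define W where "W = (\<lambda>z. heat \<Sigma> l z + C * barrier \<Sigma> y0 z + P z)"
      note el = elementary_heat elementary_barrier P elementary.const elementary.mult elementary.add
      have W: "elementary W" unfolding W_def by (intro el)
      define t1 where "t1 = t0 - \<tau>"
      define t2 where "t2 = t0 + \<tau>"
      define V where "V = (\<lambda>z. W (z - (0, t1)))"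
      have V: "elementary V" unfolding V_def by (rule elementary_shift[OF W])
      have V_eq: "V (y, t) = W (y, t - t1)" for y t by (simp add: V_def)
      have linear_part: "- (\<bar>\<beta>\<bar> * r) \<le> \<beta> * s" if "0 \<le> s" "s \<le> 2 * \<tau>" for s
      proof -
        have "\<bar>\<beta> * s\<bar> \<le> \<bar>\<beta>\<bar> * r" unfolding abs_mult using that \<tau> by (intro mult_left_mono) auto
        then show ?thesis by (simp add: abs_le_iff)
      qed
      have W_lower: "- N - 1 - \<bar>\<beta>\<bar> * r + C * barrier \<Sigma> y0 (y, s) + \<gamma> * exp (m * s + - (m * \<tau>)) \<le> W (y, s)"
        if "0 \<le> s" "s \<le> 2 * \<tau>" for y s
        using linear_part[OF that] heat_lower[OF that(1), of y] e by (simp add: W_def P_def)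
      have le: "f y t \<le> V (y, t)" if y: "y \<in> cball y0 R" and t: "t \<in> {t1..t2}" for y t
      proof (rule ccontr)
        assume pos: "\<not> f y t \<le> V (y, t)"
        define g where "g = (\<lambda>z. (\<lambda>(x, t). f x t) z - V z)"
        define K where "K = cball y0 R \<times> {t1..t2}"
        have KT: "K \<subseteq> UNIV \<times> {0..T}" using r \<tau> by (auto simp: K_def t1_def t2_def)
        have "compact K" unfolding K_def by (intro compact_Times) auto
        moreover have "continuous_on K g"
          unfolding g_def f_def
          by (intro continuous_on_diff elementary_continuous V continuous_on_subset[OF supconv_continuous KT])
        moreover have "(y, t) \<in> K" using that by (simp add: K_def)
        ultimately obtain p where p: "p \<in> K" "\<And>q. q \<in> K \<Longrightarrow> g q \<le> g p"
          using continuous_attains_sup[of K g] by (metis empty_iff)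
        obtain z s where zs: "p = (z, s)" by (cases p)
        have sT: "s \<in> {0..T}" and s: "t1 \<le> s" "s \<le> t2" using p(1) subsetD[OF KT p(1)] by (auto simp: zs K_def)
        have g_pos: "V (z, s) < f z s"
          using p(2)[OF \<open>(y, t) \<in> K\<close>] pos by (simp add: g_def zs)
        have fN: "f z s \<le> N" using supconv_bounded[OF sT, of z] by (simp add: f_def)
        have s': "0 \<le> s - t1" "s - t1 \<le> 2 * \<tau>" using s by (auto simp: t1_def t2_def)
        note Wl = W_lower[OF s', of z, folded V_eq]
        have bar: "0 \<le> C * barrier \<Sigma> y0 (z, s - t1)"
          by (intro mult_nonneg_nonneg C(1) barrier_bounds(1)[OF s'(1)])
        have "s \<noteq> t1"
        proof
          assume s1: "s = t1"
          have "f z s \<le> trig l z + e" using init[of z] p(1) by (simp add: s1 t1_def f_def zs K_def R_def)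
          also have "\<dots> \<le> V (z, s)"
            using bar \<gamma> by (simp add: V_eq W_def P_def s1)
          finally show False using g_pos by simp
        qed
        moreover have "s \<noteq> t2"
        proof
          assume "s = t2"
          then have "m * (s - t1) + - (m * \<tau>) = m * \<tau>" by (simp add: t1_def t2_def algebra_simps)
          from Wl[unfolded this] show False using bar big g_pos fN unfolding D_def by linarith
        qed
        moreover have "dist z y0 \<noteq> R"
        proof
          assume "dist z y0 = R"
          then have "C * R ^ 4 \<le> C * barrier \<Sigma> y0 (z, s - t1)"
            using C barrier_bounds(2)[OF s'(1), of z y0 \<Sigma>] by (intro mult_left_mono) auto
          moreover have "0 \<le> \<gamma> * exp (m * (s - t1) + - (m * \<tau>))" using \<gamma> by simp
          ultimately show False using Wl g_pos fN C(2) unfolding D_def by linarith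
        qed
        ultimately have interior: "(z, s) \<in> ball y0 R \<times> {t1<..<t2}"
          using s p(1) by (auto simp: zs K_def dist_commute)
        have "open (ball y0 R \<times> {t1<..<t2})" by (intro open_Times) auto
        then obtain \<rho> where \<rho>: "0 < \<rho>" "ball (z, s) \<rho> \<subseteq> ball y0 R \<times> {t1<..<t2}"
          using interior openE by blast
        have "local_max_at T (supconv \<epsilon> u) V z s"
          unfolding local_max_at_def
        proof (intro exI[of _ \<rho>] conjI \<rho>(1) allI impI)
          fix y' s' assume "(y', s') \<in> ball (z, s) \<rho> \<and> 0 < s' \<and> s' < T"
          then have "(y', s') \<in> K" using \<rho>(2) by (auto simp: K_def)
          then show "supconv \<epsilon> u y' s' - V (y', s') \<le> supconv \<epsilon> u z s - V (z, s)"
            using p(2)[of "(y', s')"] by (simp add: g_def zs f_def)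
        qed
        then have "dt V (z, s) \<le> generator \<Sigma> V (z, s) + \<beta>"
          using linear[OF V] interior R \<tau> by (auto simp: dist_commute t1_def t2_def)
        moreover define q where "q = (z, s - t1)"
        have "dt V (z, s) = pdir W (0, 1) q" "generator \<Sigma> V (z, s) = generator \<Sigma> W q"
          by (simp_all add: dt_def V_def pdir_shift generator_shift q_def)
        moreover have "generator \<Sigma> W q = generator \<Sigma> (heat \<Sigma> l) q + C * generator \<Sigma> (barrier \<Sigma> y0) q"
          unfolding W_def by (subst generator_add | intro el)+ (simp add: generator_cmult el gP)
        moreover have "pdir W (0, 1) q = pdir (heat \<Sigma> l) (0, 1) q + C * pdir (barrier \<Sigma> y0) (0, 1) q
            + \<beta> + \<gamma> * (m * exp (m * snd q + - (m * \<tau>)))"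
          unfolding W_def by (subst pdir_add | intro el)+ (simp add: pdir_cmult el tP)
        moreover have "C * generator \<Sigma> (barrier \<Sigma> y0) q \<le> C * pdir (barrier \<Sigma> y0) (0, 1) q"
          using C s' by (intro mult_left_mono barrier_supersolution) (auto simp: q_def)
        moreover have "0 < \<gamma> * (m * exp (m * snd q + - (m * \<tau>)))" using \<gamma> m by simp
        ultimately show False by (simp add: heat_equation)
      qed
      have "f y0 t0 \<le> V (y0, t0)" using le[of y0 t0] R \<tau> by (auto simp: t1_def t2_def)
      also have "\<dots> = heat \<Sigma> l (y0, \<tau>) + C * (12 * (trace_sq \<Sigma>)\<^sup>2 * \<tau>\<^sup>2) + \<beta> * \<tau> + e + \<gamma>"
        using barrier_bounds(3)[of \<tau> \<Sigma> y0] \<tau> by (simp add: V_eq W_def P_def t1_def)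
      finally show "supconv \<epsilon> u y0 t0 \<le> heat \<Sigma> l (y0, \<tau>) + e + \<beta> * \<tau> + 12 * C * (trace_sq \<Sigma>)\<^sup>2 * \<tau>\<^sup>2 + \<gamma>"
        by (simp add: f_def)
    qed
  qed
qed

text \<open>The radius may still be shrunk to any \<open>\<rho> \<le> r\<close>, because the two
  sup-convolutions have to share one cylinder size later.\<close>

lemma (in bounded_subsolution) supconv_mean_value:
  assumes A_cont: "\<forall>i j. continuous_on (UNIV \<times> {0..T}) (\<lambda>(p, t). A p t $ i $ j)"
    and b_cont: "continuous_on (UNIV \<times> {0..T}) (\<lambda>(p, t). b p t)"
    and A_sym: "\<forall>p. \<forall>t\<in>{0..T}. transpose (A p t) = A p t"
    and t0: "0 < t0" "t0 < T" and \<kappa>: "0 < \<kappa>"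
    and ident: "\<And>\<theta>. 0 < \<theta> \<Longrightarrow> \<exists>\<sigma>>0. \<forall>w. supconv \<epsilon> u y0 t0 - \<sigma> \<le> u (y0 + w) t0 - (norm w)\<^sup>2 / (2 * \<epsilon>) \<longrightarrow>
        norm (w - \<epsilon> *\<^sub>R p0) \<le> \<theta>"
    and \<Sigma>: "\<And>i j. (A p0 t0 + mat \<kappa>) $ i $ j = (\<Sum>\<sigma>\<leftarrow>\<Sigma>. \<sigma> $ i * \<sigma> $ j)"
  obtains r where "0 < r" "\<And>\<rho>. 0 < \<rho> \<Longrightarrow> \<rho> \<le> r \<Longrightarrow> \<exists>C. \<forall>\<tau> l e. 0 < \<tau> \<and> \<tau> < \<rho> / 2 \<and> 0 \<le> e \<and>
      (\<forall>y\<in>cball y0 (\<rho> / 2). supconv \<epsilon> u y (t0 - \<tau>) \<le> trig l y + e) \<and> (\<forall>y. - N - 1 \<le> trig l y) \<longrightarrow>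
      supconv \<epsilon> u y0 t0 \<le> heat \<Sigma> l (y0, \<tau>) + e + (b p0 t0 + \<kappa> * ((CARD('n) + 1) / \<epsilon> + 1)) * \<tau> + C * \<tau>\<^sup>2"
proof -
  obtain r where r: "0 < r" "r < t0" "t0 + r < T"
    and lin: "\<And>v z t. elementary v \<Longrightarrow> dist z y0 < r \<Longrightarrow> \<bar>t - t0\<bar> < r \<Longrightarrow> local_max_at T (supconv \<epsilon> u) v z t \<Longrightarrow>
      dt v (z, t) \<le> (\<Sum>i\<in>UNIV. \<Sum>j\<in>UNIV. (A p0 t0 + mat \<kappa>) $ i $ j * hess_x v (z, t) $ i $ j) + b p0 t0
        + \<kappa> * ((CARD('n) + 1) / \<epsilon> + 1)"
    using supconv_frozen[OF A_cont b_cont A_sym t0 \<kappa> ident] by blast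
  show thesis
  proof (rule that[OF r(1)])
    fix \<rho> :: real assume \<rho>: "0 < \<rho>" "\<rho> \<le> r"
    have linear: "dt v (z, t) \<le> generator \<Sigma> v (z, t) + (b p0 t0 + \<kappa> * ((CARD('n) + 1) / \<epsilon> + 1))"
      if "elementary v" "dist z y0 < \<rho>" "\<bar>t - t0\<bar> < \<rho>" "local_max_at T (supconv \<epsilon> u) v z t" for v z t
      using lin[OF that(1) _ _ that(4)] that(2,3) \<rho> generator_hess_x[OF that(1) \<Sigma>] by simp
    show "\<exists>C. \<forall>\<tau> l e. 0 < \<tau> \<and> \<tau> < \<rho> / 2 \<and> 0 \<le> e \<and>
      (\<forall>y\<in>cball y0 (\<rho> / 2). supconv \<epsilon> u y (t0 - \<tau>) \<le> trig l y + e) \<and> (\<forall>y. - N - 1 \<le> trig l y) \<longrightarrow>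
      supconv \<epsilon> u y0 t0 \<le> heat \<Sigma> l (y0, \<tau>) + e + (b p0 t0 + \<kappa> * ((CARD('n) + 1) / \<epsilon> + 1)) * \<tau> + C * \<tau>\<^sup>2"
      (is "\<exists>C. ?P C")
    proof (rule mean_value_inequality[OF \<rho>(1) _ _ linear])
      fix C
      assume C: "\<And>\<tau> l e. 0 < \<tau> \<Longrightarrow> \<tau> < \<rho> / 2 \<Longrightarrow> 0 \<le> e \<Longrightarrow>
        (\<And>y. y \<in> cball y0 (\<rho> / 2) \<Longrightarrow> supconv \<epsilon> u y (t0 - \<tau>) \<le> trig l y + e) \<Longrightarrow>
        (\<And>y. - N - 1 \<le> trig l y) \<Longrightarrow> supconv \<epsilon> u y0 t0 \<le> heat \<Sigma> l (y0, \<tau>) + e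
          + (b p0 t0 + \<kappa> * (real (CARD('n) + 1) / \<epsilon> + 1)) * \<tau> + C * \<tau>\<^sup>2"
      have "?P C" by (intro allI impI, elim conjE, rule C) auto
      then show ?thesis by blast
    qed (use r \<rho> in auto)
  qed
qed

section \<open>Sup-convolution at a contact point\<close>

context bounded_subsolution
begin

lemma maximiser_bound:
  assumes t: "t \<in> {0..T}" and w: "supconv \<epsilon> u y t - 1 < u (y + w) t - (norm w)\<^sup>2 / (2 * \<epsilon>)"
  shows "(norm w)\<^sup>2 \<le> 2 * \<epsilon> * (2 * N + 1)"
proof -
  have "(norm w)\<^sup>2 / (2 * \<epsilon>) \<le> 2 * N + 1"
    using w bdd[OF t, of "y + w"] bdd[OF t, of y] supconv_ge[OF t, of y 0] by auto
  then show ?thesis using eps by (simp add: field_simps)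
qed

text \<open>The shift \<open>x0 - \<epsilon> p0\<close> makes the maximiser in the sup-convolution explicit.\<close>

lemma supconv_at_touching:
  assumes t0: "t0 \<in> {0..T}"
    and touch: "\<And>h. norm h \<le> r \<Longrightarrow> u (x0 + h) t0 \<le> u x0 t0 + p0 \<bullet> h + K * (norm h)\<^sup>2"
    and K: "K < 1 / (2 * \<epsilon>)"
    and small: "\<And>w. (norm w)\<^sup>2 \<le> 2 * \<epsilon> * (2 * N + 1) \<Longrightarrow> norm (w - \<epsilon> *\<^sub>R p0) \<le> r"
  shows "supconv \<epsilon> u (x0 - \<epsilon> *\<^sub>R p0) t0 = u x0 t0 - \<epsilon> * (p0 \<bullet> p0) / 2"
    and "0 < \<theta> \<Longrightarrow> \<exists>\<sigma>>0. \<forall>w. supconv \<epsilon> u (x0 - \<epsilon> *\<^sub>R p0) t0 - \<sigma>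
        \<le> u (x0 - \<epsilon> *\<^sub>R p0 + w) t0 - (norm w)\<^sup>2 / (2 * \<epsilon>) \<longrightarrow> norm (w - \<epsilon> *\<^sub>R p0) \<le> \<theta>"
proof -
  define y0 where "y0 = x0 - \<epsilon> *\<^sub>R p0"
  define V where "V = u x0 t0 - \<epsilon> * (p0 \<bullet> p0) / 2"
  \<comment> \<open>Completing the square around \<epsilon> p0 leaves this curvature: that of the
    penalty minus the quadratic error K of the touching bound.\<close>
  define c where "c = 1 / (2 * \<epsilon>) - K"
  have c: "0 < c" using K by (simp add: c_def)
  have upper: "u (y0 + w) t0 - (norm w)\<^sup>2 / (2 * \<epsilon>) \<le> V - c * (norm (w - \<epsilon> *\<^sub>R p0))\<^sup>2"
    if w: "supconv \<epsilon> u y0 t0 - 1 < u (y0 + w) t0 - (norm w)\<^sup>2 / (2 * \<epsilon>)" for w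
  proof -
    define d where "d = w - \<epsilon> *\<^sub>R p0"
    have "norm d \<le> r" unfolding d_def by (rule small[OF maximiser_bound[OF t0 w]])
    from touch[OF this] have "u (x0 + d) t0 \<le> u x0 t0 + p0 \<bullet> d + K * (norm d)\<^sup>2" .
    moreover have "x0 + d = y0 + w" by (simp add: y0_def d_def)
    ultimately have "u (y0 + w) t0 \<le> u x0 t0 + p0 \<bullet> d + K * (norm d)\<^sup>2" by simp
    moreover have "(norm w)\<^sup>2 = (norm (d + \<epsilon> *\<^sub>R p0))\<^sup>2" by (simp add: d_def)
    moreover have "\<dots> = (norm d)\<^sup>2 + 2 * \<epsilon> * (p0 \<bullet> d) + \<epsilon> * (\<epsilon> * (p0 \<bullet> p0))"
      by (simp add: power2_norm_eq_inner inner_add_left inner_add_right inner_commute)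
    moreover have "((norm d)\<^sup>2 + 2 * \<epsilon> * (p0 \<bullet> d) + \<epsilon> * (\<epsilon> * (p0 \<bullet> p0))) / (2 * \<epsilon>)
        = (norm d)\<^sup>2 / (2 * \<epsilon>) + p0 \<bullet> d + \<epsilon> * (p0 \<bullet> p0) / 2"
      using eps by (simp add: field_simps)
    ultimately show ?thesis by (simp add: V_def c_def d_def left_diff_distrib)
  qed
  have "V = u (y0 + \<epsilon> *\<^sub>R p0) t0 - (norm (\<epsilon> *\<^sub>R p0))\<^sup>2 / (2 * \<epsilon>)"
    unfolding power2_norm_eq_inner using eps by (simp add: V_def y0_def)
  then have "V \<le> supconv \<epsilon> u y0 t0" using supconv_ge[OF t0, of y0 "\<epsilon> *\<^sub>R p0"] by linarith
  moreover obtain w where w: "supconv \<epsilon> u y0 t0 = u (y0 + w) t0 - (norm w)\<^sup>2 / (2 * \<epsilon>)"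
    using supconv_attained[OF t0] by blast
  have "supconv \<epsilon> u y0 t0 \<le> V"
  proof -
    have "0 \<le> c * (norm (w - \<epsilon> *\<^sub>R p0))\<^sup>2" using c by simp
    then show ?thesis using upper[of w] w by linarith
  qed
  ultimately have V: "supconv \<epsilon> u y0 t0 = V" by simp
  then show "supconv \<epsilon> u (x0 - \<epsilon> *\<^sub>R p0) t0 = u x0 t0 - \<epsilon> * (p0 \<bullet> p0) / 2" by (simp add: y0_def V_def)
  assume \<theta>: "0 < \<theta>"
  \<comment> \<open>The 1 / 2 keeps near-maximisers within the slack 1 for which
    \<open>upper\<close> was shown.\<close>
  define \<sigma> where "\<sigma> = min (1 / 2) (c * \<theta>\<^sup>2)"
  have \<sigma>: "0 < \<sigma>" "\<sigma> < 1" "\<sigma> \<le> c * \<theta>\<^sup>2" using c \<theta> by (simp_all add: \<sigma>_def)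
  have "norm (w - \<epsilon> *\<^sub>R p0) \<le> \<theta>"
    if "supconv \<epsilon> u y0 t0 - \<sigma> \<le> u (y0 + w) t0 - (norm w)\<^sup>2 / (2 * \<epsilon>)" for w
  proof -
    have "c * (norm (w - \<epsilon> *\<^sub>R p0))\<^sup>2 \<le> c * \<theta>\<^sup>2" using upper[of w] that \<sigma> V by linarith
    then have "(norm (w - \<epsilon> *\<^sub>R p0))\<^sup>2 \<le> \<theta>\<^sup>2" by (simp only: mult_le_cancel_left_pos[OF c])
    then show ?thesis by (rule power2_le_imp_le) (use \<theta> in linarith)
  qed
  then show "\<exists>\<sigma>>0. \<forall>w. supconv \<epsilon> u (x0 - \<epsilon> *\<^sub>R p0) t0 - \<sigma>
        \<le> u (x0 - \<epsilon> *\<^sub>R p0 + w) t0 - (norm w)\<^sup>2 / (2 * \<epsilon>) \<longrightarrow> norm (w - \<epsilon> *\<^sub>R p0) \<le> \<theta>"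
    using \<sigma>(1) unfolding y0_def by (intro exI[of _ \<sigma>]) simp
qed

end

section \<open>Two-point bounds under sup-convolution\<close>

definition aniso :: "'a::real_inner \<Rightarrow> real \<Rightarrow> real \<Rightarrow> 'a \<Rightarrow> real" where
  "aniso e D C d = D / 2 * (e \<bullet> d)\<^sup>2 + C * (d \<bullet> d - (e \<bullet> d)\<^sup>2)"

text \<open>For the second part, the cross terms have coefficients D - 2 C and 2 C, and |D - 2 C| +
  |2 C| \<le> |D| + 4 |C|. The same constant dominates the form itself, so one K suffices
  later.\<close>

lemma aniso_bound:
  assumes "norm e = 1"
  shows "aniso e D C d \<le> (\<bar>D\<bar> + 4 * \<bar>C\<bar>) * (norm d)\<^sup>2"
    and "aniso e D C (d + d') \<le> aniso e D C d + (\<bar>D\<bar> + 4 * \<bar>C\<bar>) * norm d * norm d' + (\<bar>D\<bar> + 4 * \<bar>C\<bar>) * (norm d')\<^sup>2"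
proof -
  have ed: "\<bar>e \<bullet> d\<bar> \<le> norm d" for d
    using Cauchy_Schwarz_ineq2[of e d] assms by simp
  have upper: "aniso e D C d \<le> (\<bar>D\<bar> + 4 * \<bar>C\<bar>) * (norm d)\<^sup>2" for d
  proof -
    have "(e \<bullet> d)\<^sup>2 \<le> (norm d)\<^sup>2" using ed power_mono[of "\<bar>e \<bullet> d\<bar>" "norm d" 2] by simp
    then have "\<bar>D / 2\<bar> * (e \<bullet> d)\<^sup>2 \<le> \<bar>D / 2\<bar> * (norm d)\<^sup>2" "\<bar>C\<bar> * (d \<bullet> d - (e \<bullet> d)\<^sup>2) \<le> \<bar>C\<bar> * (norm d)\<^sup>2"
      by (auto intro!: mult_left_mono simp: power2_norm_eq_inner)
    moreover have "D / 2 * (e \<bullet> d)\<^sup>2 \<le> \<bar>D / 2\<bar> * (e \<bullet> d)\<^sup>2" by (intro mult_right_mono) auto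
    moreover have "C * (d \<bullet> d - (e \<bullet> d)\<^sup>2) \<le> \<bar>C\<bar> * (d \<bullet> d - (e \<bullet> d)\<^sup>2)"
      using \<open>(e \<bullet> d)\<^sup>2 \<le> (norm d)\<^sup>2\<close> by (intro mult_right_mono) (auto simp: power2_norm_eq_inner)
    moreover have "\<bar>D / 2\<bar> * (norm d)\<^sup>2 + \<bar>C\<bar> * (norm d)\<^sup>2 \<le> (\<bar>D\<bar> + 4 * \<bar>C\<bar>) * (norm d)\<^sup>2"
      by (simp add: algebra_simps)
    ultimately show ?thesis unfolding aniso_def by linarith
  qed
  then show "aniso e D C d \<le> (\<bar>D\<bar> + 4 * \<bar>C\<bar>) * (norm d)\<^sup>2" .
  have "aniso e D C (d + d') = aniso e D C d + (D - 2 * C) * ((e \<bullet> d) * (e \<bullet> d')) + 2 * C * (d \<bullet> d') + aniso e D C d'"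
    by (simp add: aniso_def inner_add_left inner_add_right inner_commute power2_eq_square algebra_simps)
  moreover have "(D - 2 * C) * ((e \<bullet> d) * (e \<bullet> d')) \<le> \<bar>D - 2 * C\<bar> * (norm d * norm d')"
  proof -
    have "\<bar>e \<bullet> d\<bar> * \<bar>e \<bullet> d'\<bar> \<le> norm d * norm d'" using ed by (intro mult_mono) auto
    then have "\<bar>D - 2 * C\<bar> * (\<bar>e \<bullet> d\<bar> * \<bar>e \<bullet> d'\<bar>) \<le> \<bar>D - 2 * C\<bar> * (norm d * norm d')"
      by (intro mult_left_mono) auto
    then show ?thesis
      using abs_ge_self[of "(D - 2 * C) * ((e \<bullet> d) * (e \<bullet> d'))"] by (simp add: abs_mult)
  qed
  moreover have "2 * C * (d \<bullet> d') \<le> \<bar>2 * C\<bar> * (norm d * norm d')"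
    using abs_ge_self[of "2 * C * (d \<bullet> d')"] mult_left_mono[OF Cauchy_Schwarz_ineq2[of d d'], of "\<bar>2 * C\<bar>"]
    by (simp add: abs_mult)
  moreover have "\<bar>D - 2 * C\<bar> * (norm d * norm d') + \<bar>2 * C\<bar> * (norm d * norm d') \<le> (\<bar>D\<bar> + 4 * \<bar>C\<bar>) * (norm d * norm d')"
    unfolding distrib_right[symmetric] by (intro mult_right_mono) auto
  ultimately show "aniso e D C (d + d') \<le> aniso e D C d + (\<bar>D\<bar> + 4 * \<bar>C\<bar>) * norm d * norm d' + (\<bar>D\<bar> + 4 * \<bar>C\<bar>) * (norm d')\<^sup>2"
    using upper[of d'] by (simp add: mult.assoc)
qed

text \<open>The shifts by \<epsilon> p centre both maximisers. Expanding the penalties then cancels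
  the linear terms and leaves - \<epsilon> P^2, half from either side. The remaining deviations d1,
  d2 are paid for by the penalties when \<epsilon> is small compared with \<eta>, so the two-point
  bound survives with the extra term \<eta> (|h|^2 + |k|^2) only.\<close>

lemma supconv_two_point:
  fixes u :: "real^'n \<Rightarrow> real \<Rightarrow> real"
  assumes f: "bounded_subsolution A b T u N \<epsilon>" and g: "bounded_subsolution A' b' T (\<lambda>x t. - u x t) N \<epsilon>"
    and e: "norm e = 1" and \<eta>: "0 < \<eta>" and t: "t \<in> {0..T}"
    and H: "\<And>h k. norm h \<le> r \<Longrightarrow> norm k \<le> r \<Longrightarrow>
      u (y0 + h) t - u (x0 + k) t \<le> B + P * (e \<bullet> (h - k)) + aniso e D C (h - k)"
    and K: "K = \<bar>D\<bar> + 4 * \<bar>C\<bar>" "2 * (K + K\<^sup>2 / (2 * \<eta>)) \<le> 1 / (2 * \<epsilon>)"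
    and small: "\<And>w p :: real^'n. (norm w)\<^sup>2 \<le> 2 * \<epsilon> * (2 * N + 1) \<Longrightarrow> norm p = \<bar>P\<bar> \<Longrightarrow> norm (w - \<epsilon> *\<^sub>R p) \<le> r / 2"
    and hk: "norm h \<le> r / 2" "norm k \<le> r / 2"
  shows "supconv \<epsilon> u (y0 - \<epsilon> *\<^sub>R (P *\<^sub>R e) + h) t + supconv \<epsilon> (\<lambda>x t. - u x t) (x0 + \<epsilon> *\<^sub>R (P *\<^sub>R e) + k) t
    \<le> B - \<epsilon> * P\<^sup>2 + P * (e \<bullet> (h - k)) + aniso e D C (h - k) + \<eta> * (h \<bullet> h + k \<bullet> k)"
proof -
  interpret f: bounded_subsolution A b T u N \<epsilon> by (rule f)
  interpret g: bounded_subsolution A' b' T "\<lambda>x t. - u x t" N \<epsilon> by (rule g)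
  define p where "p = P *\<^sub>R e"
  have p: "norm p = \<bar>P\<bar>" "norm (- p) = \<bar>P\<bar>" "p \<bullet> p = P\<^sup>2"
    using e by (auto simp: p_def power2_eq_square simp flip: power2_norm_eq_inner)
  obtain w1 where w1: "supconv \<epsilon> u (y0 - \<epsilon> *\<^sub>R p + h) t = u (y0 - \<epsilon> *\<^sub>R p + h + w1) t - (norm w1)\<^sup>2 / (2 * \<epsilon>)"
    using f.supconv_attained[OF t] by blast
  obtain w2 where w2: "supconv \<epsilon> (\<lambda>x t. - u x t) (x0 + \<epsilon> *\<^sub>R p + k) t
      = - u (x0 + \<epsilon> *\<^sub>R p + k + w2) t - (norm w2)\<^sup>2 / (2 * \<epsilon>)"
    using g.supconv_attained[OF t] by blast
  define d1 where "d1 = w1 - \<epsilon> *\<^sub>R p"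
  define d2 where "d2 = w2 + \<epsilon> *\<^sub>R p"
  have "norm d1 \<le> r / 2"
    unfolding d1_def
    by (intro small[OF f.maximiser_bound[OF t, of "y0 - \<epsilon> *\<^sub>R p + h"]] p) (use w1 in simp)
  moreover have "norm (w2 - \<epsilon> *\<^sub>R (- p)) \<le> r / 2"
    by (intro small[OF g.maximiser_bound[OF t, of "x0 + \<epsilon> *\<^sub>R p + k"]] p) (use w2 in simp)
  ultimately have r: "norm (h + d1) \<le> r" "norm (k + d2) \<le> r"
    using hk norm_triangle_ineq[of h d1] norm_triangle_ineq[of k d2] by (auto simp: d2_def)
  have eps: "0 < \<epsilon>" by (rule f.eps)
  define d where "d = h - k"
  define d' where "d' = d1 - d2"
  have w1n: "(norm w1)\<^sup>2 / (2 * \<epsilon>) = (norm d1)\<^sup>2 / (2 * \<epsilon>) + p \<bullet> d1 + \<epsilon> * P\<^sup>2 / 2"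
  proof -
    have "(norm w1)\<^sup>2 = (norm (d1 + \<epsilon> *\<^sub>R p))\<^sup>2" by (simp add: d1_def)
    also have "\<dots> = (norm d1)\<^sup>2 + 2 * \<epsilon> * (p \<bullet> d1) + \<epsilon> * (\<epsilon> * P\<^sup>2)"
      by (simp add: power2_norm_eq_inner inner_add_left inner_add_right inner_commute p)
    finally show ?thesis using eps by (simp add: field_simps)
  qed
  have w2n: "(norm w2)\<^sup>2 / (2 * \<epsilon>) = (norm d2)\<^sup>2 / (2 * \<epsilon>) - p \<bullet> d2 + \<epsilon> * P\<^sup>2 / 2"
  proof -
    have "(norm w2)\<^sup>2 = (norm (d2 - \<epsilon> *\<^sub>R p))\<^sup>2" by (simp add: d2_def)
    also have "\<dots> = (norm d2)\<^sup>2 - 2 * \<epsilon> * (p \<bullet> d2) + \<epsilon> * (\<epsilon> * P\<^sup>2)"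
      unfolding power2_norm_eq_inner by (simp add: inner_diff_left inner_diff_right inner_commute p)
    finally show ?thesis using eps by (simp add: field_simps)
  qed
  have "u (y0 - \<epsilon> *\<^sub>R p + h + w1) t - u (x0 + \<epsilon> *\<^sub>R p + k + w2) t
      = u (y0 + (h + d1)) t - u (x0 + (k + d2)) t"
    by (simp add: d1_def d2_def algebra_simps)
  also have "\<dots> \<le> B + P * (e \<bullet> (d + d')) + aniso e D C (d + d')"
    using H[OF r] by (simp add: d_def d'_def algebra_simps)
  also have "P * (e \<bullet> (d + d')) = P * (e \<bullet> d) + p \<bullet> d1 - p \<bullet> d2"
    by (simp add: p_def d'_def inner_add_right inner_diff_right algebra_simps)
  also have "aniso e D C (d + d') \<le> aniso e D C d + K * norm d * norm d' + K * (norm d')\<^sup>2"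
    using aniso_bound(2)[OF e, of D C d d'] K(1) by simp
  finally have main: "supconv \<epsilon> u (y0 - \<epsilon> *\<^sub>R p + h) t + supconv \<epsilon> (\<lambda>x t. - u x t) (x0 + \<epsilon> *\<^sub>R p + k) t
      \<le> B - \<epsilon> * P\<^sup>2 + P * (e \<bullet> d) + aniso e D C d
        + (K * norm d * norm d' + K * (norm d')\<^sup>2 - ((norm d1)\<^sup>2 + (norm d2)\<^sup>2) / (2 * \<epsilon>))"
    using w1 w2 w1n w2n by (simp add: add_divide_distrib)
  have sq: "(norm (a - b))\<^sup>2 \<le> 2 * ((norm a)\<^sup>2 + (norm b)\<^sup>2)" for a b :: "real^'n"
    using zero_le_power2[of "norm (a + b)"] unfolding power2_norm_eq_inner
    by (simp add: inner_add_left inner_add_right inner_diff_left inner_diff_right inner_commute)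
  \<comment> \<open>Young's inequality: the part in d turns into the \<eta> term because |h - k|^2
    \<le> 2 (|h|^2 + |k|^2); the part in d' is left to the penalties.\<close>
  have "K * norm d * norm d' \<le> \<eta> / 2 * (norm d)\<^sup>2 + K\<^sup>2 / (2 * \<eta>) * (norm d')\<^sup>2"
  proof -
    have "0 \<le> (\<eta> * norm d - K * norm d')\<^sup>2 / (2 * \<eta>)" using \<eta> by simp
    also have "\<dots> = \<eta> / 2 * (norm d)\<^sup>2 + K\<^sup>2 / (2 * \<eta>) * (norm d')\<^sup>2 - K * norm d * norm d'"
      using \<eta> by (simp add: power2_eq_square field_simps)
    finally show ?thesis by simp
  qed
  moreover have "\<eta> / 2 * (norm d)\<^sup>2 \<le> \<eta> / 2 * (2 * ((norm h)\<^sup>2 + (norm k)\<^sup>2))"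
    using sq[of h k] \<eta> unfolding d_def by (intro mult_left_mono) auto
  moreover define G where "G = K + K\<^sup>2 / (2 * \<eta>)"
  define Y where "Y = (norm d1)\<^sup>2 + (norm d2)\<^sup>2"
  have "G * (norm d')\<^sup>2 \<le> G * (2 * Y)"
  proof (rule mult_left_mono)
    show "(norm d')\<^sup>2 \<le> 2 * Y" unfolding d'_def Y_def by (rule sq)
    have "0 \<le> K" by (simp add: K(1))
    then show "0 \<le> G" using \<eta> by (simp add: G_def)
  qed
  moreover have "G * (2 * Y) = (2 * G) * Y" by simp
  moreover have "(2 * G) * Y \<le> 1 / (2 * \<epsilon>) * Y"
    by (rule mult_right_mono[OF K(2)[folded G_def]]) (simp add: Y_def)
  moreover have "1 / (2 * \<epsilon>) * Y = ((norm d1)\<^sup>2 + (norm d2)\<^sup>2) / (2 * \<epsilon>)" by (simp add: Y_def)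
  moreover have "G * (norm d')\<^sup>2 = K * (norm d')\<^sup>2 + K\<^sup>2 / (2 * \<eta>) * (norm d')\<^sup>2"
    by (simp only: G_def distrib_right)
  moreover have "\<eta> / 2 * (2 * ((norm h)\<^sup>2 + (norm k)\<^sup>2)) = \<eta> * (h \<bullet> h + k \<bullet> k)"
    by (simp add: power2_norm_eq_inner)
  ultimately have "K * norm d * norm d' + K * (norm d')\<^sup>2 - ((norm d1)\<^sup>2 + (norm d2)\<^sup>2) / (2 * \<epsilon>) \<le> \<eta> * (h \<bullet> h + k \<bullet> k)"
    by linarith
  then show ?thesis using main unfolding p_def d_def by linarith
qed

section \<open>Reflection coupling\<close>

text \<open>The coupling: noise in the two variables is synchronised in the directions \<open>\<Sigma>\<close> and reflected in the direction \<open>v\<close>.\<close>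

lemma heat_coupled:
  fixes \<Sigma> :: "'a::euclidean_space list"
  shows "heat ((v, - v) # map (\<lambda>\<sigma>. (\<sigma>, \<sigma>)) \<Sigma>)
      (map (\<lambda>(c, k, \<theta>). (c, (k, 0), \<theta>)) l1 @ map (\<lambda>(c, k, \<theta>). (c, (0, k), \<theta>)) l2) ((y, x), s)
    = heat (v # \<Sigma>) l1 (y, s) + heat (v # \<Sigma>) l2 (x, s)"
proof -
  have "sqsum ((v, - v) # map (\<lambda>\<sigma>. (\<sigma>, \<sigma>)) \<Sigma>) (k, 0) = sqsum (v # \<Sigma>) k"
    "sqsum ((v, - v) # map (\<lambda>\<sigma>. (\<sigma>, \<sigma>)) \<Sigma>) (0, k) = sqsum (v # \<Sigma>) k" for k :: 'a
    by (simp_all add: sqsum_def comp_def inner_Pair)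
  then show ?thesis
    by (simp add: heat_def comp_def case_prod_unfold inner_Pair)
qed

lemma trace_sq_diagonal:
  fixes M :: "real^'n^'n"
  assumes "\<And>i j. M $ i $ j = (\<Sum>\<sigma>\<leftarrow>\<Sigma>. \<sigma> $ i * \<sigma> $ j)"
  shows "trace_sq \<Sigma> = (\<Sum>i\<in>UNIV. M $ i $ i)"
proof -
  have "trace_sq \<Sigma> = (\<Sum>i\<in>UNIV. \<Sum>\<sigma>\<leftarrow>\<Sigma>. \<sigma> $ i * \<sigma> $ i)"
    by (induction \<Sigma>) (simp_all add: trace_sq_def inner_vec_def sum.distrib)
  then show ?thesis by (simp add: assms)
qed

section \<open>The quadratic majorant on the doubled space\<close>

definition two_point_fun ::
  "'a::euclidean_space \<Rightarrow> real \<Rightarrow> real \<Rightarrow> real \<Rightarrow> real \<Rightarrow> real \<Rightarrow> 'a \<Rightarrow> 'a \<Rightarrow> ('a \<times> 'a) \<times> real \<Rightarrow> real" where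
  "two_point_fun e F P D C \<eta> y0 x0 z = F + P * (e \<bullet> ((fst (fst z) - y0) - (snd (fst z) - x0)))
     + aniso e D C ((fst (fst z) - y0) - (snd (fst z) - x0))
     + \<eta> * ((fst (fst z) - y0) \<bullet> (fst (fst z) - y0) + (snd (fst z) - x0) \<bullet> (snd (fst z) - x0))"

lemma elementary_two_point_fun: "elementary (two_point_fun e F P D C \<eta> y0 x0)"
proof -
  have d: "(fst (fst z) - y0) - (snd (fst z) - x0) = (fst (fst z) - snd (fst z)) - (y0 - x0)"
    for z :: "('a \<times> 'a) \<times> real" by simp
  have "bounded_linear (\<lambda>z :: ('a \<times> 'a) \<times> real. fst (fst z))"
    "bounded_linear (\<lambda>z :: ('a \<times> 'a) \<times> real. snd (fst z))"
    by (intro bounded_linear_fst bounded_linear_fst_comp bounded_linear_snd_comp)+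
  note bl = this bounded_linear_sub[OF this]
  have ed: "elementary (\<lambda>z :: ('a \<times> 'a) \<times> real. e \<bullet> (fst (fst z) - snd (fst z) - (y0 - x0)))"
    unfolding inner_diff_right[of e _ "y0 - x0"]
    by (intro elementary_diff elementary.const elementary.linear bounded_linear_inner_right_comp bl)
  show ?thesis
    unfolding two_point_fun_def[abs_def] aniso_def d
    by (intro elementary.add elementary.mult elementary.const elementary_diff elementary_power
        elementary_inner bl ed)
qed

lemma two_point_fun_derivatives:
  shows "pdir (two_point_fun e F P D C \<eta> y0 x0) (0, 1) z = 0"
    and "pdir2 (two_point_fun e F P D C \<eta> y0 x0) (a, b) z
      = 2 * aniso e D C (a - b) + 2 * \<eta> * (a \<bullet> a + b \<bullet> b)"
proof -
  define Q where "Q = two_point_fun e F P D C \<eta> y0 x0"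
  define d where "d = (\<lambda>z :: ('a \<times> 'a) \<times> real. (fst (fst z) - y0) - (snd (fst z) - x0))"
  define L where "L = (\<lambda>z (v :: ('a \<times> 'a) \<times> real). P * (e \<bullet> (fst (fst v) - snd (fst v)))
      + (D - 2 * C) * (e \<bullet> d z) * (e \<bullet> (fst (fst v) - snd (fst v)))
      + 2 * C * (d z \<bullet> (fst (fst v) - snd (fst v)))
      + 2 * \<eta> * ((fst (fst z) - y0) \<bullet> fst (fst v) + (snd (fst z) - x0) \<bullet> snd (fst v)))"
  have dQ: "(Q has_derivative L z) (at z)" for z
    unfolding Q_def two_point_fun_def[abs_def] aniso_def L_def d_def
    by (auto intro!: derivative_eq_intros simp: inner_commute algebra_simps power2_eq_square)
  have Q1: "pdir Q v = (\<lambda>z. L z v)" for v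
    by (intro ext pdir_eq dQ)
  show "pdir (two_point_fun e F P D C \<eta> y0 x0) (0, 1) z = 0"
    using Q1[of "(0, 1)"] by (simp add: Q_def L_def)
  have "((\<lambda>z. L z ((a, b), 0)) has_derivative
      (\<lambda>v. (D - 2 * C) * (e \<bullet> (fst (fst v) - snd (fst v))) * (e \<bullet> (a - b))
      + 2 * C * ((fst (fst v) - snd (fst v)) \<bullet> (a - b))
      + 2 * \<eta> * (fst (fst v) \<bullet> a + snd (fst v) \<bullet> b))) (at z)"
    unfolding L_def d_def
    by (auto intro!: derivative_eq_intros simp: inner_commute algebra_simps)
  from pdir_eq[OF this, of "((a, b), 0)"]
  show "pdir2 (two_point_fun e F P D C \<eta> y0 x0) (a, b) z
      = 2 * aniso e D C (a - b) + 2 * \<eta> * (a \<bullet> a + b \<bullet> b)"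
    unfolding pdir2_def Q_def[symmetric] Q1
    by (simp add: aniso_def power2_eq_square algebra_simps)
qed

text \<open>A direction (\<sigma>, \<sigma>) does not change the difference, so \<open>aniso\<close>
  contributes nothing. The direction (v, - v) changes it by 2 v, a multiple of e: C drops out, and 2
  (D / 2) (4 \<alpha>) remains. The \<eta> term counts every direction twice.\<close>

lemma generator_two_point_fun:
  assumes e: "norm e = 1" and v: "v = sqrt \<alpha> *\<^sub>R e" "0 \<le> \<alpha>"
  shows "generator ((v, - v) # map (\<lambda>\<sigma>. (\<sigma>, \<sigma>)) \<Sigma>) (two_point_fun e F P D C \<eta> y0 x0) z
    = 4 * \<alpha> * D + 4 * \<eta> * trace_sq (v # \<Sigma>)"
proof -
  have "e \<bullet> e = 1" using e by (simp flip: power2_norm_eq_inner)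
  then have "2 * aniso e D C (v - - v) = 4 * \<alpha> * D"
    using v(2) by (simp add: aniso_def v(1) power2_eq_square inner_add_left inner_add_right)
  moreover have "aniso e D C 0 = 0" by (simp add: aniso_def)
  then have "(\<Sum>\<sigma>\<leftarrow>\<Sigma>. pdir2 (two_point_fun e F P D C \<eta> y0 x0) (\<sigma>, \<sigma>) z) = 4 * \<eta> * trace_sq \<Sigma>"
    by (induction \<Sigma>) (simp_all add: two_point_fun_derivatives trace_sq_def algebra_simps)
  ultimately show ?thesis
    by (simp add: generator_def comp_def two_point_fun_derivatives(2)[where a = v] trace_sq_def algebra_simps)
qed

text \<open>The mean value inequalities bound f and g at time t0 by heat flows started at t0 -
  \<tau>; in their sum the drifts b(p) and -b(p) cancel. The coupled flow lies below the majorant,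
  whose value at the centre is again f + g, so (c1 - \<Xi> - 2 E) \<tau> is at most a constant times
  \<tau>^2.\<close>

lemma two_point_inequality:
  fixes A :: "real^'n \<Rightarrow> real \<Rightarrow> real^'n^'n" and b u :: "real^'n \<Rightarrow> real \<Rightarrow> real" and P \<kappa> \<epsilon> :: real and e :: "real^'n"
  defines "f \<equiv> supconv \<epsilon> u" and "g \<equiv> supconv \<epsilon> (\<lambda>x t. - u x t)" and "p \<equiv> P *\<^sub>R e"
  assumes f: "bounded_subsolution A b T u N \<epsilon>"
    and g: "bounded_subsolution (\<lambda>p. A (- p)) (\<lambda>p t. - b (- p) t) T (\<lambda>x t. - u x t) N \<epsilon>"
    and A_cont: "\<forall>i j. continuous_on (UNIV \<times> {0..T}) (\<lambda>(p, t). A p t $ i $ j)"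
    and b_cont: "continuous_on (UNIV \<times> {0..T}) (\<lambda>(p, t). b p t)"
    and A_sym: "\<forall>p. \<forall>t\<in>{0..T}. transpose (A p t) = A p t"
    and t0: "0 < t0" "t0 < T" and \<kappa>: "0 < \<kappa>" and e: "norm e = 1" and \<alpha>: "0 \<le> \<alpha>"
    and A_lower: "\<And>v. \<alpha> * (e \<bullet> v)\<^sup>2 \<le> v \<bullet> (A p t0 *v v)"
    and identf: "\<And>\<theta>. 0 < \<theta> \<Longrightarrow> \<exists>\<sigma>>0. \<forall>w. f y0 t0 - \<sigma> \<le> u (y0 + w) t0 - (norm w)\<^sup>2 / (2 * \<epsilon>) \<longrightarrow>
        norm (w - \<epsilon> *\<^sub>R p) \<le> \<theta>"
    and identg: "\<And>\<theta>. 0 < \<theta> \<Longrightarrow> \<exists>\<sigma>>0. \<forall>w. g x0 t0 - \<sigma> \<le> - u (x0 + w) t0 - (norm w)\<^sup>2 / (2 * \<epsilon>) \<longrightarrow>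
        norm (w - \<epsilon> *\<^sub>R (- p)) \<le> \<theta>"
    and r: "0 < r" "r \<le> t0"
    and H: "\<And>h k t. norm h \<le> r \<Longrightarrow> norm k \<le> r \<Longrightarrow> t0 - r \<le> t \<Longrightarrow> t \<le> t0 \<Longrightarrow>
      f (y0 + h) t + g (x0 + k) t \<le> f y0 t0 + g x0 t0 + P * (e \<bullet> (h - k)) + aniso e D C (h - k)
        + \<eta> * (h \<bullet> h + k \<bullet> k) + c1 * (t - t0)"
  shows "c1 \<le> 4 * \<alpha> * D + 4 * \<eta> * ((\<Sum>i\<in>UNIV. A p t0 $ i $ i) + CARD('n) * \<kappa>)
    + 2 * \<kappa> * ((CARD('n) + 1) / \<epsilon> + 1)"
proof -
  interpret f: bounded_subsolution A b T u N \<epsilon> by (rule f)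
  interpret g: bounded_subsolution "\<lambda>p. A (- p)" "\<lambda>p t. - b (- p) t" T "\<lambda>x t. - u x t" N \<epsilon> by (rule g)
  have t0T: "t0 \<in> {0..T}" using t0 by simp
  define v where "v = sqrt \<alpha> *\<^sub>R e"
  define M where "M = A p t0 + mat \<kappa> - (\<chi> i j. v $ i * v $ j)"
  have "transpose M = M"
    using A_sym t0T by (simp add: M_def vec_eq_iff transpose_def mat_def mult.commute)
  moreover have "0 \<le> w \<bullet> (M *v w)" for w
  proof -
    have "w \<bullet> ((\<chi> i j. v $ i * v $ j) *v w) = (v \<bullet> w)\<^sup>2"
    proof -
      have "(v \<bullet> w)\<^sup>2 = (\<Sum>i\<in>UNIV. \<Sum>j\<in>UNIV. v $ i * v $ j * (w $ i * w $ j))"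
        by (simp add: inner_vec_def power2_eq_square sum_product algebra_simps)
      then show ?thesis by (simp add: quadratic_form_sum)
    qed
    also have "\<dots> = \<alpha> * (e \<bullet> w)\<^sup>2" using \<alpha> by (simp add: v_def power_mult_distrib)
    finally have vv: "w \<bullet> ((\<chi> i j. v $ i * v $ j) *v w) = \<alpha> * (e \<bullet> w)\<^sup>2" .
    have "mat \<kappa> *v w = \<kappa> *\<^sub>R w"
      by (simp add: vec_eq_iff matrix_vector_mult_def mat_def if_distrib[of "\<lambda>x. x * _"] sum.delta cong: if_cong)
    then have "w \<bullet> (M *v w) = w \<bullet> (A p t0 *v w) + \<kappa> * (w \<bullet> w) - \<alpha> * (e \<bullet> w)\<^sup>2"
      by (simp add: M_def matrix_vector_mult_add_rdistrib matrix_vector_mult_diff_rdistrib inner_add_right inner_diff_right vv)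
    moreover have "0 \<le> \<kappa> * (w \<bullet> w)" using \<kappa> by simp
    ultimately show ?thesis using A_lower[of w] by linarith
  qed
  ultimately obtain \<Sigma> where \<Sigma>: "\<And>i j. M $ i $ j = (\<Sum>\<sigma>\<leftarrow>\<Sigma>. \<sigma> $ i * \<sigma> $ j)"
    using psd_decomposition[of M] by blast
  have entries: "(A p t0 + mat \<kappa>) $ i $ j = (\<Sum>\<sigma>\<leftarrow>v # \<Sigma>. \<sigma> $ i * \<sigma> $ j)" for i j
  proof -
    have "(A p t0 + mat \<kappa>) $ i $ j = v $ i * v $ j + M $ i $ j" by (simp add: M_def)
    then show ?thesis by (simp add: \<Sigma>)
  qed
  have trace: "trace_sq (v # \<Sigma>) = (\<Sum>i\<in>UNIV. A p t0 $ i $ i) + CARD('n) * \<kappa>"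
    by (subst trace_sq_diagonal[OF entries]) (simp add: sum.distrib mat_def)
  define E where "E = \<kappa> * ((CARD('n) + 1) / \<epsilon> + 1)"
  obtain rf where rf: "0 < rf" "\<And>\<rho>. 0 < \<rho> \<Longrightarrow> \<rho> \<le> rf \<Longrightarrow> \<exists>C. \<forall>\<tau> l e. 0 < \<tau> \<and> \<tau> < \<rho> / 2 \<and> 0 \<le> e \<and>
      (\<forall>y\<in>cball y0 (\<rho> / 2). f y (t0 - \<tau>) \<le> trig l y + e) \<and> (\<forall>y. - N - 1 \<le> trig l y) \<longrightarrow>
      f y0 t0 \<le> heat (v # \<Sigma>) l (y0, \<tau>) + e + (b p t0 + E) * \<tau> + C * \<tau>\<^sup>2"
    using f.supconv_mean_value[OF A_cont b_cont A_sym t0 \<kappa> identf[unfolded f_def] entries]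
    unfolding f_def E_def by blast
  have neg: "continuous_on (UNIV \<times> {0..T}) (\<lambda>(p, t). h (- p) t)"
    if "continuous_on (UNIV \<times> {0..T}) (\<lambda>(p, t). h p t)" for h :: "real^'n \<Rightarrow> real \<Rightarrow> real"
  proof -
    have "continuous_on (UNIV \<times> {0..T}) (\<lambda>x. (\<lambda>(p, t). h p t) (- fst x, snd x))"
      by (rule continuous_on_compose2[OF that]) (auto intro!: continuous_intros)
    then show ?thesis by (simp add: case_prod_beta)
  qed
  have A_cont': "\<forall>i j. continuous_on (UNIV \<times> {0..T}) (\<lambda>(p, t). A (- p) t $ i $ j)"
    using A_cont neg[of "\<lambda>p t. A p t $ _ $ _"] by blast
  have b_cont': "continuous_on (UNIV \<times> {0..T}) (\<lambda>(p, t). - b (- p) t)"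
    using continuous_on_minus[OF neg[OF b_cont]] by (simp add: case_prod_beta)
  have A_sym': "\<forall>p. \<forall>t\<in>{0..T}. transpose (A (- p) t) = A (- p) t" using A_sym by blast
  have entries': "(A (- (- p)) t0 + mat \<kappa>) $ i $ j = (\<Sum>\<sigma>\<leftarrow>v # \<Sigma>. \<sigma> $ i * \<sigma> $ j)" for i j
    using entries by simp
  obtain rg where rg: "0 < rg" "\<And>\<rho>. 0 < \<rho> \<Longrightarrow> \<rho> \<le> rg \<Longrightarrow> \<exists>C. \<forall>\<tau> l e. 0 < \<tau> \<and> \<tau> < \<rho> / 2 \<and> 0 \<le> e \<and>
      (\<forall>y\<in>cball x0 (\<rho> / 2). g y (t0 - \<tau>) \<le> trig l y + e) \<and> (\<forall>y. - N - 1 \<le> trig l y) \<longrightarrow>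
      g x0 t0 \<le> heat (v # \<Sigma>) l (x0, \<tau>) + e + (- b p t0 + E) * \<tau> + C * \<tau>\<^sup>2"
    using g.supconv_mean_value[OF A_cont' b_cont' A_sym' t0 \<kappa> identg[unfolded g_def] entries']
    unfolding g_def E_def minus_minus by blast
  \<comment> \<open>The entry 1 keeps the balls inside the unit balls on which the trigonometric
    approximation holds.\<close>
  define \<rho> where "\<rho> = Min {rf, rg, r, 1}"
  have \<rho>: "0 < \<rho>" "\<rho> \<le> rf" "\<rho> \<le> rg" "\<rho> \<le> r" "\<rho> \<le> 1"
    using rf(1) rg(1) r(1) by (auto simp: \<rho>_def)
  obtain Cf where Cf: "\<And>\<tau> l e. 0 < \<tau> \<Longrightarrow> \<tau> < \<rho> / 2 \<Longrightarrow> 0 \<le> e \<Longrightarrow>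
      \<forall>y\<in>cball y0 (\<rho> / 2). f y (t0 - \<tau>) \<le> trig l y + e \<Longrightarrow> \<forall>y. - N - 1 \<le> trig l y \<Longrightarrow>
      f y0 t0 \<le> heat (v # \<Sigma>) l (y0, \<tau>) + e + (b p t0 + E) * \<tau> + Cf * \<tau>\<^sup>2"
    using rf(2)[OF \<rho>(1,2)] by blast
  obtain Cg where Cg: "\<And>\<tau> l e. 0 < \<tau> \<Longrightarrow> \<tau> < \<rho> / 2 \<Longrightarrow> 0 \<le> e \<Longrightarrow>
      \<forall>y\<in>cball x0 (\<rho> / 2). g y (t0 - \<tau>) \<le> trig l y + e \<Longrightarrow> \<forall>y. - N - 1 \<le> trig l y \<Longrightarrow>
      g x0 t0 \<le> heat (v # \<Sigma>) l (x0, \<tau>) + e + (- b p t0 + E) * \<tau> + Cg * \<tau>\<^sup>2"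
    using rg(2)[OF \<rho>(1,3)] by blast
  define R where "R = \<rho> / 2"
  have R: "0 < R" "R \<le> r" "R \<le> 1" using \<rho> by (auto simp: R_def)
  define \<Theta> where "\<Theta> = (v, - v) # map (\<lambda>\<sigma>. (\<sigma>, \<sigma>)) \<Sigma>"
  define \<Xi> where "\<Xi> = 4 * \<alpha> * D + 4 * \<eta> * trace_sq (v # \<Sigma>)"
  define F where "F = f y0 t0 + g x0 t0"
  define Q where "Q = two_point_fun e F P D C \<eta> y0 x0"
  have Q: "elementary Q" unfolding Q_def by (rule elementary_two_point_fun)
  have Q_time: "Q (z, s) = Q (z, 0)" for z s by (simp add: Q_def two_point_fun_def)
  have "compact (Q ` (cball (y0, x0) R \<times> {0}))"
    by (intro compact_continuous_image elementary_continuous Q compact_Times) auto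
  then obtain MQ where "\<forall>q\<in>Q ` (cball (y0, x0) R \<times> {0}). \<bar>q\<bar> \<le> MQ"
    using compact_imp_bounded bounded_real by metis
  then have MQ: "\<And>z. z \<in> cball (y0, x0) R \<Longrightarrow> \<bar>Q (z, 0)\<bar> \<le> MQ" by blast
  \<comment> \<open>On the lateral boundary the barrier must outweigh 2 N from the two flows, MQ
    from the majorant, and the terms linear in time; this is independent of \<tau> and of the
    approximation.\<close>
  define CC where "CC = (2 * N + 2 + MQ + \<bar>c1\<bar> * R + \<bar>\<Xi>\<bar> * R) / R ^ 4"
  have N: "0 \<le> N" by (rule order_trans[OF abs_ge_zero f.bdd[OF t0T]])
  have MQ0: "0 \<le> MQ" using order_trans[OF abs_ge_zero MQ[of "(y0, x0)"]] R by simp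
  have CC: "0 \<le> CC" "CC * R ^ 4 = 2 * N + 2 + MQ + \<bar>c1\<bar> * R + \<bar>\<Xi>\<bar> * R"
    using R N MQ0 by (auto simp: CC_def)
  define K where "K = 12 * CC * (trace_sq \<Theta>)\<^sup>2 + Cf + Cg"
  have ineq: "c1 - \<Xi> - 2 * E \<le> K * \<tau>" if \<tau>: "0 < \<tau>" "\<tau> < R" for \<tau>
  proof -
    have tT: "t0 - \<tau> \<in> {0..T}" using \<tau> R r t0 by auto
    \<comment> \<open>The approximation error is counted four times: once in each mean value
      inequality, twice in comparing the initial data with the majorant. It tends to 0 at fixed
      \<tau>, since K is fixed beforehand.\<close>
    have step: "(c1 - \<Xi> - 2 * E) * \<tau> \<le> K * \<tau> * \<tau> + 4 * e'" if e': "0 < e'" "e' \<le> 1" for e'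
    proof -
      have slice: "continuous_on UNIV (\<lambda>y. h y (t0 - \<tau>))"
        if "continuous_on (UNIV \<times> {0..T}) (\<lambda>(x, t). h x t)" for h :: "real^'n \<Rightarrow> real \<Rightarrow> real"
      proof -
        have "continuous_on UNIV (\<lambda>y. (\<lambda>(x, t). h x t) (y, t0 - \<tau>))"
          by (rule continuous_on_compose2[OF that]) (use tT in \<open>auto intro!: continuous_intros\<close>)
        then show ?thesis by simp
      qed
      obtain l1 where l1: "\<And>y. y \<in> cball y0 1 \<Longrightarrow> \<bar>trig l1 y - f y (t0 - \<tau>)\<bar> \<le> e'" "\<And>y. \<bar>trig l1 y\<bar> \<le> N + e'"
        using trig_approximation[OF slice[OF f.supconv_continuous] f.supconv_bounded[OF tT] e'(1)]
        unfolding f_def by metis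
      obtain l2 where l2: "\<And>y. y \<in> cball x0 1 \<Longrightarrow> \<bar>trig l2 y - g y (t0 - \<tau>)\<bar> \<le> e'" "\<And>y. \<bar>trig l2 y\<bar> \<le> N + e'"
        using trig_approximation[OF slice[OF g.supconv_continuous] g.supconv_bounded[OF tT] e'(1)]
        unfolding g_def by metis
      have n1: "f y (t0 - \<tau>) \<le> trig l1 y + e'" "trig l1 y \<le> f y (t0 - \<tau>) + e'" if "dist y0 y \<le> R" for y
        using l1(1)[of y] R that by (auto simp: abs_le_iff)
      have n2: "g y (t0 - \<tau>) \<le> trig l2 y + e'" "trig l2 y \<le> g y (t0 - \<tau>) + e'" if "dist x0 y \<le> R" for y
        using l2(1)[of y] R that by (auto simp: abs_le_iff)
      have b1: "trig l1 y \<le> N + e'" "- N - 1 \<le> trig l1 y" for y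
        using l1(2)[of y] e' unfolding abs_le_iff by linarith+
      have b2: "trig l2 y \<le> N + e'" "- N - 1 \<le> trig l2 y" for y
        using l2(2)[of y] e' unfolding abs_le_iff by linarith+
      have f1: "f y0 t0 \<le> heat (v # \<Sigma>) l1 (y0, \<tau>) + e' + (b p t0 + E) * \<tau> + Cf * \<tau>\<^sup>2"
      proof (rule Cf)
        show "\<forall>y\<in>cball y0 (\<rho> / 2). f y (t0 - \<tau>) \<le> trig l1 y + e'"
          unfolding R_def[symmetric] using n1(1) by simp
        show "\<forall>y. - N - 1 \<le> trig l1 y"
          using b1(2) by blast
      qed (use \<tau> e' in \<open>auto simp: R_def\<close>)
      have g1: "g x0 t0 \<le> heat (v # \<Sigma>) l2 (x0, \<tau>) + e' + (- b p t0 + E) * \<tau> + Cg * \<tau>\<^sup>2"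
      proof (rule Cg)
        show "\<forall>y\<in>cball x0 (\<rho> / 2). g y (t0 - \<tau>) \<le> trig l2 y + e'"
          unfolding R_def[symmetric] using n2(1) by simp
        show "\<forall>y. - N - 1 \<le> trig l2 y"
          using b2(2) by blast
      qed (use \<tau> e' in \<open>auto simp: R_def\<close>)
      define l where "l = map (\<lambda>(c, k, \<theta>). (c, (k, 0 :: real^'n), \<theta>)) l1 @ map (\<lambda>(c, k, \<theta>). (c, (0 :: real^'n, k), \<theta>)) l2"
      have heat_l: "heat \<Theta> l ((y, x), s) = heat (v # \<Sigma>) l1 (y, s) + heat (v # \<Sigma>) l2 (x, s)" for y x s
        unfolding \<Theta>_def l_def by (rule heat_coupled)
      have trig_l: "trig l (y, x) = trig l1 y + trig l2 x" for y x
        using heat_l[of y x 0] by simp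
      \<comment> \<open>The majorant is constant in time; the slope \<open>c1\<close> enters through
        the additive constant, because the data are taken at t0 - \<tau>, where \<open>H\<close>
        contributes - c1 \<tau>.\<close>
      have "heat \<Theta> l ((y0, x0), \<tau>) \<le> Q ((y0, x0), \<tau>) + (2 * e' - c1 * \<tau>) + \<Xi> * \<tau> + 12 * CC * (trace_sq \<Theta>)\<^sup>2 * \<tau>\<^sup>2"
      proof (rule heat_le_supersolution[OF Q, where r = R])
        show "generator \<Theta> Q z \<le> \<Xi>" for z
          unfolding \<Theta>_def Q_def \<Xi>_def using generator_two_point_fun[OF e v_def \<alpha>] by simp
        show "pdir Q (0, 1) z = 0" for z
          unfolding Q_def by (rule two_point_fun_derivatives)
        fix z assume z: "z \<in> cball (y0, x0) R"
        obtain y x where yx: "z = (y, x)" by (cases z)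
        define h where "h = y - y0"
        define k where "k = x - x0"
        have hk: "norm h \<le> R" "norm k \<le> R"
          using dist_fst_le[of "(y0, x0)" z] dist_snd_le[of "(y0, x0)" z] z
          by (auto simp: yx h_def k_def dist_norm norm_minus_commute)
        have "f (y0 + h) (t0 - \<tau>) + g (x0 + k) (t0 - \<tau>) \<le> F + P * (e \<bullet> (h - k)) + aniso e D C (h - k)
            + \<eta> * (h \<bullet> h + k \<bullet> k) + c1 * (t0 - \<tau> - t0)"
          unfolding F_def by (rule H) (use hk R \<tau> in auto)
        also have "\<dots> = Q (z, 0) - c1 * \<tau>"
          by (simp add: Q_def two_point_fun_def yx h_def k_def)
        finally have "f y (t0 - \<tau>) + g x (t0 - \<tau>) \<le> Q (z, 0) - c1 * \<tau>" by (simp add: h_def k_def)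
        moreover have "trig l1 y \<le> f y (t0 - \<tau>) + e'"
          using n1(2)[of y] hk by (simp add: h_def dist_norm norm_minus_commute)
        moreover have "trig l2 x \<le> g x (t0 - \<tau>) + e'"
          using n2(2)[of x] hk by (simp add: k_def dist_norm norm_minus_commute)
        ultimately show "trig l z \<le> Q (z, 0) + (2 * e' - c1 * \<tau>)"
          by (simp add: yx trig_l)
      next
        fix z s assume z: "dist z (y0, x0) = R" and s: "0 \<le> s" "s \<le> \<tau>"
        obtain y x where yx: "z = (y, x)" by (cases z)
        have "heat (v # \<Sigma>) l1 (y, s) \<le> N + e'"
          by (rule heat_upper_bound[OF _ s(1)]) (rule b1(1))
        moreover have "heat (v # \<Sigma>) l2 (x, s) \<le> N + e'"
          by (rule heat_upper_bound[OF _ s(1)]) (rule b2(1))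
        moreover have "- MQ \<le> Q (z, s)"
          using MQ[of z] z by (simp add: Q_time[of z s] dist_commute abs_le_iff)
        moreover have "\<bar>c1\<bar> * \<tau> \<le> \<bar>c1\<bar> * R" "\<bar>\<Xi>\<bar> * s \<le> \<bar>\<Xi>\<bar> * R" using \<tau> s by (auto intro: mult_left_mono)
        moreover have "c1 * \<tau> \<le> \<bar>c1\<bar> * \<tau>" "- \<Xi> * s \<le> \<bar>\<Xi>\<bar> * s"
          by (rule mult_right_mono; use \<tau> s in linarith)+
        ultimately show "heat \<Theta> l (z, s) \<le> Q (z, s) + (2 * e' - c1 * \<tau>) + \<Xi> * s + CC * R ^ 4"
          using e' unfolding yx heat_l CC(2) by linarith
      qed (use R CC \<tau> in auto)
      moreover have "Q ((y0, x0), \<tau>) = F" by (simp add: Q_def two_point_fun_def aniso_def)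
      ultimately have "F \<le> F + 4 * e' - c1 * \<tau> + \<Xi> * \<tau> + 2 * E * \<tau> + 12 * CC * (trace_sq \<Theta>)\<^sup>2 * \<tau>\<^sup>2 + Cf * \<tau>\<^sup>2 + Cg * \<tau>\<^sup>2"
        using f1 g1 by (simp add: heat_l F_def algebra_simps)
      then show ?thesis by (simp add: K_def algebra_simps power2_eq_square)
    qed
    have "(c1 - \<Xi> - 2 * E) * \<tau> \<le> K * \<tau> * \<tau>"
    proof (rule field_le_epsilon)
      fix d :: real assume "0 < d"
      then have "0 < min 1 (d / 4)" "min 1 (d / 4) \<le> 1" "min 1 (d / 4) \<le> d / 4" by auto
      with step[of "min 1 (d / 4)"] show "(c1 - \<Xi> - 2 * E) * \<tau> \<le> K * \<tau> * \<tau> + d" by linarith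
    qed
    then show ?thesis using \<tau>(1) by simp
  qed
  have "c1 - \<Xi> - 2 * E \<le> 0"
  proof (rule field_le_epsilon)
    fix d :: real assume d: "0 < d"
    define \<tau> where "\<tau> = min (R / 2) (d / (\<bar>K\<bar> + 1))"
    have \<tau>: "0 < \<tau>" "\<tau> < R" using R d by (auto simp: \<tau>_def)
    have "K * \<tau> \<le> (\<bar>K\<bar> + 1) * (d / (\<bar>K\<bar> + 1))"
      using \<tau> by (intro mult_mono) (auto simp: \<tau>_def)
    then show "c1 - \<Xi> - 2 * E \<le> 0 + d" using ineq[OF \<tau>] by simp
  qed
  then show ?thesis by (simp add: \<Xi>_def E_def trace algebra_simps)
qed

text \<open>All regularisation is removed here, the total error \<delta> being split into two
  halves. The order of the choices matters: first \<eta> from the trace of A, then \<epsilon> from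
  \<eta>, then \<kappa> from \<epsilon>, because freezing costs \<kappa> times the semiconvexity
  constant 1 / \<epsilon>.\<close>

lemma two_point_differential_inequality:
  fixes A :: "real^'n \<Rightarrow> real \<Rightarrow> real^'n^'n" and b u :: "real^'n \<Rightarrow> real \<Rightarrow> real" and P :: real and e :: "real^'n"
  assumes unif: "uniformly_continuous_on (UNIV \<times> {0..T}) (\<lambda>(x, t). u x t)"
    and bdd: "\<And>x t. t \<in> {0..T} \<Longrightarrow> \<bar>u x t\<bar> \<le> N"
    and sub: "visc_sub A b T u" and super: "visc_super A b T u"
    and A_cont: "\<forall>i j. continuous_on (UNIV \<times> {0..T}) (\<lambda>(p, t). A p t $ i $ j)"
    and b_cont: "continuous_on (UNIV \<times> {0..T}) (\<lambda>(p, t). b p t)"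
    and A_sym: "\<forall>p. \<forall>t\<in>{0..T}. transpose (A p t) = A p t"
    and A_psd: "\<forall>p. \<forall>t\<in>{0..T}. \<forall>v. 0 \<le> v \<bullet> (A p t *v v)"
    and t0: "0 < t0" "t0 < T" and e: "norm e = 1" and \<alpha>: "0 \<le> \<alpha>"
    and A_lower: "\<And>v. \<alpha> * (e \<bullet> v)\<^sup>2 \<le> v \<bullet> (A (P *\<^sub>R e) t0 *v v)"
    and r: "0 < r" "r \<le> t0"
    and H: "\<And>h k t. norm h \<le> r \<Longrightarrow> norm k \<le> r \<Longrightarrow> t0 - r \<le> t \<Longrightarrow> t \<le> t0 \<Longrightarrow>
      u (y0 + h) t - u (x0 + k) t \<le> u y0 t0 - u x0 t0 + P * (e \<bullet> (h - k)) + aniso e D C (h - k) + c1 * (t - t0)"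
  shows "c1 \<le> 4 * \<alpha> * D"
proof (rule field_le_epsilon)
  fix \<delta> :: real assume \<delta>: "0 < \<delta>"
  define p where "p = P *\<^sub>R e"
  have p: "norm p = \<bar>P\<bar>" "p \<bullet> p = P\<^sup>2"
    using e by (auto simp: p_def power2_eq_square simp flip: power2_norm_eq_inner)
  define tr where "tr = (\<Sum>i\<in>UNIV. A p t0 $ i $ i)"
  have t0T: "t0 \<in> {0..T}" using t0 by simp
  have "0 \<le> A p t0 $ i $ i" for i
  proof -
    have "0 \<le> axis i 1 \<bullet> (A p t0 *v axis i 1)" using A_psd t0T by blast
    then show ?thesis by (simp add: matrix_vector_mult_basis column_def inner_axis')
  qed
  then have tr: "0 \<le> tr" unfolding tr_def by (intro sum_nonneg) auto
  define n where "n = real CARD('n)"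
  have n: "1 \<le> n" by (simp add: n_def Suc_le_eq)
  define \<eta> where "\<eta> = \<delta> / (8 * (tr + n))"
  have trn: "0 < tr + n" using tr n by simp
  have \<eta>: "0 < \<eta>" "4 * \<eta> * (tr + n) = \<delta> / 2"
  proof -
    define X where "X = tr + n"
    have "0 < X" using trn by (simp add: X_def)
    then show "0 < \<eta>" "4 * \<eta> * (tr + n) = \<delta> / 2"
      using \<delta> unfolding \<eta>_def X_def[symmetric] by auto
  qed
  define K where "K = \<bar>D\<bar> + 4 * \<bar>C\<bar>"
  have K: "0 \<le> K" by (simp add: K_def)
  define G where "G = 2 * (K + K\<^sup>2 / (2 * \<eta>)) + 1"
  have G: "0 < G" "K < G" "2 * (K + K\<^sup>2 / (2 * \<eta>)) \<le> G"
  proof -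
    have "0 \<le> K\<^sup>2 / (2 * \<eta>)" using \<eta> by simp
    then show "0 < G" "K < G" "2 * (K + K\<^sup>2 / (2 * \<eta>)) \<le> G" using K by (auto simp: G_def)
  qed
  have N: "0 \<le> N" by (rule order_trans[OF abs_ge_zero bdd[OF t0T]])
  \<comment> \<open>The first entry lets the penalty beat K and the constant from Young's
    inequality; the other two make the maximisers and the shift \<epsilon> P e no longer than r /
    4.\<close>
  define \<epsilon> where "\<epsilon> = Min {1 / (2 * G), (r / 4)\<^sup>2 / (2 * (2 * N + 1)), r / 4 / (\<bar>P\<bar> + 1)}"
  have \<epsilon>: "0 < \<epsilon>" "\<epsilon> \<le> 1 / (2 * G)" "\<epsilon> \<le> (r / 4)\<^sup>2 / (2 * (2 * N + 1))" "\<epsilon> \<le> r / 4 / (\<bar>P\<bar> + 1)"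
    using G r N by (auto simp: \<epsilon>_def)
  have \<epsilon>G: "G \<le> 1 / (2 * \<epsilon>)" using \<epsilon>(1,2) G(1) by (simp add: field_simps)
  have small: "norm (w - \<epsilon> *\<^sub>R q) \<le> r / 2"
    if "(norm w)\<^sup>2 \<le> 2 * \<epsilon> * (2 * N + 1)" "norm q = \<bar>P\<bar>" for w q :: "real^'n"
  proof -
    have "\<epsilon> * (2 * (2 * N + 1)) \<le> (r / 4)\<^sup>2" using \<epsilon>(3) N by (simp add: pos_le_divide_eq)
    then have "(norm w)\<^sup>2 \<le> (r / 4)\<^sup>2" using that(1) by (simp add: algebra_simps)
    then have "norm w \<le> r / 4" by (rule power2_le_imp_le) (use r in simp)
    moreover have "\<epsilon> * (\<bar>P\<bar> + 1) \<le> r / 4" using \<epsilon>(4) by (subst (asm) pos_le_divide_eq) auto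
    then have "norm (\<epsilon> *\<^sub>R q) \<le> r / 4" using \<epsilon>(1) that(2) by (simp add: algebra_simps)
    ultimately show ?thesis using norm_triangle_ineq4[of w "\<epsilon> *\<^sub>R q"] by linarith
  qed
  have f: "bounded_subsolution A b T u N \<epsilon>"
    by unfold_locales (use unif bdd \<epsilon>(1) visc_sub_elementary[OF sub] in auto)
  have "uniformly_continuous_on (UNIV \<times> {0..T}) (\<lambda>(x, t). - u x t)"
    using uniformly_continuous_on_minus[OF unif] by (simp add: case_prod_unfold)
  then have g: "bounded_subsolution (\<lambda>p. A (- p)) (\<lambda>p t. - b (- p) t) T (\<lambda>x t. - u x t) N \<epsilon>"
    by unfold_locales (use bdd \<epsilon>(1) visc_super_elementary[OF super] in auto)
  interpret f: bounded_subsolution A b T u N \<epsilon> by (rule f)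
  interpret g: bounded_subsolution "\<lambda>p. A (- p)" "\<lambda>p t. - b (- p) t" T "\<lambda>x t. - u x t" N \<epsilon> by (rule g)
  have KG: "K < 1 / (2 * \<epsilon>)" using G(2) \<epsilon>G by linarith
  have touch_u: "u (y0 + h) t0 \<le> u y0 t0 + p \<bullet> h + K * (norm h)\<^sup>2" if "norm h \<le> r" for h
    using H[OF that, of 0 t0] aniso_bound(1)[OF e, of D C h] r by (simp add: p_def K_def)
  have touch_v: "- u (x0 + k) t0 \<le> - u x0 t0 + (- p) \<bullet> k + K * (norm k)\<^sup>2" if "norm k \<le> r" for k
    using H[OF _ that, of 0 t0] aniso_bound(1)[OF e, of D C "- k"] r by (simp add: p_def K_def)
  have half: "norm w \<le> r" if "norm w \<le> r / 2" for w :: "real^'n" using that r by simp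
  have small_u: "norm (w - \<epsilon> *\<^sub>R p) \<le> r" if "(norm w)\<^sup>2 \<le> 2 * \<epsilon> * (2 * N + 1)" for w
    by (rule half[OF small[OF that p(1)]])
  have small_v: "norm (w - \<epsilon> *\<^sub>R (- p)) \<le> r" if "(norm w)\<^sup>2 \<le> 2 * \<epsilon> * (2 * N + 1)" for w
    by (rule half[OF small[OF that]]) (simp add: p(1))
  have value_u: "supconv \<epsilon> u (y0 - \<epsilon> *\<^sub>R p) t0 = u y0 t0 - \<epsilon> * (p \<bullet> p) / 2"
    by (rule f.supconv_at_touching(1)[OF t0T touch_u KG small_u])
  have value_v: "supconv \<epsilon> (\<lambda>x t. - u x t) (x0 - \<epsilon> *\<^sub>R (- p)) t0 = - u x0 t0 - \<epsilon> * ((- p) \<bullet> (- p)) / 2"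
    by (rule g.supconv_at_touching(1)[OF t0T touch_v KG small_v])
  have unique_u: "\<exists>\<sigma>>0. \<forall>w. supconv \<epsilon> u (y0 - \<epsilon> *\<^sub>R p) t0 - \<sigma>
      \<le> u (y0 - \<epsilon> *\<^sub>R p + w) t0 - (norm w)\<^sup>2 / (2 * \<epsilon>) \<longrightarrow> norm (w - \<epsilon> *\<^sub>R p) \<le> \<theta>" if "0 < \<theta>" for \<theta>
    by (rule f.supconv_at_touching(2)[OF t0T touch_u KG small_u]) (use that in auto)
  have unique_v: "\<exists>\<sigma>>0. \<forall>w. supconv \<epsilon> (\<lambda>x t. - u x t) (x0 - \<epsilon> *\<^sub>R (- p)) t0 - \<sigma>
      \<le> - u (x0 - \<epsilon> *\<^sub>R (- p) + w) t0 - (norm w)\<^sup>2 / (2 * \<epsilon>) \<longrightarrow> norm (w - \<epsilon> *\<^sub>R (- p)) \<le> \<theta>" if "0 < \<theta>" for \<theta>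
    by (rule g.supconv_at_touching(2)[OF t0T touch_v KG small_v]) (use that in auto)
  define E where "E = (n + 1) / \<epsilon> + 1"
  define \<kappa> where "\<kappa> = min 1 (\<delta> / (4 * E))"
  have E: "0 < E" unfolding E_def using n \<epsilon>(1) by (simp add: add_pos_pos)
  have \<kappa>: "0 < \<kappa>" "\<kappa> \<le> 1" "2 * \<kappa> * E \<le> \<delta> / 2"
  proof -
    show "0 < \<kappa>" "\<kappa> \<le> 1" using \<delta> E by (auto simp: \<kappa>_def)
    have "\<kappa> \<le> \<delta> / (4 * E)" by (simp add: \<kappa>_def)
    then have "\<kappa> * (4 * E) \<le> \<delta>" using E by (subst (asm) pos_le_divide_eq) auto
    then show "2 * \<kappa> * E \<le> \<delta> / 2" by linarith
  qed
  have "c1 \<le> 4 * \<alpha> * D + 4 * \<eta> * ((\<Sum>i\<in>UNIV. A (P *\<^sub>R e) t0 $ i $ i) + CARD('n) * \<kappa>)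
    + 2 * \<kappa> * ((CARD('n) + 1) / \<epsilon> + 1)"
  proof (rule two_point_inequality[OF f g A_cont b_cont A_sym t0 \<kappa>(1) e \<alpha> A_lower])
    show "\<exists>\<sigma>>0. \<forall>w. supconv \<epsilon> u (y0 - \<epsilon> *\<^sub>R p) t0 - \<sigma> \<le> u (y0 - \<epsilon> *\<^sub>R p + w) t0 - (norm w)\<^sup>2 / (2 * \<epsilon>) \<longrightarrow>
        norm (w - \<epsilon> *\<^sub>R (P *\<^sub>R e)) \<le> \<theta>" if "0 < \<theta>" for \<theta>
      using unique_u[OF that] by (simp add: p_def)
    show "\<exists>\<sigma>>0. \<forall>w. supconv \<epsilon> (\<lambda>x t. - u x t) (x0 + \<epsilon> *\<^sub>R p) t0 - \<sigma>
        \<le> - u (x0 + \<epsilon> *\<^sub>R p + w) t0 - (norm w)\<^sup>2 / (2 * \<epsilon>) \<longrightarrow>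
        norm (w - \<epsilon> *\<^sub>R (- (P *\<^sub>R e))) \<le> \<theta>" if "0 < \<theta>" for \<theta>
      using unique_v[OF that] by (simp add: p_def)
    show "0 < r / 2" "r / 2 \<le> t0" using r by auto
    fix h k :: "real^'n" and t
    assume hk: "norm h \<le> r / 2" "norm k \<le> r / 2" and t: "t0 - r / 2 \<le> t" "t \<le> t0"
    have tT: "t \<in> {0..T}" using t r t0 by auto
    have "supconv \<epsilon> u (y0 - \<epsilon> *\<^sub>R (P *\<^sub>R e) + h) t + supconv \<epsilon> (\<lambda>x t. - u x t) (x0 + \<epsilon> *\<^sub>R (P *\<^sub>R e) + k) t
      \<le> (u y0 t0 - u x0 t0 + c1 * (t - t0)) - \<epsilon> * P\<^sup>2 + P * (e \<bullet> (h - k)) + aniso e D C (h - k) + \<eta> * (h \<bullet> h + k \<bullet> k)"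
    proof (rule supconv_two_point[OF f g e \<eta>(1) tT _ K_def _ small hk])
      fix h k :: "real^'n" assume "norm h \<le> r" "norm k \<le> r"
      then show "u (y0 + h) t - u (x0 + k) t
          \<le> u y0 t0 - u x0 t0 + c1 * (t - t0) + P * (e \<bullet> (h - k)) + aniso e D C (h - k)"
        using H[of h k t] t r by simp
    qed (use G \<epsilon>G in linarith)
    moreover have "supconv \<epsilon> u (y0 - \<epsilon> *\<^sub>R p) t0 = u y0 t0 - \<epsilon> * P\<^sup>2 / 2"
      using value_u p by simp
    moreover have "supconv \<epsilon> (\<lambda>x t. - u x t) (x0 + \<epsilon> *\<^sub>R p) t0 = - u x0 t0 - \<epsilon> * P\<^sup>2 / 2"
      using value_v p by simp
    ultimately show "supconv \<epsilon> u (y0 - \<epsilon> *\<^sub>R p + h) t + supconv \<epsilon> (\<lambda>x t. - u x t) (x0 + \<epsilon> *\<^sub>R p + k) t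
      \<le> supconv \<epsilon> u (y0 - \<epsilon> *\<^sub>R p) t0 + supconv \<epsilon> (\<lambda>x t. - u x t) (x0 + \<epsilon> *\<^sub>R p) t0
        + P * (e \<bullet> (h - k)) + aniso e D C (h - k) + \<eta> * (h \<bullet> h + k \<bullet> k) + c1 * (t - t0)"
      unfolding p_def by linarith
  qed
  then have "c1 \<le> 4 * \<alpha> * D + 4 * \<eta> * (tr + n * \<kappa>) + 2 * \<kappa> * E"
    unfolding tr_def n_def p_def E_def by (simp add: add.commute)
  moreover have "4 * \<eta> * (tr + n * \<kappa>) \<le> 4 * \<eta> * (tr + n)"
    using \<kappa>(2) \<eta>(1) n by (intro mult_left_mono add_left_mono) auto
  ultimately show "c1 \<le> 4 * \<alpha> * D + \<delta>"
    using \<eta>(2) \<kappa>(3) by linarith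
qed

section \<open>Periodic functions and their modulus of continuity\<close>

lemma full_lattice_compact_domain:
  fixes \<Lambda> :: "(real^'n) set"
  assumes "full_lattice \<Lambda>"
  obtains K where "compact K" "\<And>x. \<exists>\<gamma>\<in>\<Lambda>. x + \<gamma> \<in> K"
proof -
  obtain B :: "real^'n^'n" where B: "invertible B" and \<Lambda>: "\<Lambda> = {B *v (\<chi> i. of_int (k i)) | k :: 'n \<Rightarrow> int. True}"
    using assms unfolding full_lattice_def by blast
  define K where "K = (\<lambda>v. B *v v) ` cbox 0 1"
  have "compact K" unfolding K_def
    by (intro compact_continuous_image linear_continuous_on matrix_vector_mul_bounded_linear compact_cbox)
  moreover have "\<exists>\<gamma>\<in>\<Lambda>. x + \<gamma> \<in> K" for x
  proof -
    obtain v where v: "x = B *v v"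
      using B by (metis invertible_def matrix_vector_mul_assoc matrix_vector_mul_lid)
    define k where "k = (\<lambda>i. - \<lfloor>v $ i\<rfloor>)"
    have "0 \<le> v $ i - of_int \<lfloor>v $ i\<rfloor> \<and> v $ i - of_int \<lfloor>v $ i\<rfloor> \<le> 1" for i
      by linarith
    then have "v + (\<chi> i. of_int (k i)) \<in> cbox 0 1"
      by (simp add: mem_box_cart k_def)
    moreover have "x + B *v (\<chi> i. of_int (k i)) = B *v (v + (\<chi> i. of_int (k i)))"
      by (simp add: v matrix_vector_right_distrib)
    ultimately show ?thesis by (auto simp: \<Lambda> K_def)
  qed
  ultimately show ?thesis by (rule that)
qed

lemma periodic_uniformly_continuous:
  fixes u :: "real^'n \<Rightarrow> real \<Rightarrow> real"
  assumes K: "compact K" "\<And>x. \<exists>\<gamma>\<in>\<Lambda>. x + \<gamma> \<in> K"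
    and per: "\<forall>\<gamma>\<in>\<Lambda>. \<forall>x. \<forall>t\<in>{0..T}. u (x + \<gamma>) t = u x t"
    and cont: "continuous_on (UNIV \<times> {0..T}) (\<lambda>(x, t). u x t)"
  shows "uniformly_continuous_on (UNIV \<times> {0..T}) (\<lambda>(x, t). u x t)"
    and "\<exists>N. \<forall>x. \<forall>t\<in>{0..T}. \<bar>u x t\<bar> \<le> N"
proof -
  \<comment> \<open>Enlarged by the unit ball, so that a single lattice translation brings both of
    two nearby points into the compact set.\<close>
  define K' where "K' = {x + y | x y. x \<in> K \<and> y \<in> cball 0 1}"
  have "compact K'" unfolding K'_def by (intro compact_sums K compact_cball)
  then have "compact (K' \<times> {0..T})" by (intro compact_Times) auto
  then have unif: "uniformly_continuous_on (K' \<times> {0..T}) (\<lambda>(x, t). u x t)"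
    by (intro compact_uniformly_continuous continuous_on_subset[OF cont]) auto
  show "uniformly_continuous_on (UNIV \<times> {0..T}) (\<lambda>(x, t). u x t)"
    unfolding uniformly_continuous_on_def
  proof (intro allI impI)
    fix e :: real assume "0 < e"
    then obtain d where d: "0 < d" "\<And>x x'. x \<in> K' \<times> {0..T} \<Longrightarrow> x' \<in> K' \<times> {0..T} \<Longrightarrow> dist x' x < d \<Longrightarrow>
        dist ((\<lambda>(x, t). u x t) x') ((\<lambda>(x, t). u x t) x) < e"
      using unif unfolding uniformly_continuous_on_def by metis
    show "\<exists>d>0. \<forall>x\<in>UNIV \<times> {0..T}. \<forall>x'\<in>UNIV \<times> {0..T}. dist x' x < d \<longrightarrow>
        dist (case x' of (x, t) \<Rightarrow> u x t) (case x of (x, t) \<Rightarrow> u x t) < e"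
    proof (intro exI[of _ "min d 1"] conjI ballI impI)
      fix p p' :: "(real^'n) \<times> real"
      assume p: "p \<in> UNIV \<times> {0..T}" "p' \<in> UNIV \<times> {0..T}" "dist p' p < min d 1"
      obtain x t x' t' where xt: "p = (x, t)" "p' = (x', t')" by (cases p; cases p')
      obtain \<gamma> where \<gamma>: "\<gamma> \<in> \<Lambda>" "x + \<gamma> \<in> K" using K(2) by blast
      have "dist x' x \<le> 1" using dist_fst_le[of p' p] p(3) by (simp add: xt)
      then have "x' - x \<in> cball 0 1" by (simp add: dist_norm norm_minus_commute)
      moreover have "x' + \<gamma> = (x + \<gamma>) + (x' - x)" by simp
      ultimately have "x' + \<gamma> \<in> K'" unfolding K'_def using \<gamma>(2) by blast
      moreover have "x + \<gamma> = (x + \<gamma>) + 0" by simp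
      then have "x + \<gamma> \<in> K'" unfolding K'_def using \<gamma>(2) by (metis (mono_tags, lifting) centre_in_cball mem_Collect_eq zero_le_one)
      moreover have "dist (x' + \<gamma>, t') (x + \<gamma>, t) < d" using p(3) by (simp add: xt dist_Pair_Pair)
      ultimately have "dist (u (x' + \<gamma>) t') (u (x + \<gamma>) t) < e"
        using d(2)[of "(x + \<gamma>, t)" "(x' + \<gamma>, t')"] p by (simp add: xt)
      then show "dist (case p' of (x, t) \<Rightarrow> u x t) (case p of (x, t) \<Rightarrow> u x t) < e"
        using per \<gamma>(1) p by (simp add: xt)
    qed (use d in auto)
  qed
  have "compact ((\<lambda>(x, t). u x t) ` (K \<times> {0..T}))"
    by (intro compact_continuous_image continuous_on_subset[OF cont] compact_Times K) auto
  then obtain N where N: "\<forall>q\<in>(\<lambda>(x, t). u x t) ` (K \<times> {0..T}). \<bar>q\<bar> \<le> N"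
    using compact_imp_bounded bounded_real by metis
  have "\<bar>u x t\<bar> \<le> N" if t: "t \<in> {0..T}" for x t
  proof -
    obtain \<gamma> where \<gamma>: "\<gamma> \<in> \<Lambda>" "x + \<gamma> \<in> K" using K(2) by blast
    then have "u (x + \<gamma>) t = u x t" "\<bar>u (x + \<gamma>) t\<bar> \<le> N" using per N t by force+
    then show ?thesis by simp
  qed
  then show "\<exists>N. \<forall>x. \<forall>t\<in>{0..T}. \<bar>u x t\<bar> \<le> N" by blast
qed

lemma modulus_upper:
  assumes "\<And>x. \<bar>u x t\<bar> \<le> N"
  shows "(u y t - u x t) / 2 \<le> modulus u (dist y x / 2) t"
  unfolding modulus_def
proof (rule cSup_upper)
  show "bdd_above {(u y' t - u x' t) / 2 |x' y'. dist y' x' / 2 = dist y x / 2}"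
  proof (rule bdd_aboveI[of _ N])
    fix q assume "q \<in> {(u y' t - u x' t) / 2 |x' y'. dist y' x' / 2 = dist y x / 2}"
    then obtain x' y' where "q = (u y' t - u x' t) / 2" by blast
    then show "q \<le> N" using assms[of x'] assms[of y'] by (simp add: abs_le_iff)
  qed
qed blast

lemma modulus_attained:
  fixes u :: "real^'n \<Rightarrow> real \<Rightarrow> real"
  assumes K: "compact K" "\<And>x. \<exists>\<gamma>\<in>\<Lambda>. x + \<gamma> \<in> K"
    and per: "\<forall>\<gamma>\<in>\<Lambda>. \<forall>x. \<forall>t\<in>{0..T}. u (x + \<gamma>) t = u x t"
    and cont: "continuous_on (UNIV \<times> {0..T}) (\<lambda>(x, t). u x t)" and t: "t \<in> {0..T}" and s: "0 \<le> s"
  obtains x y where "dist y x / 2 = s" "modulus u s t = (u y t - u x t) / 2"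
proof -
  have cont_t: "continuous_on S (\<lambda>z. u (h z) t)" if "continuous_on S h" for S :: "((real^'n) \<times> (real^'n)) set" and h
  proof -
    have "continuous_on S (\<lambda>z. (\<lambda>(x, t). u x t) (h z, t))"
      by (rule continuous_on_compose2[OF cont]) (use t that in \<open>auto intro!: continuous_intros\<close>)
    then show ?thesis by simp
  qed
  \<comment> \<open>Pairs are parametrised by base point and displacement: periodicity moves the
    base point into K, while the displacement ranges over a sphere anyway.\<close>
  define S where "S = K \<times> sphere (0 :: real^'n) (2 * s)"
  have "compact S" unfolding S_def by (intro compact_Times K) auto
  moreover have "continuous_on S (\<lambda>z. u (fst z + snd z) t - u (fst z) t)"
    by (intro continuous_on_diff cont_t continuous_intros)
  moreover have "S \<noteq> {}"
  proof -
    obtain d :: "real^'n" where "norm d = 2 * s" using vector_choose_size[of "2 * s"] s by auto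
    moreover obtain x where "x \<in> K" using K(2)[of 0] by blast
    ultimately show ?thesis using s by (auto simp: S_def)
  qed
  ultimately obtain z where z: "z \<in> S" "\<And>z'. z' \<in> S \<Longrightarrow> u (fst z' + snd z') t - u (fst z') t \<le> u (fst z + snd z) t - u (fst z) t"
    using continuous_attains_sup[of S "\<lambda>z. u (fst z + snd z) t - u (fst z) t"] by blast
  define x where "x = fst z"
  define y where "y = fst z + snd z"
  have d: "dist y x / 2 = s" using z(1) by (auto simp: x_def y_def S_def dist_norm)
  have "modulus u s t = (u y t - u x t) / 2"
    unfolding modulus_def
  proof (rule cSup_eq_maximum)
    show "(u y t - u x t) / 2 \<in> {(u y t - u x t) / 2 |x y. dist y x / 2 = s}" using d by blast
    fix q assume "q \<in> {(u y t - u x t) / 2 |x y. dist y x / 2 = s}"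
    then obtain x' y' where q: "q = (u y' t - u x' t) / 2" "dist y' x' / 2 = s" by blast
    obtain \<gamma> where \<gamma>: "\<gamma> \<in> \<Lambda>" "x' + \<gamma> \<in> K" using K(2) by blast
    have "(x' + \<gamma>, y' - x') \<in> S" using \<gamma>(2) q(2) by (auto simp: S_def dist_norm norm_minus_commute)
    from z(2)[OF this] have "u (y' + \<gamma>) t - u (x' + \<gamma>) t \<le> u y t - u x t"
      by (simp add: x_def y_def add.commute)
    then show "q \<le> (u y t - u x t) / 2" using per \<gamma>(1) t q(1) by simp
  qed
  then show ?thesis using that d by blast
qed

text \<open>Only derivatives along the two axes enter: the mean value theorem in t at fixed s, then
  Taylor's formula in s at t0. Since t - t0 \<le> 0, lowering the time slope by \<eta> raises the
  bound, which is why the inequality is stated for past times.\<close>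

lemma smooth_on_taylor_upper:
  fixes \<phi> :: "real \<times> real \<Rightarrow> real"
  assumes U: "open U" "(s0, t0) \<in> U" and \<phi>: "smooth_on U \<phi>" and \<eta>: "0 < \<eta>"
  obtains r where "0 < r" "\<And>s t. \<bar>s - s0\<bar> \<le> r \<Longrightarrow> t0 - r \<le> t \<Longrightarrow> t \<le> t0 \<Longrightarrow>
    \<phi> (s, t) \<le> \<phi> (s0, t0) + pdir \<phi> (1, 0) (s0, t0) * (s - s0)
      + (pdir (pdir \<phi> (1, 0)) (1, 0) (s0, t0) + \<eta>) / 2 * (s - s0)\<^sup>2 + (dt \<phi> (s0, t0) - \<eta>) * (t - t0)"
proof -
  define ps where "ps = pdir \<phi> (1, 0)"
  define pss where "pss = pdir ps (1, 0)"
  define pt where "pt = pdir \<phi> (0, 1)"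
  have cont: "continuous_on U pss" "continuous_on U pt"
    using \<phi> unfolding smooth_on_def
    by (metis iter_pdir.simps pss_def ps_def) (metis \<phi> iter_pdir.simps pt_def smooth_on_def)
  have line: "((\<lambda>r. h (z + r *\<^sub>R v)) has_real_derivative pdir h v z) (at 0)"
    if "(\<lambda>s. h (z + s *\<^sub>R v)) differentiable (at 0)" for h :: "real \<times> real \<Rightarrow> real" and z v
    using that unfolding pdir_def by (simp add: DERIV_deriv_iff_real_differentiable)
  have d\<phi>: "((\<lambda>r. \<phi> (z + r *\<^sub>R v)) has_real_derivative pdir \<phi> v z) (at 0)" if "z \<in> U" for z v
    using \<phi> that unfolding smooth_on_def by (intro line) (metis iter_pdir.simps(1))
  have dps: "((\<lambda>r. ps (z + r *\<^sub>R v)) has_real_derivative pdir ps v z) (at 0)" if "z \<in> U" for z v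
    using \<phi> that unfolding smooth_on_def ps_def by (intro line) (metis iter_pdir.simps)
  have along_s: "((\<lambda>s. h (s, t)) has_real_derivative pdir h (1, 0) (s, t)) (at s)"
    if "((\<lambda>r. h ((s, t) + r *\<^sub>R (1, 0))) has_real_derivative pdir h (1, 0) (s, t)) (at 0)"
    for h :: "real \<times> real \<Rightarrow> real" and s t
    using that DERIV_at_within_shift[of "\<lambda>s. h (s, t)" "pdir h (1, 0) (s, t)" s 0 UNIV] by (simp add: add.commute)
  have along_t: "((\<lambda>t. h (s, t)) has_real_derivative pdir h (0, 1) (s, t)) (at t)"
    if "((\<lambda>r. h ((s, t) + r *\<^sub>R (0, 1))) has_real_derivative pdir h (0, 1) (s, t)) (at 0)"
    for h :: "real \<times> real \<Rightarrow> real" and s t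
    using that DERIV_at_within_shift[of "\<lambda>t. h (s, t)" "pdir h (0, 1) (s, t)" t 0 UNIV] by (simp add: add.commute)
  have "\<forall>\<^sub>F z in nhds (s0, t0). z \<in> U" using U by (simp add: eventually_nhds_in_open)
  moreover have near: "\<forall>\<^sub>F z in nhds (s0, t0). dist (h z) (h (s0, t0)) < \<eta>" if "continuous_on U h" for h :: "real \<times> real \<Rightarrow> real"
  proof -
    have "isCont h (s0, t0)" using that U by (simp add: continuous_on_eq_continuous_at)
    then show ?thesis using \<eta> unfolding continuous_at_eps_delta eventually_nhds_metric by (metis dist_commute)
  qed
  ultimately have "\<forall>\<^sub>F z in nhds (s0, t0). z \<in> U \<and> dist (pss z) (pss (s0, t0)) < \<eta> \<and> dist (pt z) (pt (s0, t0)) < \<eta>"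
    using near[OF cont(1)] near[OF cont(2)] by (intro eventually_conj)
  then obtain \<rho> where \<rho>: "0 < \<rho>" "\<And>z. dist z (s0, t0) < \<rho> \<Longrightarrow>
      z \<in> U \<and> \<bar>pss z - pss (s0, t0)\<bar> < \<eta> \<and> \<bar>pt z - pt (s0, t0)\<bar> < \<eta>"
    unfolding eventually_nhds_metric dist_real_def by blast
  define r where "r = \<rho> / 3"
  have box: "(s, t) \<in> U \<and> \<bar>pss (s, t) - pss (s0, t0)\<bar> < \<eta> \<and> \<bar>pt (s, t) - pt (s0, t0)\<bar> < \<eta>"
    if "\<bar>s - s0\<bar> \<le> r" "\<bar>t - t0\<bar> \<le> r" for s t
  proof (rule \<rho>(2))
    have "dist (s, t) (s0, t0) \<le> \<bar>s - s0\<bar> + \<bar>t - t0\<bar>"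
      unfolding dist_Pair_Pair dist_real_def by (rule order_trans[OF sqrt_sum_squares_le_sum]) auto
    then show "dist (s, t) (s0, t0) < \<rho>" using that \<rho>(1) by (simp add: r_def)
  qed
  show thesis
  proof (rule that[of r])
    show "0 < r" using \<rho>(1) by (simp add: r_def)
    fix s t assume s: "\<bar>s - s0\<bar> \<le> r" and t: "t0 - r \<le> t" "t \<le> t0"
    have time: "\<phi> (s, t) \<le> \<phi> (s, t0) + (pt (s0, t0) - \<eta>) * (t - t0)"
    proof (cases "t = t0")
      case False
      then have lt: "t < t0" using t by simp
      have "((\<lambda>t. \<phi> (s, t)) has_real_derivative pt (s, \<tau>)) (at \<tau>)" if "t \<le> \<tau>" "\<tau> \<le> t0" for \<tau>
        unfolding pt_def by (rule along_t[OF d\<phi>]) (use box[OF s, of \<tau>] that t in auto)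
      then obtain \<xi> where \<xi>: "t < \<xi>" "\<xi> < t0" "\<phi> (s, t0) - \<phi> (s, t) = (t0 - t) * pt (s, \<xi>)"
        using MVT2[OF lt, of "\<lambda>t. \<phi> (s, t)" "\<lambda>\<tau>. pt (s, \<tau>)"] by blast
      have "pt (s0, t0) - \<eta> \<le> pt (s, \<xi>)" using box[OF s, of \<xi>] \<xi> t by (auto simp: abs_less_iff)
      then have "(t0 - t) * (pt (s0, t0) - \<eta>) \<le> (t0 - t) * pt (s, \<xi>)" using lt by (intro mult_left_mono) auto
      then show ?thesis using \<xi>(3) by (simp add: algebra_simps)
    qed simp
    have space: "\<phi> (s, t0) \<le> \<phi> (s0, t0) + ps (s0, t0) * (s - s0) + (pss (s0, t0) + \<eta>) / 2 * (s - s0)\<^sup>2"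
    proof (cases "s = s0")
      case False
      define diff where "diff = (\<lambda>m :: nat. \<lambda>s. if m = 0 then \<phi> (s, t0) else if m = 1 then ps (s, t0) else pss (s, t0))"
      have r0: "0 \<le> r" using \<rho>(1) by (simp add: r_def)
      have "\<exists>\<xi>. (if s < s0 then s < \<xi> \<and> \<xi> < s0 else s0 < \<xi> \<and> \<xi> < s) \<and>
          \<phi> (s, t0) = (\<Sum>m<2. diff m s0 / fact m * (s - s0) ^ m) + diff 2 \<xi> / fact 2 * (s - s0) ^ 2"
      proof (rule Taylor[where a = "s0 - r" and b = "s0 + r"])
        show "\<forall>m \<tau>. m < 2 \<and> s0 - r \<le> \<tau> \<and> \<tau> \<le> s0 + r \<longrightarrow> (diff m has_real_derivative diff (Suc m) \<tau>) (at \<tau>)"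
        proof (intro allI impI, elim conjE)
          fix m :: nat and \<tau> assume m: "m < 2" and \<tau>: "s0 - r \<le> \<tau>" "\<tau> \<le> s0 + r"
          have \<tau>U: "(\<tau>, t0) \<in> U" using box[of \<tau> t0] \<tau> r0 by auto
          consider "m = 0" | "m = 1" using m by linarith
          then show "(diff m has_real_derivative diff (Suc m) \<tau>) (at \<tau>)"
            using along_s[OF d\<phi>[OF \<tau>U]] along_s[OF dps[OF \<tau>U]]
            by cases (simp_all add: diff_def ps_def pss_def)
        qed
      qed (use False s in \<open>auto simp: diff_def fun_eq_iff\<close>)
      then obtain \<xi> where between: "if s < s0 then s < \<xi> \<and> \<xi> < s0 else s0 < \<xi> \<and> \<xi> < s"
        and expand: "\<phi> (s, t0) = (\<Sum>m<2. diff m s0 / fact m * (s - s0) ^ m) + diff 2 \<xi> / fact 2 * (s - s0) ^ 2"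
        by blast
      have \<xi>: "\<bar>\<xi> - s0\<bar> \<le> r"
          "\<phi> (s, t0) = \<phi> (s0, t0) + ps (s0, t0) * (s - s0) + pss (\<xi>, t0) / 2 * (s - s0)\<^sup>2"
        using between s expand by (auto simp: diff_def numeral_2_eq_2 split: if_splits)
      have "pss (\<xi>, t0) / 2 \<le> (pss (s0, t0) + \<eta>) / 2" using box[OF \<xi>(1), of t0] r0 by (auto simp: abs_less_iff)
      then show ?thesis using \<xi>(2) by (simp add: mult_right_mono)
    qed simp
    show "\<phi> (s, t) \<le> \<phi> (s0, t0) + pdir \<phi> (1, 0) (s0, t0) * (s - s0)
      + (pdir (pdir \<phi> (1, 0)) (1, 0) (s0, t0) + \<eta>) / 2 * (s - s0)\<^sup>2 + (dt \<phi> (s0, t0) - \<eta>) * (t - t0)"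
      using time space by (simp add: dt_def ps_def pss_def pt_def)
  qed
qed

text \<open>In the transversal directions the crude bound \<open>C\<close> suffices, since the reflection coupling only sees the
  direction \<open>e\<close>.\<close>

lemma distance_expansion:
  fixes e d :: "'a::real_inner" and s0 p G :: real
  assumes e: "norm e = 1" and s0: "0 < s0" and d: "norm d \<le> min s0 1"
  defines "\<rho> \<equiv> norm ((2 * s0) *\<^sub>R e + d) / 2"
  shows "\<bar>\<rho> - s0\<bar> \<le> norm d / 2" "s0 / 2 \<le> \<rho>"
    and "2 * (p * (\<rho> - s0) + G / 2 * (\<rho> - s0)\<^sup>2)
      \<le> p * (e \<bullet> d) + aniso e (G / 2) ((2 * \<bar>p\<bar> + \<bar>G\<bar> * (1 + 1 / (4 * s0))) / (4 * s0)) d"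
proof -
  define a where "a = e \<bullet> d"
  define b2 where "b2 = d \<bullet> d - a\<^sup>2"
  define n where "n = norm ((2 * s0) *\<^sub>R e + d)"
  \<comment> \<open>The error of linearising half the norm. Here 2 \<delta> is the difference of n
    and 2 s0 + a, whose squares differ by b2; dividing by their sum, at least 2 s0, puts \<delta>
    between 0 and b2 / (4 s0), a purely transversal quantity.\<close>
  define \<delta> where "\<delta> = \<rho> - s0 - a / 2"
  have ee: "e \<bullet> e = 1" using e by (simp flip: power2_norm_eq_inner)
  have a: "\<bar>a\<bar> \<le> norm d" using Cauchy_Schwarz_ineq2[of e d] e by (simp add: a_def)
  have b2: "0 \<le> b2" "b2 \<le> 1"
  proof -
    have "a\<^sup>2 \<le> (norm d)\<^sup>2" using a power_mono[of "\<bar>a\<bar>" "norm d" 2] by simp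
    then show "0 \<le> b2" by (simp add: b2_def power2_norm_eq_inner)
    have "(norm d)\<^sup>2 \<le> 1\<^sup>2" using d by (intro power_mono) auto
    then show "b2 \<le> 1" by (simp add: b2_def power2_norm_eq_inner add_increasing2 algebra_simps)
  qed
  have "\<bar>n - norm ((2 * s0) *\<^sub>R e)\<bar> \<le> norm d"
    using norm_triangle_ineq3[of "(2 * s0) *\<^sub>R e + d" "(2 * s0) *\<^sub>R e"] by (simp add: n_def)
  then have n: "\<bar>n - 2 * s0\<bar> \<le> norm d" using e s0 by simp
  have \<rho>: "\<rho> = n / 2" by (simp add: \<rho>_def n_def)
  show "\<bar>\<rho> - s0\<bar> \<le> norm d / 2" using n by (simp add: \<rho> abs_le_iff field_simps)
  show "s0 / 2 \<le> \<rho>" using n d by (simp add: \<rho> abs_le_iff)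
  have "n\<^sup>2 = (2 * s0 + a)\<^sup>2 + b2"
    unfolding n_def power2_norm_eq_inner b2_def a_def
    by (simp add: inner_add_left inner_add_right ee inner_commute power2_eq_square algebra_simps)
  then have prod: "(n - (2 * s0 + a)) * (n + (2 * s0 + a)) = b2" by (simp add: power2_eq_square algebra_simps)
  have sum: "2 * s0 \<le> n + (2 * s0 + a)" using n a d by (simp add: abs_le_iff)
  have \<delta>: "0 \<le> \<delta>" "\<delta> \<le> b2 / (4 * s0)"
  proof -
    have two: "2 * \<delta> = n - (2 * s0 + a)" by (simp add: \<delta>_def \<rho> field_simps)
    then have prod': "2 * \<delta> * (n + (2 * s0 + a)) = b2" using prod by simp
    show nn: "0 \<le> \<delta>"
    proof (rule ccontr)
      assume "\<not> 0 \<le> \<delta>"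
      then have "2 * \<delta> * (n + (2 * s0 + a)) < 0" by (intro mult_neg_pos[of "2 * \<delta>"]) (use sum s0 in linarith)+
      then show False using prod' b2 by simp
    qed
    have "2 * \<delta> * (2 * s0) \<le> b2" using mult_left_mono[OF sum, of "2 * \<delta>"] nn prod' by simp
    then show "\<delta> \<le> b2 / (4 * s0)" using s0 by (simp add: field_simps)
  qed
  have \<delta>1: "\<delta> \<le> 1 / (4 * s0)" using order_trans[OF \<delta>(2) divide_right_mono[OF b2(2)]] s0 by simp
  have rs: "\<rho> - s0 = a / 2 + \<delta>" by (simp add: \<delta>_def)
  have t1: "2 * (p * (\<rho> - s0)) \<le> p * a + 2 * \<bar>p\<bar> * (b2 / (4 * s0))"
  proof -
    have "p * \<delta> \<le> \<bar>p\<bar> * \<delta>" using \<delta>(1) by (intro mult_right_mono) auto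
    also have "\<dots> \<le> \<bar>p\<bar> * (b2 / (4 * s0))" using \<delta>(2) by (intro mult_left_mono) auto
    finally show ?thesis by (simp add: rs algebra_simps)
  qed
  have t2: "G * (\<rho> - s0)\<^sup>2 \<le> G * a\<^sup>2 / 4 + \<bar>G\<bar> * (1 + 1 / (4 * s0)) * (b2 / (4 * s0))"
  proof -
    have "\<bar>a + \<delta>\<bar> \<le> 1 + 1 / (4 * s0)" using a d \<delta> \<delta>1 by linarith
    then have "\<bar>a + \<delta>\<bar> * \<delta> \<le> (1 + 1 / (4 * s0)) * (b2 / (4 * s0))" using \<delta> by (intro mult_mono) auto
    then have "\<bar>G\<bar> * (\<bar>a + \<delta>\<bar> * \<delta>) \<le> \<bar>G\<bar> * ((1 + 1 / (4 * s0)) * (b2 / (4 * s0)))" by (rule mult_left_mono) simp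
    moreover have "G * ((a + \<delta>) * \<delta>) \<le> \<bar>G\<bar> * (\<bar>a + \<delta>\<bar> * \<delta>)"
      using abs_ge_self[of "G * ((a + \<delta>) * \<delta>)"] \<delta>(1) by (simp add: abs_mult)
    moreover have "G * (\<rho> - s0)\<^sup>2 = G * a\<^sup>2 / 4 + G * ((a + \<delta>) * \<delta>)"
      by (simp add: rs power2_eq_square algebra_simps)
    ultimately show ?thesis by (simp add: mult.assoc)
  qed
  have "2 * (p * (\<rho> - s0) + G / 2 * (\<rho> - s0)\<^sup>2) = 2 * (p * (\<rho> - s0)) + G * (\<rho> - s0)\<^sup>2" by simp
  also have "\<dots> \<le> p * a + 2 * \<bar>p\<bar> * (b2 / (4 * s0)) + (G * a\<^sup>2 / 4 + \<bar>G\<bar> * (1 + 1 / (4 * s0)) * (b2 / (4 * s0)))"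
    using t1 t2 by linarith
  also have "\<dots> = p * a + (G / 2 / 2 * a\<^sup>2 + (2 * \<bar>p\<bar> + \<bar>G\<bar> * (1 + 1 / (4 * s0))) / (4 * s0) * b2)"
    using s0 by (simp add: field_simps)
  finally show "2 * (p * (\<rho> - s0) + G / 2 * (\<rho> - s0)\<^sup>2)
      \<le> p * (e \<bullet> d) + aniso e (G / 2) ((2 * \<bar>p\<bar> + \<bar>G\<bar> * (1 + 1 / (4 * s0))) / (4 * s0)) d"
    by (simp add: aniso_def a_def b2_def)
qed

text \<open>For P \<noteq> 0 the factor P^2 cancels against the square of v p with p = P e, and
  directions orthogonal to e, which the infimum excludes, are covered by semi-definiteness. The
  bound on \<alpha> is given for R > 0 only, so a vanishing gradient is reached as a limit from the
  right, by continuity of A and \<alpha>.\<close>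

lemma ellipticity_lower_bound:
  fixes A :: "real^'n \<Rightarrow> real \<Rightarrow> real^'n^'n" and P :: real
  assumes A_cont: "\<forall>i j. continuous_on (UNIV \<times> {0..T}) (\<lambda>(p, t). A p t $ i $ j)"
    and A_psd: "\<forall>p. \<forall>t\<in>{0..T}. \<forall>v. 0 \<le> v \<bullet> (A p t *v v)"
    and \<alpha>_cont: "continuous_on ({0..} \<times> {0..T}) (\<lambda>(R, t). \<alpha> R t)"
    and \<alpha>_bound: "\<forall>R>0. \<forall>t\<in>{0..T}.
        \<alpha> R t \<le> R\<^sup>2 * Inf {(v \<bullet> (A p t *v v)) / (v \<bullet> p)\<^sup>2 | p v. norm p = R \<and> v \<bullet> p \<noteq> 0}"
    and t: "t \<in> {0..T}" and e: "norm e = 1"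
  shows "\<alpha> \<bar>P\<bar> t * (e \<bullet> v)\<^sup>2 \<le> v \<bullet> (A (P *\<^sub>R e) t *v v)"
proof -
  have nonzero: "\<alpha> \<bar>P\<bar> t * (e \<bullet> v)\<^sup>2 \<le> v \<bullet> (A (P *\<^sub>R e) t *v v)" if P: "P \<noteq> 0" for P
  proof (cases "v \<bullet> e = 0")
    case True
    then show ?thesis using A_psd t by (simp add: inner_commute)
  next
    case False
    define I where "I = {(v \<bullet> (A p t *v v)) / (v \<bullet> p)\<^sup>2 | p v. norm p = \<bar>P\<bar> \<and> v \<bullet> p \<noteq> 0}"
    have "(v \<bullet> (A (P *\<^sub>R e) t *v v)) / (v \<bullet> (P *\<^sub>R e))\<^sup>2 \<in> I"
      unfolding I_def using P False e by (intro CollectI exI[of _ "P *\<^sub>R e"] exI[of _ v]) auto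
    moreover have "bdd_below I"
      unfolding I_def using A_psd t by (intro bdd_belowI[of _ 0]) auto
    ultimately have "Inf I \<le> (v \<bullet> (A (P *\<^sub>R e) t *v v)) / (v \<bullet> (P *\<^sub>R e))\<^sup>2" by (rule cInf_lower)
    then have "P\<^sup>2 * Inf I \<le> P\<^sup>2 * ((v \<bullet> (A (P *\<^sub>R e) t *v v)) / (v \<bullet> (P *\<^sub>R e))\<^sup>2)" by (rule mult_left_mono) simp
    also have "\<dots> = (v \<bullet> (A (P *\<^sub>R e) t *v v)) / (v \<bullet> e)\<^sup>2"
      using P False by (simp add: power_mult_distrib)
    finally have "\<alpha> \<bar>P\<bar> t \<le> (v \<bullet> (A (P *\<^sub>R e) t *v v)) / (v \<bullet> e)\<^sup>2"
      using \<alpha>_bound[rule_format, of "\<bar>P\<bar>" t] P t unfolding I_def[symmetric] by simp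
    then show ?thesis using False by (simp add: pos_le_divide_eq inner_commute)
  qed
  show ?thesis
  proof (cases "P = 0")
    case True
    define g where "g = (\<lambda>R. v \<bullet> (A (R *\<^sub>R e) t *v v) - \<alpha> R t * (e \<bullet> v)\<^sup>2)"
    have A_line: "continuous_on {0..} (\<lambda>R. A (R *\<^sub>R e) t $ i $ j)" for i j
    proof -
      have c: "continuous_on (UNIV \<times> {0..T}) (\<lambda>(p, t). A p t $ i $ j)" using A_cont by blast
      have "continuous_on {0..} (\<lambda>R. (\<lambda>(p, t). A p t $ i $ j) (R *\<^sub>R e, t))"
        by (rule continuous_on_compose2[OF c]) (use t in \<open>auto intro!: continuous_intros\<close>)
      then show ?thesis by simp
    qed
    have \<alpha>_line: "continuous_on {0..} (\<lambda>R. \<alpha> R t)"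
    proof -
      have "continuous_on {0..} (\<lambda>R. (\<lambda>(R, t). \<alpha> R t) (R, t))"
        by (rule continuous_on_compose2[OF \<alpha>_cont]) (use t in \<open>auto intro!: continuous_intros\<close>)
      then show ?thesis by simp
    qed
    have "continuous_on {0..} g"
      unfolding g_def quadratic_form_sum by (intro continuous_intros A_line \<alpha>_line)
    then have "(g \<longlongrightarrow> g 0) (at 0 within {0..})" by (simp add: continuous_on_def)
    then have "(g \<longlongrightarrow> g 0) (at_right 0)" by (rule tendsto_within_subset) auto
    moreover have "\<forall>\<^sub>F R in at_right 0. 0 \<le> g R"
      using nonzero by (auto simp: g_def eventually_at_right_field intro!: exI[of _ 1])
         (metis abs_of_pos less_irrefl)
    ultimately have "0 \<le> g 0"
      by (intro tendsto_lowerbound[of g "g 0" "at_right 0"]) auto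
    then show ?thesis by (simp add: g_def True)
  qed (rule nonzero)
qed

theorem theorem1p1:
  fixes A :: "real^'n \<Rightarrow> real \<Rightarrow> real^'n^'n"
    and b :: "real^'n \<Rightarrow> real \<Rightarrow> real"
    and \<alpha> :: "real \<Rightarrow> real \<Rightarrow> real"
    and u :: "real^'n \<Rightarrow> real \<Rightarrow> real"
    and T :: real
  assumes T_pos: "T > 0"
    and A_cont: "\<forall>i j. continuous_on (UNIV \<times> {0..T}) (\<lambda>(p, t). A p t $ i $ j)"
    and b_cont: "continuous_on (UNIV \<times> {0..T}) (\<lambda>(p, t). b p t)"
    and A_sym: "\<forall>p. \<forall>t\<in>{0..T}. transpose (A p t) = A p t"
    and A_psd: "\<forall>p. \<forall>t\<in>{0..T}. \<forall>v. 0 \<le> v \<bullet> (A p t *v v)"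
    and \<alpha>_cont: "continuous_on ({0..} \<times> {0..T}) (\<lambda>(R, t). \<alpha> R t)"
    and \<alpha>_pos: "\<forall>R\<ge>0. \<forall>t\<in>{0..T}. \<alpha> R t > 0"
    and \<alpha>_bound: "\<forall>R>0. \<forall>t\<in>{0..T}.
        \<alpha> R t \<le> R\<^sup>2 * Inf {(v \<bullet> (A p t *v v)) / (v \<bullet> p)\<^sup>2 | p v. norm p = R \<and> v \<bullet> p \<noteq> 0}"
    and u_sol: "visc_solution A b T u"
    and u_periodic: "\<exists>\<Lambda>. full_lattice \<Lambda> \<and> (\<forall>\<gamma>\<in>\<Lambda>. \<forall>x. \<forall>t\<in>{0..T}. u (x + \<gamma>) t = u x t)"
  shows "\<forall>(\<phi> :: real \<times> real \<Rightarrow> real) s0 t0 U.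
           0 < s0 \<and> 0 < t0 \<and> t0 < T \<and> open U \<and> (s0, t0) \<in> U \<and> smooth_on U \<phi> \<and>
           (\<exists>e>0. \<forall>s t. (s, t) \<in> ball (s0, t0) e \<and> 0 < s \<and> 0 < t \<and> t < T \<longrightarrow>
                    modulus u s t - \<phi> (s, t) \<le> modulus u s0 t0 - \<phi> (s0, t0))
           \<longrightarrow> dt \<phi> (s0, t0) \<le> \<alpha> \<bar>pdir \<phi> (1, 0) (s0, t0)\<bar> t0 * pdir (pdir \<phi> (1, 0)) (1, 0) (s0, t0)"
proof (intro allI impI, elim conjE exE)
  fix \<phi> :: "real \<times> real \<Rightarrow> real" and s0 t0 :: real and U and \<mu> :: real
  assume s0: "0 < s0" and t0: "0 < t0" "t0 < T" and U: "open U" "(s0, t0) \<in> U" and \<phi>: "smooth_on U \<phi>"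
    and \<mu>: "0 < \<mu>"
    and max: "\<forall>s t. (s, t) \<in> ball (s0, t0) \<mu> \<and> 0 < s \<and> 0 < t \<and> t < T \<longrightarrow>
      modulus u s t - \<phi> (s, t) \<le> modulus u s0 t0 - \<phi> (s0, t0)"
  define P where "P = pdir \<phi> (1, 0) (s0, t0)"
  define \<phi>ss where "\<phi>ss = pdir (pdir \<phi> (1, 0)) (1, 0) (s0, t0)"
  define a where "a = \<alpha> \<bar>P\<bar> t0"
  have t0T: "t0 \<in> {0..T}" using t0 by simp
  have a: "0 \<le> a" using \<alpha>_pos t0T by (simp add: a_def less_imp_le)
  have cont: "continuous_on (UNIV \<times> {0..T}) (\<lambda>(x, t). u x t)"
    and sub: "visc_sub A b T u" and super: "visc_super A b T u"
    using u_sol unfolding visc_solution_def by auto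
  obtain \<Lambda> where \<Lambda>: "full_lattice \<Lambda>" and per: "\<forall>\<gamma>\<in>\<Lambda>. \<forall>x. \<forall>t\<in>{0..T}. u (x + \<gamma>) t = u x t"
    using u_periodic by blast
  obtain K where K: "compact K" "\<And>x. \<exists>\<gamma>\<in>\<Lambda>. x + \<gamma> \<in> K"
    using full_lattice_compact_domain[OF \<Lambda>] by blast
  note unif = periodic_uniformly_continuous(1)[OF K per cont]
  obtain N where N: "\<And>x t. t \<in> {0..T} \<Longrightarrow> \<bar>u x t\<bar> \<le> N"
    using periodic_uniformly_continuous(2)[OF K per cont] by blast
  obtain x0 y0 where xy: "dist y0 x0 / 2 = s0" "modulus u s0 t0 = (u y0 t0 - u x0 t0) / 2"
    using modulus_attained[OF K per cont t0T, of s0] s0 by (metis less_imp_le)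
  define e where "e = (1 / (2 * s0)) *\<^sub>R (y0 - x0)"
  have e: "norm e = 1" "y0 - x0 = (2 * s0) *\<^sub>R e"
    using xy(1) s0 by (auto simp: e_def dist_norm)
  have "dt \<phi> (s0, t0) \<le> a * \<phi>ss + (a + 1) * \<eta>" if \<eta>: "0 < \<eta>" for \<eta>
  proof -
    obtain r1 where r1: "0 < r1" and taylor: "\<And>s t. \<bar>s - s0\<bar> \<le> r1 \<Longrightarrow> t0 - r1 \<le> t \<Longrightarrow> t \<le> t0 \<Longrightarrow>
      \<phi> (s, t) \<le> \<phi> (s0, t0) + P * (s - s0) + (\<phi>ss + \<eta>) / 2 * (s - s0)\<^sup>2 + (dt \<phi> (s0, t0) - \<eta>) * (t - t0)"
      using smooth_on_taylor_upper[OF U \<phi> \<eta>] unfolding P_def \<phi>ss_def by blast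
    define G where "G = \<phi>ss + \<eta>"
    define C where "C = (2 * \<bar>P\<bar> + \<bar>G\<bar> * (1 + 1 / (4 * s0))) / (4 * s0)"
    \<comment> \<open>Displacements d = h - k have length at most 2 r, which must not exceed s0 or 1
      for \<open>distance_expansion\<close>; \<mu> / 3 keeps (\<rho>, t) in the ball of the local
      maximum, and t0 / 2 keeps t positive.\<close>
    define r where "r = Min {r1, \<mu> / 3, t0 / 2, s0 / 2, 1 / 2}"
    have r: "0 < r" "r \<le> r1" "r \<le> \<mu> / 3" "r \<le> t0 / 2" "r \<le> s0 / 2" "r \<le> 1 / 2"
      using r1 \<mu> t0 s0 by (auto simp: r_def)
    \<comment> \<open>Up to a constant, u(y) - u(x) is at most 2 \<phi>(|y - x| / 2), so the time
      slope doubles. Along e the argument moves by half of e d, so the second-order term is G (e d /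
      2)^2, which is the longitudinal part of \<open>aniso\<close> with D = G / 2.\<close>
    have "2 * (dt \<phi> (s0, t0) - \<eta>) \<le> 4 * a * (G / 2)"
    proof (rule two_point_differential_inequality[OF unif N sub super A_cont b_cont A_sym A_psd t0 e(1) a])
      show "a * (e \<bullet> v)\<^sup>2 \<le> v \<bullet> (A (P *\<^sub>R e) t0 *v v)" for v
        unfolding a_def by (rule ellipticity_lower_bound[OF A_cont A_psd \<alpha>_cont \<alpha>_bound t0T e(1)])
      show "0 < r" "r \<le> t0" using r t0 by auto
      fix h k :: "real^'n" and t assume hk: "norm h \<le> r" "norm k \<le> r" and t: "t0 - r \<le> t" "t \<le> t0"
      define d where "d = h - k"
      define \<rho> where "\<rho> = norm ((2 * s0) *\<^sub>R e + d) / 2"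
      have d: "norm d \<le> 2 * r" "norm d \<le> min s0 1"
        using norm_triangle_ineq4[of h k] hk r by (auto simp: d_def)
      note exp = distance_expansion[OF e(1) s0 d(2), folded \<rho>_def]
      have dist: "dist (y0 + h) (x0 + k) / 2 = \<rho>"
        using e(2) by (simp add: \<rho>_def d_def dist_norm algebra_simps)
      have \<rho>r: "\<bar>\<rho> - s0\<bar> \<le> r" using exp(1) d(1) by simp
      have "dist (\<rho>, t) (s0, t0) \<le> \<bar>\<rho> - s0\<bar> + \<bar>t - t0\<bar>"
        unfolding dist_Pair_Pair dist_real_def by (rule order_trans[OF sqrt_sum_squares_le_sum]) auto
      also have "\<dots> < \<mu>" using \<rho>r t r \<mu> by auto
      finally have "(\<rho>, t) \<in> ball (s0, t0) \<mu>" by (simp add: dist_commute)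
      moreover have tT: "0 < t" "t < T" using t r t0 by auto
      ultimately have "modulus u \<rho> t - \<phi> (\<rho>, t) \<le> modulus u s0 t0 - \<phi> (s0, t0)"
        using max exp(2) s0 by auto
      moreover have "(u (y0 + h) t - u (x0 + k) t) / 2 \<le> modulus u \<rho> t"
        using modulus_upper[of u t N "y0 + h" "x0 + k"] N[of t] tT unfolding dist by auto
      moreover have "\<phi> (\<rho>, t) \<le> \<phi> (s0, t0) + P * (\<rho> - s0) + G / 2 * (\<rho> - s0)\<^sup>2 + (dt \<phi> (s0, t0) - \<eta>) * (t - t0)"
        unfolding G_def by (rule taylor) (use \<rho>r r t in auto)
      moreover note exp(3)[of P G, folded C_def]
      ultimately show "u (y0 + h) t - u (x0 + k) t \<le> u y0 t0 - u x0 t0 + P * (e \<bullet> (h - k))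
          + aniso e (G / 2) C (h - k) + 2 * (dt \<phi> (s0, t0) - \<eta>) * (t - t0)"
        using xy(2) unfolding d_def by argo
    qed
    then show ?thesis by (simp add: G_def algebra_simps)
  qed
  then have "dt \<phi> (s0, t0) \<le> a * \<phi>ss + \<epsilon>" if "0 < \<epsilon>" for \<epsilon>
    using that[THEN divide_pos_pos, of "a + 1"] a by fastforce
  then have "dt \<phi> (s0, t0) \<le> a * \<phi>ss" by (rule field_le_epsilon)
  then show "dt \<phi> (s0, t0) \<le> \<alpha> \<bar>pdir \<phi> (1, 0) (s0, t0)\<bar> t0 * pdir (pdir \<phi> (1, 0)) (1, 0) (s0, t0)"
    by (simp add: a_def P_def \<phi>ss_def)
qed

end
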